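(* Let $p(z,w)\in\mathbb{C}[z,w]$ be a polynomial with no zeros in $U_2$ near $(0,0)$ which has a single irreducible Weierstrass factor at $(0,0)$ (occurring with multiplicity one), and whose zero set near $(0,0)$ is injectively parametrized by $$t\mapsto(ct^M,\phi(t)),\qquad t\in\mathbb{C}\text{ small},$$ where $M\ge1$, $|c|=1$, $\phi\in\mathbb{C}\{t\}$, $\phi(t)=it^{2M}+o(t^{2M})$, and $\phi$ is of isolated type with data $K$ and $\phi_0$ (defined in the context). Then the admissible numerator ideal $$\mathcal{I}_p^\infty=\{q\in\mathbb{C}\{z,w\}:\ q/p\text{ is bounded on }U_2\cap B((0,0),\epsilon)\text{ for some }\epsilon>0\}$$ is given by the product ideal $$\mathcal{I}_p^\infty=\left(w-\phi_0(\bar cz),\ z^{2(1+K)}\right)^M,$$ that is, the ideal of $\mathbb{C}\{z,w\}$ generated by $(w-\phi_0(\bar cz))^jz^{2(1+K)(M-j)}$, $j=0,\dots,M$.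
   Context: $U_2=\{(z,w)\in\mathbb{C}^2:\Im w>|z|^2\}$; $\mathbb{C}\{\cdot\}$ denotes convergent power series centered at the origin; $B((0,0),\epsilon)$ is the Euclidean ball. That $p$ has a single irreducible Weierstrass factor with the given parametrization means that near $(0,0)$, $p(z,w)=u(z,w)\prod_{j=1}^M\left(w-\phi(\nu^j(\bar cz)^{1/M})\right)$ with $u\in\mathbb{C}\{z,w\}$, $u(0,0)\ne0$, $\nu=e^{2\pi i/M}$. The series $L$ associated to $\phi$: since $\phi(t)=it^{2M}+o(t^{2M})$, one can write $\frac{it\phi'(t)}{-2M}=(\Phi(t))^{2M}$ with $\Phi$ analytic near $0$, $\Phi(0)=0$, $\Phi'(0)=1$; let $\Psi=\Phi^{-1}$ be the local inverse and $L(s)=\log(\Psi(s)/s)\in\mathbb{C}\{s\}$ with $L(0)=0$. In terms of $s$ (via $t=\Psi(s)=se^{L(s)}$) the curve is parametrized by $s\mapsto\left(cs^Me^{ML(s)},\ is^{2M}+2Mi\int_{[0,s]}x^{2M}L'(x)\,dx\right)$. Isolated type: $L(s)=iA_0(s^M)+s^{2MK}L_1(s)$ with $K\in\mathbb{N}$, $K\ge1$, $A_0\in\mathbb{R}[s]$ of degree less than $2K$, $L_1\in\mathbb{C}\{s\}$, $\Re L_1(0)>0$. In this case $\phi$ has the form $\phi(t)=\phi_0(t^M)+O(t^{2M(1+K)})$ for a (unique) polynomial $\phi_0\in\mathbb{C}[t]$ of degree less than $2(1+K)$; this is the $\phi_0$ in the claim. *)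

theory Defs
  imports
    "HOL-Analysis.Analysis"
    "HOL-Library.Landau_Symbols"
    "HOL-Algebra.Ideal_Product"
begin

definition U2 :: "(complex \<times> complex) set" where
  "U2 = {(z, w). Im w > (norm z)\<^sup>2}"

text \<open>Elements of \<open>\<complex>[z,w]\<close> have type \<^typ>\<open>complex poly poly\<close> and elements of \<open>\<complex>[[z,w]]\<close> have type
  \<^typ>\<open>complex fps fps\<close>.  In both cases the outer variable is \<open>w\<close> and the inner (coefficient) variable
  is \<open>z\<close>.\<close>

definition eval_poly2 :: "complex poly poly \<Rightarrow> complex \<Rightarrow> complex \<Rightarrow> complex" where
  "eval_poly2 p z w = poly (poly p [:w:]) z"

abbreviation coeff2 :: "complex fps fps \<Rightarrow> nat \<Rightarrow> nat \<Rightarrow> complex" where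
  "coeff2 f i j \<equiv> fps_nth (fps_nth f j) i"

definition convergent2 :: "complex fps fps \<Rightarrow> bool" where
  "convergent2 f \<longleftrightarrow>
     (\<exists>r>0. (\<lambda>(i, j). norm (coeff2 f i j) * r ^ i * r ^ j) summable_on (UNIV :: (nat \<times> nat) set))"

definition eval_fps2 :: "complex fps fps \<Rightarrow> complex \<Rightarrow> complex \<Rightarrow> complex" where
  "eval_fps2 f z w = (\<Sum>\<^sub>\<infinity>(i, j)\<in>UNIV. coeff2 f i j * z ^ i * w ^ j)"

text \<open>The ring \<open>\<complex>{z,w}\<close>.\<close>

definition conv_ring :: "complex fps fps ring" where
  "conv_ring = \<lparr>carrier = {f. convergent2 f}, monoid.mult = (*), one = 1, zero = 0, add = (+)\<rparr>"

definition z_fps2 :: "complex fps fps" where "z_fps2 = fps_const fps_X"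
definition w_fps2 :: "complex fps fps" where "w_fps2 = fps_X"

definition poly_in_z :: "complex poly \<Rightarrow> complex fps fps" where
  "poly_in_z f = fps_const (fps_of_poly f)"

text \<open>Being bounded for some \<open>\<epsilon>\<close> implies being bounded for every smaller \<open>\<epsilon>\<close>, so the values of
  \<^const>\<open>eval_fps2\<close> outside the domain of convergence are irrelevant.\<close>

definition admissible_numerators :: "complex poly poly \<Rightarrow> complex fps fps set" where
  "admissible_numerators p =
     {q \<in> carrier conv_ring.
        \<exists>\<epsilon>>0. bounded ((\<lambda>(z, w). eval_fps2 q z w / eval_poly2 p z w) ` (U2 \<inter> ball (0, 0) \<epsilon>))}"

text \<open>\<open>p(z,w) = u(z,w) \<Prod>\<^sub>j (w - \<phi>(\<nu>\<^sup>j (c\<^sup>* z)\<^bsup>1/M\<^esup>))\<close> near the origin.  The product does not depend on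
  the choice of the root, so the identity is required for every \<open>M\<close>-th root \<open>t\<close> of \<open>c\<^sup>* z\<close>.\<close>

definition single_weierstrass_factor ::
    "complex poly poly \<Rightarrow> nat \<Rightarrow> complex \<Rightarrow> complex fps \<Rightarrow> bool" where
  "single_weierstrass_factor p M c \<phi> \<longleftrightarrow>
     (\<exists>u\<in>carrier conv_ring. eval_fps2 u 0 0 \<noteq> 0 \<and>
        (\<exists>\<epsilon>>0. \<forall>z w t. (z, w) \<in> ball (0, 0) \<epsilon> \<longrightarrow> t ^ M = cnj c * z \<longrightarrow>
           eval_poly2 p z w =
             eval_fps2 u z w *
               (\<Prod>j=1..M. w - eval_fps \<phi> (exp (2 * of_real pi * \<i> / of_nat M) ^ j * t))))"

definition locally_inj_parametrizes ::
    "(complex \<Rightarrow> complex \<times> complex) \<Rightarrow> (complex \<times> complex) set \<Rightarrow> bool" where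
  "locally_inj_parametrizes \<gamma> Z \<longleftrightarrow>
     (\<exists>\<delta>>0. inj_on \<gamma> (ball 0 \<delta>) \<and> \<gamma> ` ball 0 \<delta> \<subseteq> Z \<and>
        (\<exists>\<epsilon>>0. Z \<inter> ball (0, 0) \<epsilon> \<subseteq> \<gamma> ` ball 0 \<delta>))"

text \<open>\<open>L\<close> is the series with \<open>L(s) = log (\<Psi>(s)/s)\<close>, \<open>L(0) = 0\<close>, where \<open>\<Psi> = \<Phi>\<^sup>-\<^sup>1\<close> and
  \<open>\<Phi>(t)\<^bsup>2M\<^esup> = i t \<phi>'(t) / (-2M)\<close>, \<open>\<Phi>'(0) = 1\<close>.  These conditions determine \<open>\<Phi>\<close> and \<open>L\<close> uniquely.\<close>

definition associated_series :: "nat \<Rightarrow> complex fps \<Rightarrow> complex fps \<Rightarrow> bool" where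
  "associated_series M \<phi> L \<longleftrightarrow>
     (\<exists>\<Phi>. fps_conv_radius \<Phi> > 0 \<and> fps_nth \<Phi> 0 = 0 \<and> fps_nth \<Phi> 1 = 1 \<and>
        \<Phi> ^ (2 * M) = fps_const (\<i> / (- 2 * of_nat M)) * fps_X * fps_deriv \<phi> \<and>
        fps_conv_radius L > 0 \<and> fps_nth L 0 = 0 \<and>
        fps_compose (fps_exp 1) L = fps_shift 1 (fps_inv \<Phi>))"

definition isolated_type :: "nat \<Rightarrow> complex fps \<Rightarrow> nat \<Rightarrow> bool" where
  "isolated_type M \<phi> K \<longleftrightarrow> K \<ge> 1 \<and>
     (\<exists>L (A0 :: real poly) L1. associated_series M \<phi> L \<and> degree A0 < 2 * K \<and>
        fps_conv_radius L1 > 0 \<and> Re (fps_nth L1 0) > 0 \<and>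
        L = fps_const \<i> * fps_compose (fps_of_poly (map_poly complex_of_real A0)) (fps_X ^ M) +
            fps_X ^ (2 * M * K) * L1)"

definition is_phi0 :: "nat \<Rightarrow> complex fps \<Rightarrow> nat \<Rightarrow> complex poly \<Rightarrow> bool" where
  "is_phi0 M \<phi> K \<phi>0 \<longleftrightarrow> degree \<phi>0 < 2 * (1 + K) \<and>
     (\<lambda>t. eval_fps \<phi> t - poly \<phi>0 (t ^ M)) \<in> O[at 0](\<lambda>t. t ^ (2 * M * (1 + K)))"

lemma convergent2_mono:
  assumes "(\<lambda>(i, j). norm (coeff2 f i j) * r ^ i * r ^ j) summable_on (UNIV :: (nat \<times> nat) set)"
    and "0 < s" "s \<le> r"
  shows "(\<lambda>(i, j). norm (coeff2 f i j) * s ^ i * s ^ j) summable_on (UNIV :: (nat \<times> nat) set)"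
  using assms(1)
proof (rule summable_on_comparison_test)
  fix x :: "nat \<times> nat"
  show "(case x of (i, j) \<Rightarrow> norm (coeff2 f i j) * s ^ i * s ^ j) \<le>
        (case x of (i, j) \<Rightarrow> norm (coeff2 f i j) * r ^ i * r ^ j)"
    using assms(2,3) by (auto intro!: mult_mono power_mono split: prod.split)
qed (use assms(2,3) in \<open>auto split: prod.split\<close>)

lemma convergent2_finite:
  assumes "finite {(i, j). coeff2 f i j \<noteq> 0}"
  shows "convergent2 f"
  unfolding convergent2_def
proof (intro exI[of _ 1] conjI)
  show "(\<lambda>(i, j). norm (coeff2 f i j) * 1 ^ i * 1 ^ j) summable_on UNIV"
    by (rule summable_on_cong_neutral[THEN iffD1, OF _ _ _ summable_on_finite[OF assms]]) auto
qed simp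

lemma convergent2_common:
  assumes "convergent2 f" "convergent2 g"
  obtains r where "r > 0"
    "(\<lambda>(i, j). norm (coeff2 f i j) * r ^ i * r ^ j) summable_on (UNIV :: (nat \<times> nat) set)"
    "(\<lambda>(i, j). norm (coeff2 g i j) * r ^ i * r ^ j) summable_on (UNIV :: (nat \<times> nat) set)"
proof -
  obtain r s where r: "r > 0"
      "(\<lambda>(i, j). norm (coeff2 f i j) * r ^ i * r ^ j) summable_on (UNIV :: (nat \<times> nat) set)"
    and s: "s > 0"
      "(\<lambda>(i, j). norm (coeff2 g i j) * s ^ i * s ^ j) summable_on (UNIV :: (nat \<times> nat) set)"
    using assms by (auto simp: convergent2_def)
  show ?thesis
    by (rule that[of "min r s"])
       (use r s in \<open>auto intro: convergent2_mono[OF r(2)] convergent2_mono[OF s(2)]\<close>)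
qed

lemma convergent2_add:
  assumes "convergent2 f" "convergent2 g"
  shows "convergent2 (f + g)"
proof -
  obtain r where r: "r > 0"
    "(\<lambda>(i, j). norm (coeff2 f i j) * r ^ i * r ^ j) summable_on (UNIV :: (nat \<times> nat) set)"
    "(\<lambda>(i, j). norm (coeff2 g i j) * r ^ i * r ^ j) summable_on (UNIV :: (nat \<times> nat) set)"
    using convergent2_common[OF assms] .
  have "(\<lambda>(i, j). norm (coeff2 (f + g) i j) * r ^ i * r ^ j) summable_on (UNIV :: (nat \<times> nat) set)"
    using summable_on_add[OF r(2,3)]
  proof (rule summable_on_comparison_test)
    fix x :: "nat \<times> nat"
    obtain i j where x: "x = (i, j)" by fastforce
    have "norm (coeff2 (f + g) i j) * (r ^ i * r ^ j) \<le>
          (norm (coeff2 f i j) + norm (coeff2 g i j)) * (r ^ i * r ^ j)"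
      using r(1) by (intro mult_right_mono) (auto simp: norm_triangle_ineq)
    thus "(case x of (i, j) \<Rightarrow> norm (coeff2 (f + g) i j) * r ^ i * r ^ j) \<le>
          (case x of (i, j) \<Rightarrow> norm (coeff2 f i j) * r ^ i * r ^ j) +
          (case x of (i, j) \<Rightarrow> norm (coeff2 g i j) * r ^ i * r ^ j)"
      by (simp add: x algebra_simps)
  qed (use r(1) in \<open>auto split: prod.split\<close>)
  thus ?thesis using r(1) by (auto simp: convergent2_def)
qed

lemma convergent2_uminus: "convergent2 f \<Longrightarrow> convergent2 (- f)"
  by (simp add: convergent2_def)

lemma convergent2_mult:
  assumes "convergent2 f" "convergent2 g"
  shows "convergent2 (f * g)"
proof -
  obtain r where r: "r > 0"
    "(\<lambda>(i, j). norm (coeff2 f i j) * r ^ i * r ^ j) summable_on (UNIV :: (nat \<times> nat) set)"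
    "(\<lambda>(i, j). norm (coeff2 g i j) * r ^ i * r ^ j) summable_on (UNIV :: (nat \<times> nat) set)"
    using convergent2_common[OF assms] .
  define F where "F = (\<lambda>x. case x of (i, j) \<Rightarrow> norm (coeff2 f i j) * r ^ i * r ^ j)"
  define G where "G = (\<lambda>x. case x of (i, j) \<Rightarrow> norm (coeff2 g i j) * r ^ i * r ^ j)"
  have nn: "F x \<ge> 0" "G x \<ge> 0" for x
    using r(1) by (auto simp: F_def G_def split: prod.split)
  define S where "S = (\<lambda>x. case x of (i::nat, j::nat) \<Rightarrow> {0..j} \<times> {0..i})"
  have "(\<lambda>(x, y). F x * G y) summable_on UNIV \<times> UNIV"
  proof (rule summable_on_SigmaI[where g = "\<lambda>x. F x * infsum G UNIV"])
    have G: "G summable_on UNIV" and F: "F summable_on UNIV"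
      using r by (simp_all add: F_def G_def)
    show "((\<lambda>y. case (x, y) of (x, y) \<Rightarrow> F x * G y) has_sum F x * infsum G UNIV) UNIV" for x
      using has_sum_cmult_right[OF has_sum_infsum[OF G]] by simp
    show "(\<lambda>x. F x * infsum G UNIV) summable_on UNIV"
      by (rule summable_on_cmult_left[OF F])
  qed (use nn in auto)
  moreover have "(\<lambda>(x, y). F x * G y) summable_on UNIV \<times> UNIV \<longleftrightarrow>
     (\<lambda>((i, j), (l, k)). F (k, l) * G (i - k, j - l)) summable_on Sigma UNIV S"
    by (rule summable_on_reindex_bij_witness[of _
          "\<lambda>((i, j), (l, k)). ((k, l), (i - k, j - l))"
          "\<lambda>((k, l), (m, n)). ((k + m, l + n), (l, k))"])
       (auto simp: S_def)
  ultimately have "(\<lambda>((i, j), (l, k)). F (k, l) * G (i - k, j - l)) summable_on Sigma UNIV S"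
    by simp
  hence "(\<lambda>x. \<Sum>\<^sub>\<infinity>y\<in>S x. (\<lambda>((i, j), (l, k)). F (k, l) * G (i - k, j - l)) (x, y)) summable_on UNIV"
    by (intro summable_on_Sigma_banach) simp
  hence sum: "(\<lambda>x. \<Sum>y\<in>S x. (\<lambda>((i, j), (l, k)). F (k, l) * G (i - k, j - l)) (x, y)) summable_on UNIV"
    by (simp add: S_def split: prod.split)
  have "(\<lambda>(i, j). norm (coeff2 (f * g) i j) * r ^ i * r ^ j) summable_on (UNIV :: (nat \<times> nat) set)"
    using sum
  proof (rule summable_on_comparison_test)
    fix x :: "nat \<times> nat"
    obtain i j where x: "x = (i, j)" by fastforce
    have "coeff2 (f * g) i j = (\<Sum>(l, k)\<in>S x. coeff2 f k l * coeff2 g (i - k) (j - l))"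
      by (simp add: x S_def fps_mult_nth fps_sum_nth sum.cartesian_product)
    hence "norm (coeff2 (f * g) i j) * (r ^ i * r ^ j) \<le>
        (\<Sum>(l, k)\<in>S x. norm (coeff2 f k l * coeff2 g (i - k) (j - l))) * (r ^ i * r ^ j)"
      using r(1) by (intro mult_right_mono) (auto intro!: sum_norm_le split: prod.split)
    also have "\<dots> = (\<Sum>(l, k)\<in>S x. F (k, l) * G (i - k, j - l))"
      unfolding sum_distrib_right
    proof (intro sum.cong refl)
      fix y assume "y \<in> S x"
      then obtain l k where y: "y = (l, k)" "l \<le> j" "k \<le> i" by (auto simp: S_def x)
      hence "r ^ i = r ^ k * r ^ (i - k)" "r ^ j = r ^ l * r ^ (j - l)"
        by (simp_all flip: power_add)
      thus "(case y of (l, k) \<Rightarrow> norm (coeff2 f k l * coeff2 g (i - k) (j - l))) * (r ^ i * r ^ j) =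
            (case y of (l, k) \<Rightarrow> F (k, l) * G (i - k, j - l))"
        by (simp add: y(1) F_def G_def norm_mult)
    qed
    finally show "(case x of (i, j) \<Rightarrow> norm (coeff2 (f * g) i j) * r ^ i * r ^ j) \<le>
        (\<Sum>y\<in>S x. (\<lambda>((i, j), (l, k)). F (k, l) * G (i - k, j - l)) (x, y))"
      by (simp add: x mult.assoc)
  qed (use r(1) in \<open>auto split: prod.split\<close>)
  thus ?thesis using r(1) by (auto simp: convergent2_def)
qed

lemma convergent2_poly_in_z: "convergent2 (poly_in_z f)"
proof (rule convergent2_finite)
  have "{(i, j). coeff2 (poly_in_z f) i j \<noteq> 0} \<subseteq> {..degree f} \<times> {0}"
    by (auto simp: poly_in_z_def le_degree split: if_splits)
  thus "finite {(i, j). coeff2 (poly_in_z f) i j \<noteq> 0}"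
    by (rule finite_subset) auto
qed

lemma convergent2_z: "convergent2 z_fps2"
  using convergent2_poly_in_z[of "[:0, 1:]"]
  by (simp add: poly_in_z_def z_fps2_def fps_of_poly_pCons)

lemma convergent2_w: "convergent2 w_fps2"
proof (rule convergent2_finite)
  have "{(i, j). coeff2 w_fps2 i j \<noteq> 0} \<subseteq> {0} \<times> {1}"
    by (auto simp: w_fps2_def fps_X_def split: if_splits)
  thus "finite {(i, j). coeff2 w_fps2 i j \<noteq> 0}"
    by (rule finite_subset) auto
qed

lemma cring_conv_ring: "cring conv_ring"
proof (rule cringI)
  have 0: "convergent2 0" and 1: "convergent2 1"
    using convergent2_poly_in_z[of 0] convergent2_poly_in_z[of 1] by (simp_all add: poly_in_z_def)
  show "abelian_group conv_ring"
    by (rule abelian_groupI)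
       (auto simp: conv_ring_def convergent2_add 0 add.assoc add.commute
             intro!: bexI[of _ "- f" for f] convergent2_uminus)
  show "Group.comm_monoid conv_ring"
    by (rule Group.comm_monoidI) (auto simp: conv_ring_def convergent2_mult 1 algebra_simps)
qed (auto simp: conv_ring_def algebra_simps)

end

(* Let N = 2(1+K), f(z) = phi_0(conj(c) z) and h = |w - f| + |z|^N.  Writing t = s exp(L(s)), the hypothesis
   Re L_1(0) > 0 gives |t|^(2M) - Im phi(t) >= kappa |s|^(MN): to first order in Im s^M the contributions of A_0
   to |t|^(2M) and to phi cancel, and the second-order term 2 (Im s^M)^2 absorbs the rest.  On U_2 this bounds
   |w - phi(t)| from below by a multiple of |z|^N, so each Weierstrass factor is comparable to h and |p| to h^M.
   The ideal is therefore contained in the admissible numerators.  Conversely, expand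
   q = sum_{j<M} a_j(z) (w - f)^j + (w - f)^M Q.  For real s = x > 0 the defect |t|^(2M) - Im phi(t) is O(x^(MN)),
   so the curves w = f(z) + i lambda x^(MN) with lambda large lie in U_2; there |q| = O(h^M) forces
   a_j(z) = O(z^(N(M-j))), that is, z^(N(M-j)) divides a_j. *)
theory Submission
  imports Defs "HOL-Complex_Analysis.Laurent_Convergence"
begin

text \<open>Write \<sigma> = s^M and y = Im \<sigma>. Integrating x^(2M) L'(x) turns a term x^m of L
  into m/(m+2M) x^(m+2M), so a term \<sigma>^n of A_0 enters phi with the factor n/(n+2). Up to a
  common factor it contributes |\<sigma>|^2 Im(\<sigma>^n) to |t|^(2M) and n/(n+2)
  Im(\<sigma>^(n+2)) to Im phi. Both equal n y Re(\<sigma>^(n+1)) up to O(y^2 |\<sigma>|^n); as A_0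
  is real, they cancel. The leading term of s^(2MK) L_1 enters phi with the factor K/(K+1), and the
  gap 1/(K+1) lets Re L_1(0) > 0 survive: for real s = x > 0 the defect is asymptotic to 2M Re
  L_1(0)/(K+1) x^(MN).

  The exponent N is tied to both sides: all M branches phi(t) with t^M = conj(c) z agree with f(z)
  up to O(|z|^N), and the defect is at least of that size. So one function h serves all branches.

  For the converse, curves with different lambda share the same z at each x, so q is there a
  polynomial in lambda up to O(x^(MNM)), and its coefficients can be separated.\<close>

section \<open>Powers of an ideal with two generators\<close>

context cring
begin

text \<open>The ideal quotient (J : X). It allows the minimality of a generated ideal to be applied
  to one factor of a product while the other is held fixed.\<close>

lemma colon_ideal:
  assumes J: "ideal J R" and X: "X \<subseteq> carrier R"
  shows "ideal {y \<in> carrier R. \<forall>x\<in>X. x \<otimes> y \<in> J} R"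
proof -
  interpret J: ideal J R by (rule J)
  show ?thesis
  proof (rule idealI)
    show "ring R" by (rule ring_axioms)
    show "subgroup {y \<in> carrier R. \<forall>x\<in>X. x \<otimes> y \<in> J} (add_monoid R)"
    proof (rule add.subgroupI)
      have "\<zero> \<in> {y \<in> carrier R. \<forall>x\<in>X. x \<otimes> y \<in> J}" using X by (auto simp: subset_iff)
      thus "{y \<in> carrier R. \<forall>x\<in>X. x \<otimes> y \<in> J} \<noteq> {}" by blast
    next
      fix a assume "a \<in> {y \<in> carrier R. \<forall>x\<in>X. x \<otimes> y \<in> J}"
      thus "\<ominus> a \<in> {y \<in> carrier R. \<forall>x\<in>X. x \<otimes> y \<in> J}"
        using X by (auto simp: subset_iff r_minus)
    next
      fix a b
      assume "a \<in> {y \<in> carrier R. \<forall>x\<in>X. x \<otimes> y \<in> J}" "b \<in> {y \<in> carrier R. \<forall>x\<in>X. x \<otimes> y \<in> J}"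
      thus "a \<oplus> b \<in> {y \<in> carrier R. \<forall>x\<in>X. x \<otimes> y \<in> J}"
        using X by (auto simp: subset_iff r_distr)
    qed auto
  next
    fix a x assume a: "a \<in> {y \<in> carrier R. \<forall>x\<in>X. x \<otimes> y \<in> J}" and x: "x \<in> carrier R"
    have "y \<otimes> (x \<otimes> a) = x \<otimes> (y \<otimes> a)" if "y \<in> X" for y
      using that a x X by (auto simp: subset_iff m_lcomm)
    thus "x \<otimes> a \<in> {y \<in> carrier R. \<forall>x\<in>X. x \<otimes> y \<in> J}"
      using a x by (auto simp: J.I_l_closed)
    thus "a \<otimes> x \<in> {y \<in> carrier R. \<forall>x\<in>X. x \<otimes> y \<in> J}"
      using a x by (simp add: m_comm)
  qed
qed

text \<open>Minimality is used twice: Idl T lies in the quotient (J : S), hence S lies in (J : Idl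
  T), and therefore so does Idl S.\<close>

lemma ideal_prod_genideal_subset:
  assumes S: "S \<subseteq> carrier R" and T: "T \<subseteq> carrier R" and J: "ideal J R"
    and ST: "\<And>s t. s \<in> S \<Longrightarrow> t \<in> T \<Longrightarrow> s \<otimes> t \<in> J"
  shows "(Idl S) \<cdot> (Idl T) \<subseteq> J"
proof
  interpret J: ideal J R by (rule J)
  have 1: "Idl T \<subseteq> {y \<in> carrier R. \<forall>x\<in>S. x \<otimes> y \<in> J}"
    by (rule genideal_minimal[OF colon_ideal[OF J S]]) (use T ST in auto)
  hence IT: "Idl T \<subseteq> carrier R" by blast
  have 2: "Idl S \<subseteq> {y \<in> carrier R. \<forall>x\<in>Idl T. x \<otimes> y \<in> J}"
    by (rule genideal_minimal[OF colon_ideal[OF J IT]])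
       (use S 1 in \<open>auto simp: subset_iff m_comm\<close>)
  fix x assume "x \<in> (Idl S) \<cdot> (Idl T)"
  thus "x \<in> J"
  proof induction
    case (prod i j)
    hence "j \<otimes> i \<in> J" "i \<in> carrier R" "j \<in> carrier R" using 1 2 by auto
    thus ?case by (simp add: m_comm)
  qed auto
qed

text \<open>Multiplying the monomials of degree M in a and b by a or by b yields exactly the
  monomials of degree M + 1.\<close>

lemma genideal_pair_power:
  fixes M :: nat
  assumes a: "a \<in> carrier R" and b: "b \<in> carrier R"
  shows "(Idl {a, b}) [^]\<^bsub>ideals_set R\<^esub> M = Idl {a [^] j \<otimes> b [^] (M - j) |j. j \<le> M}"
proof (induction M)
  case 0
  have "{a [^] j \<otimes> b [^] (0 - j) |j. j \<le> (0 :: nat)} = {\<one>}" by auto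
  thus ?case by (simp add: ideals_set_def genideal_one)
next
  case (Suc M)
  let ?G = "\<lambda>M. {a [^] j \<otimes> b [^] (M - j) |j. j \<le> (M :: nat)}"
  have G: "?G M \<subseteq> carrier R" for M using a b by auto
  have ab: "{a, b} \<subseteq> carrier R" using a b by auto
  have "(Idl (?G M)) \<cdot> (Idl {a, b}) = Idl (?G (Suc M))"
  proof
    show "(Idl (?G M)) \<cdot> (Idl {a, b}) \<subseteq> Idl (?G (Suc M))"
    proof (rule ideal_prod_genideal_subset[OF G ab genideal_ideal[OF G]])
      fix s t assume "s \<in> ?G M" "t \<in> {a, b}"
      then obtain j where j: "j \<le> M" "s = a [^] j \<otimes> b [^] (M - j)" and t: "t = a \<or> t = b" by auto
      from t have "s \<otimes> t \<in> ?G (Suc M)"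
      proof
        assume "t = a"
        hence "s \<otimes> t = a [^] Suc j \<otimes> b [^] (Suc M - Suc j)"
          using a b by (simp add: j m_ac)
        thus ?thesis using j by blast
      next
        assume "t = b"
        hence "s \<otimes> t = a [^] j \<otimes> b [^] (Suc M - j)"
          using a b j by (simp add: Suc_diff_le m_ac)
        thus ?thesis using j le_SucI by blast
      qed
      thus "s \<otimes> t \<in> Idl (?G (Suc M))" using genideal_self[OF G] by blast
    qed
    have "s \<in> (Idl (?G M)) \<cdot> (Idl {a, b})" if "s \<in> ?G (Suc M)" for s
    proof -
      from that obtain j where j: "j \<le> Suc M" "s = a [^] j \<otimes> b [^] (Suc M - j)" by blast
      have mem: "x \<in> ?G M \<Longrightarrow> y \<in> {a, b} \<Longrightarrow> x \<otimes> y \<in> (Idl (?G M)) \<cdot> (Idl {a, b})" for x y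
        using genideal_self[OF G, of M] genideal_self[OF ab] by (intro ideal_prod.prod) blast+
      show ?thesis
      \<comment> \<open>Every monomial of degree M + 1 except a^(M+1) contains a factor b that can
        be split off.\<close>
      proof (cases "j = Suc M")
        case True
        have "a [^] M \<otimes> b [^] (M - M) \<in> ?G M" by blast
        moreover have "s = (a [^] M \<otimes> b [^] (M - M)) \<otimes> a" using a by (simp add: j True)
        ultimately show ?thesis using mem by blast
      next
        case False
        hence "a [^] j \<otimes> b [^] (M - j) \<in> ?G M" using j by auto
        moreover have "s = (a [^] j \<otimes> b [^] (M - j)) \<otimes> b"
          using a b j False by (simp add: Suc_diff_le m_ac)
        ultimately show ?thesis using mem by blast
      qed
    qed
    thus "Idl (?G (Suc M)) \<subseteq> (Idl (?G M)) \<cdot> (Idl {a, b})"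
      by (intro genideal_minimal ideal_prod_is_ideal genideal_ideal G ab subsetI)
  qed
  moreover have "Idl {a, b} [^]\<^bsub>ideals_set R\<^esub> Suc M
      = (Idl {a, b} [^]\<^bsub>ideals_set R\<^esub> M) \<cdot> (Idl {a, b})"
    by (simp add: nat_pow_def ideals_set_def)
  ultimately show ?case using Suc by simp
qed

end

section \<open>Convergent power series in two variables and their values\<close>

lemma carrier_conv_ring [simp]: "f \<in> carrier conv_ring \<longleftrightarrow> convergent2 f"
  and mult_conv_ring [simp]: "f \<otimes>\<^bsub>conv_ring\<^esub> g = f * g"
  and add_conv_ring [simp]: "f \<oplus>\<^bsub>conv_ring\<^esub> g = f + g"
  and one_conv_ring [simp]: "\<one>\<^bsub>conv_ring\<^esub> = 1"
  and zero_conv_ring [simp]: "\<zero>\<^bsub>conv_ring\<^esub> = 0"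
  by (simp_all add: conv_ring_def)

lemma power_conv_ring [simp]: "f [^]\<^bsub>conv_ring\<^esub> (n::nat) = f ^ n"
  by (induction n) (simp_all add: nat_pow_def conv_ring_def mult.commute)

lemma convergent2_power: "convergent2 f \<Longrightarrow> convergent2 (f ^ n)"
  using monoid.nat_pow_closed[OF cring.axioms(1)[OF cring_conv_ring, THEN ring.is_monoid], of f n]
  by simp

lemma fps_conv_radius_ge_geometric:
  fixes a :: "complex fps"
  assumes "R > 0" and a: "\<And>n. norm (fps_nth a n) \<le> C * R ^ n"
  shows "fps_conv_radius a \<ge> ereal (1 / R)"
  unfolding fps_conv_radius_def
proof (rule conv_radius_geI_ex)
  fix r :: real assume r: "0 < r" "ereal r < ereal (1 / R)"
  hence lt: "norm (R * r) < 1" using assms(1) by (simp add: field_simps)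
  have "summable (\<lambda>n. fps_nth a n * of_real r ^ n)"
  proof (rule summable_comparison_test')
    show "summable (\<lambda>n. C * (R * r) ^ n)" using lt by (intro summable_mult summable_geometric)
    show "norm (fps_nth a n * of_real r ^ n) \<le> C * (R * r) ^ n" for n
      using mult_right_mono[OF a[of n], of "r ^ n"] r(1)
      by (simp add: norm_mult norm_power power_mult_distrib mult.assoc)
  qed
  thus "\<exists>z. norm z = r \<and> summable (\<lambda>n. fps_nth a n * z ^ n)"
    using r(1) by (intro exI[of _ "of_real r"]) simp
qed

lemma norm_eval_fps_le_geometric:
  fixes a :: "complex fps"
  assumes "R > 0" and a: "\<And>n. norm (fps_nth a n) \<le> C * R ^ n" and z: "norm z \<le> 1 / (2 * R)"
  shows "norm (eval_fps a z) \<le> 2 * C"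
proof -
  have C: "C \<ge> 0" using order_trans[OF norm_ge_zero a[of 0]] by simp
  have g: "(\<lambda>n. C * (1/2) ^ n) sums (C * 2)"
    using geometric_sums[of "1/2 :: real"] by (intro sums_mult) simp
  have le: "norm (fps_nth a n * z ^ n) \<le> C * (1/2) ^ n" for n
  proof -
    have "norm (fps_nth a n * z ^ n) \<le> C * R ^ n * (1 / (2 * R)) ^ n"
      unfolding norm_mult norm_power using a[of n] z C assms(1)
      by (intro mult_mono power_mono) auto
    also have "\<dots> = C * (1/2) ^ n" using assms(1) by (simp add: power_mult_distrib field_simps)
    finally show ?thesis .
  qed
  have "norm (eval_fps a z) \<le> (\<Sum>n. C * (1/2) ^ n)"
    unfolding eval_fps_def by (rule norm_suminf_le[OF le sums_summable[OF g]])
  also have "\<dots> = 2 * C" using sums_unique[OF g] by simp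
  finally show ?thesis .
qed

text \<open>Cauchy estimates as a form of convergence: they pass at once to shifts and to single
  rows of coefficients, and they can be proved by recursion.\<close>

definition geometric_bound2 :: "real \<Rightarrow> real \<Rightarrow> complex fps fps \<Rightarrow> bool" where
  "geometric_bound2 C R f \<longleftrightarrow> R > 0 \<and> (\<forall>i j. norm (coeff2 f i j) \<le> C * R ^ (i + j))"

lemma geometric_bound2_imp_summable:
  assumes "geometric_bound2 C R f" and s: "0 \<le> s" "s \<le> 1 / (2 * R)"
  shows "(\<lambda>(i, j). norm (coeff2 f i j) * s ^ i * s ^ j) summable_on (UNIV :: (nat \<times> nat) set)"
proof -
  have R: "R > 0" and a: "\<And>i j. norm (coeff2 f i j) \<le> C * R ^ (i + j)"
    using assms by (auto simp: geometric_bound2_def)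
  have C: "C \<ge> 0" using order_trans[OF norm_ge_zero a[of 0 0]] by simp
  have half: "((\<lambda>n. (1/2) ^ n) has_sum (2::real)) (UNIV :: nat set)"
    using geometric_sums[of "1/2 :: real"] by (intro norm_summable_imp_has_sum) auto
  have "(\<lambda>(i, j). C * (1/2) ^ i * (1/2::real) ^ j) summable_on (UNIV :: nat set) \<times> (UNIV :: nat set)"
  proof (rule summable_on_SigmaI)
    fix i :: nat
    show "((\<lambda>j. case (i, j) of (i, j) \<Rightarrow> C * (1/2) ^ i * (1/2) ^ j) has_sum (C * (1/2) ^ i * 2)) UNIV"
      using has_sum_cmult_right[OF half] by simp
    show "(\<lambda>i. C * (1/2) ^ i * 2) summable_on (UNIV :: nat set)"
      using has_sum_imp_summable[OF half] by (intro summable_on_cmult_left summable_on_cmult_right)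
  qed (use C in auto)
  hence "(\<lambda>(i, j). C * (1/2) ^ i * (1/2::real) ^ j) summable_on (UNIV :: (nat \<times> nat) set)" by simp
  thus ?thesis
  proof (rule summable_on_comparison_test)
    fix x :: "nat \<times> nat"
    obtain i j where x: "x = (i, j)" by fastforce
    have "norm (coeff2 f i j) * (s ^ i * s ^ j) \<le> C * R ^ (i + j) * ((1 / (2 * R)) ^ i * (1 / (2 * R)) ^ j)"
      using s R C by (intro mult_mono power_mono a) auto
    also have "\<dots> = C * (1/2) ^ i * (1/2) ^ j"
      using R by (simp add: power_mult_distrib power_add field_simps)
    finally show "(case x of (i, j) \<Rightarrow> norm (coeff2 f i j) * s ^ i * s ^ j)
        \<le> (case x of (i, j) \<Rightarrow> C * (1/2) ^ i * (1/2) ^ j)" by (simp add: x mult.assoc)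
  qed (use s in auto)
qed

text \<open>A single term is bounded by the sum of all norms, which gives the ratio 1/r; conversely,
  at half the radius 1/R the norms are dominated by a product of two geometric series of ratio
  1/2.\<close>

lemma convergent2_iff_geometric: "convergent2 f \<longleftrightarrow> (\<exists>C R. geometric_bound2 C R f)"
proof
  assume "convergent2 f"
  then obtain r where r: "r > 0"
    "(\<lambda>(i, j). norm (coeff2 f i j) * r ^ i * r ^ j) summable_on (UNIV :: (nat \<times> nat) set)"
    by (auto simp: convergent2_def)
  let ?F = "\<lambda>(i, j). norm (coeff2 f i j) * r ^ i * r ^ j"
  have "?F (i, j) \<le> infsum ?F UNIV" for i j
    using finite_sum_le_infsum[OF r(2), of "{(i, j)}"] r(1) by auto
  hence "norm (coeff2 f i j) \<le> infsum ?F UNIV * (1 / r) ^ (i + j)" for i j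
    using r(1) by (simp add: power_add field_simps)
  thus "\<exists>C R. geometric_bound2 C R f"
    unfolding geometric_bound2_def using r(1) by (intro exI[of _ "infsum ?F UNIV"] exI[of _ "1 / r"]) auto
next
  assume "\<exists>C R. geometric_bound2 C R f"
  then obtain C R where b: "geometric_bound2 C R f" by blast
  hence R: "R > 0" by (simp add: geometric_bound2_def)
  show "convergent2 f" unfolding convergent2_def
    using geometric_bound2_imp_summable[OF b, of "1 / (2 * R)"] R
    by (intro exI[of _ "1 / (2 * R)"]) auto
qed

text \<open>Only the inner variable is evaluated, which leaves a series in w; two-variable
  evaluation thus becomes \<open>eval_fps\<close> applied twice.\<close>

definition eval_inner :: "complex fps fps \<Rightarrow> complex \<Rightarrow> complex fps" where
  "eval_inner f z = Abs_fps (\<lambda>j. eval_fps (fps_nth f j) z)"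

text \<open>For |z| below half the radius 1/R, summation over the powers of z costs a factor 2 and
  leaves Cauchy estimates in w with the same ratio R.\<close>

lemma
  assumes b: "geometric_bound2 C R f" and z: "norm z < 1 / (2 * R)"
  shows conv_radius_inner: "norm z < fps_conv_radius (fps_nth f j)"
    and conv_radius_eval_inner: "fps_conv_radius (eval_inner f z) \<ge> ereal (1 / R)"
    and norm_nth_eval_inner_le: "norm (fps_nth (eval_inner f z) j) \<le> 2 * C * R ^ j"
proof -
  have R: "R > 0" and a: "\<And>i j. norm (coeff2 f i j) \<le> (C * R ^ j) * R ^ i"
    using b by (auto simp: geometric_bound2_def power_add mult_ac)
  show le: "norm (fps_nth (eval_inner f z) j) \<le> 2 * C * R ^ j" for j
    using norm_eval_fps_le_geometric[OF R a, of z j] z by (simp add: eval_inner_def)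
  show "fps_conv_radius (eval_inner f z) \<ge> ereal (1 / R)"
    by (rule fps_conv_radius_ge_geometric[OF R le])
  have "norm z < ereal (1 / R)" using z R by (simp add: field_simps)
  also have "\<dots> \<le> fps_conv_radius (fps_nth f j)"
    by (rule fps_conv_radius_ge_geometric[OF R a])
  finally show "norm z < fps_conv_radius (fps_nth f j)" .
qed

text \<open>Absolute summability on the smaller bidisc permits summation over the powers of z first
  and over those of w afterwards.\<close>

lemma eval_fps2_conv_eval_fps:
  assumes b: "geometric_bound2 C R f" and z: "norm z < 1 / (2 * R)" and w: "norm w < 1 / (2 * R)"
  shows "eval_fps2 f z w = eval_fps (eval_inner f z) w"
proof -
  have R: "R > 0" using b by (simp add: geometric_bound2_def)
  let ?s = "1 / (2 * R)"
  let ?t = "\<lambda>(i, j). coeff2 f i j * z ^ i * w ^ j"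
  have "(\<lambda>x. norm (?t x)) summable_on UNIV"
  proof (rule summable_on_comparison_test[OF geometric_bound2_imp_summable[OF b, of ?s]])
    fix x :: "nat \<times> nat"
    show "norm (?t x) \<le> (case x of (i, j) \<Rightarrow> norm (coeff2 f i j) * ?s ^ i * ?s ^ j)"
      using z w by (cases x) (auto simp: norm_mult norm_power intro!: mult_mono power_mono mult_nonneg_nonneg divide_nonneg_nonneg intro: zero_le_power R[THEN less_imp_le])
  qed (use R in auto)
  hence "?t summable_on UNIV" by (rule abs_summable_summable)
  hence "(?t has_sum eval_fps2 f z w) UNIV"
    unfolding eval_fps2_def by (rule has_sum_infsum)
  \<comment> \<open>The indices are swapped so that the exponent j of w becomes the outer index of
    the iterated sum.\<close>
  hence "((\<lambda>(j, i). ?t (i, j)) has_sum eval_fps2 f z w) (UNIV \<times> UNIV)"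
    by (subst has_sum_reindex_bij_witness[of _ prod.swap prod.swap UNIV]) auto
  moreover have "((\<lambda>i. case (j, i) of (j, i) \<Rightarrow> ?t (i, j)) has_sum
      fps_nth (eval_inner f z) j * w ^ j) UNIV" for j
  proof -
    have "((\<lambda>i. coeff2 f i j * z ^ i) has_sum eval_fps (fps_nth f j) z) UNIV"
      by (intro norm_summable_imp_has_sum norm_summable_fps sums_eval_fps conv_radius_inner[OF b z])
    from has_sum_cmult_left[OF this, of "w ^ j"] show ?thesis
      by (simp add: eval_inner_def mult_ac)
  qed
  ultimately have "((\<lambda>j. fps_nth (eval_inner f z) j * w ^ j) has_sum eval_fps2 f z w) UNIV"
    by (rule has_sum_SigmaD)
  hence "(\<lambda>j. fps_nth (eval_inner f z) j * w ^ j) sums eval_fps2 f z w"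
    by (rule has_sum_imp_sums)
  thus ?thesis by (simp add: eval_fps_def sums_iff)
qed

lemma geometric_bound2_mono:
  assumes "geometric_bound2 C R f" "C \<le> C'" "R \<le> R'"
  shows "geometric_bound2 C' R' f"
proof -
  have R: "R > 0" and a: "\<And>i j. norm (coeff2 f i j) \<le> C * R ^ (i + j)"
    using assms(1) by (auto simp: geometric_bound2_def)
  have C: "C \<ge> 0" using order_trans[OF norm_ge_zero a[of 0 0]] by simp
  have "C * R ^ n \<le> C' * R' ^ n" for n
    using assms(2,3) R C by (intro mult_mono power_mono) auto
  thus ?thesis unfolding geometric_bound2_def using R assms(3) order_trans[OF a] by force
qed

lemma convergent2_common_geometric:
  assumes "convergent2 f" "convergent2 g"
  obtains C R where "geometric_bound2 C R f" "geometric_bound2 C R g"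
proof -
  from assms obtain C R C' R' where "geometric_bound2 C R f" "geometric_bound2 C' R' g"
    by (auto simp: convergent2_iff_geometric)
  thus ?thesis
    by (intro that[of "max C C'" "max R R'"]) (auto elim: geometric_bound2_mono)
qed

lemma eventually_nhds_pair_zeroI:
  assumes "s > 0" "\<And>(z :: complex) (w :: complex). norm z < s \<Longrightarrow> norm w < s \<Longrightarrow> P z w"
  shows "eventually (\<lambda>(z, w). P z w) (nhds (0, 0))"
proof -
  have "eventually (\<lambda>x. x \<in> ball (0 :: complex) s \<times> ball (0 :: complex) s) (nhds (0, 0))"
    using assms(1) by (intro eventually_nhds_in_open open_Times) auto
  thus ?thesis by (rule eventually_mono) (auto intro: assms(2))
qed

text \<open>The identities hold near the origin only, since \<open>eval_fps2\<close> takes the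
  default value of \<open>infsum\<close> where the double series is not summable.\<close>

lemma
  assumes "convergent2 f" "convergent2 g"
  shows eval_fps2_mult: "eventually (\<lambda>(z, w). eval_fps2 (f * g) z w = eval_fps2 f z w * eval_fps2 g z w) (nhds (0, 0))"
    and eval_fps2_add: "eventually (\<lambda>(z, w). eval_fps2 (f + g) z w = eval_fps2 f z w + eval_fps2 g z w) (nhds (0, 0))"
proof -
  obtain C R where fg: "geometric_bound2 C R f" "geometric_bound2 C R g"
    using convergent2_common_geometric[OF assms] .
  obtain C' R' where m': "geometric_bound2 C' R' (f * g)"
    using convergent2_mult[OF assms] by (auto simp: convergent2_iff_geometric)
  obtain C'' R'' where a': "geometric_bound2 C'' R'' (f + g)"
    using convergent2_add[OF assms] by (auto simp: convergent2_iff_geometric)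
  \<comment> \<open>One pair of constants for f, g, f * g and f + g makes the iterated evaluation
    valid for all four on the same bidisc.\<close>
  define D where "D = max C (max C' C'')"
  define S where "S = max R (max R' R'')"
  have b: "geometric_bound2 D S f" "geometric_bound2 D S g" "geometric_bound2 D S (f * g)" "geometric_bound2 D S (f + g)"
    using geometric_bound2_mono[OF fg(1)] geometric_bound2_mono[OF fg(2)]
      geometric_bound2_mono[OF m'] geometric_bound2_mono[OF a']
    by (auto simp: D_def S_def)
  have S: "S > 0" using b by (auto simp: geometric_bound2_def)
  have w_lt: "ereal (norm w) < fps_conv_radius (eval_inner h z)"
    if "geometric_bound2 D S h" "norm z < 1 / (2 * S)" "norm w < 1 / (2 * S)" for h and z w :: complex
  proof -
    have "norm w < ereal (1 / S)" using that S by (simp add: field_simps)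
    also have "\<dots> \<le> fps_conv_radius (eval_inner h z)" by (rule conv_radius_eval_inner[OF that(1,2)])
    finally show ?thesis .
  qed
  have rad: "ereal (norm z) < fps_conv_radius (fps_nth h j)"
    if "geometric_bound2 D S h" "norm z < 1 / (2 * S)" for h j and z :: complex
    by (rule conv_radius_inner[OF that])
  \<comment> \<open>The radius of convergence of the partial sum is carried through the induction
    because additivity of \<open>eval_fps\<close> depends on it.\<close>
  have sums: "eval_fps (\<Sum>i\<in>A. F i) z = (\<Sum>i\<in>A. eval_fps (F i) z) \<and> ereal (norm z) < fps_conv_radius (\<Sum>i\<in>A. F i)"
    if "finite A" "\<And>i. i \<in> A \<Longrightarrow> ereal (norm z) < fps_conv_radius (F i)" for A :: "nat set" and F and z :: complex
    using that
  proof (induction A rule: finite_induct)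
    case (insert x A)
    thus ?case
      using order.strict_trans2[OF _ fps_conv_radius_add[of "F x" "\<Sum>i\<in>A. F i"]]
      by (auto simp: eval_fps_add)
  qed auto
  have mult: "eval_inner (f * g) z = eval_inner f z * eval_inner g z" if z: "norm z < 1 / (2 * S)" for z
  proof (rule fps_ext)
    fix j
    have "fps_nth (eval_inner (f * g) z) j = (\<Sum>i=0..j. eval_fps (fps_nth f i * fps_nth g (j - i)) z)"
      unfolding eval_inner_def fps_nth_Abs_fps fps_mult_nth
      using rad[OF b(1) z] rad[OF b(2) z]
      by (intro conjunct1[OF sums]) (auto intro!: order.strict_trans2[OF _ fps_conv_radius_mult])
    also have "\<dots> = (\<Sum>i=0..j. eval_fps (fps_nth f i) z * eval_fps (fps_nth g (j - i)) z)"
      by (intro sum.cong refl eval_fps_mult rad z b)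
    finally show "fps_nth (eval_inner (f * g) z) j = fps_nth (eval_inner f z * eval_inner g z) j"
      by (simp add: fps_mult_nth eval_inner_def)
  qed
  have add: "eval_inner (f + g) z = eval_inner f z + eval_inner g z" if z: "norm z < 1 / (2 * S)" for z
    by (rule fps_ext) (simp add: eval_inner_def eval_fps_add rad[OF b(1) z] rad[OF b(2) z])
  show "eventually (\<lambda>(z, w). eval_fps2 (f * g) z w = eval_fps2 f z w * eval_fps2 g z w) (nhds (0, 0))"
    by (rule eventually_nhds_pair_zeroI[of "1 / (2 * S)"])
       (use S b in \<open>simp_all add: eval_fps2_conv_eval_fps[of D S] mult eval_fps_mult w_lt\<close>)
  show "eventually (\<lambda>(z, w). eval_fps2 (f + g) z w = eval_fps2 f z w + eval_fps2 g z w) (nhds (0, 0))"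
    by (rule eventually_nhds_pair_zeroI[of "1 / (2 * S)"])
       (use S b in \<open>simp_all add: eval_fps2_conv_eval_fps[of D S] add eval_fps_add w_lt\<close>)
qed

lemma eval_fps2_bounded:
  assumes "convergent2 f"
  shows "\<exists>B. eventually (\<lambda>(z, w). norm (eval_fps2 f z w) \<le> B) (nhds (0, 0))"
proof -
  obtain C R where b: "geometric_bound2 C R f"
    using assms by (auto simp: convergent2_iff_geometric)
  hence R: "R > 0" by (simp add: geometric_bound2_def)
  \<comment> \<open>Each of the two variables contributes one factor 2.\<close>
  have "eventually (\<lambda>(z, w). norm (eval_fps2 f z w) \<le> 2 * (2 * C)) (nhds (0, 0))"
  proof (rule eventually_nhds_pair_zeroI[of "1 / (2 * R)"])
    fix z w :: complex assume zw: "norm z < 1 / (2 * R)" "norm w < 1 / (2 * R)"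
    show "norm (eval_fps2 f z w) \<le> 2 * (2 * C)"
      unfolding eval_fps2_conv_eval_fps[OF b zw]
      using zw norm_nth_eval_inner_le[OF b zw(1)] by (intro norm_eval_fps_le_geometric[OF R]) auto
  qed (use R in simp)
  thus ?thesis ..
qed

lemma eval_fps2_const:
  assumes "convergent2 (fps_const a)"
  shows "eventually (\<lambda>(z, w). eval_fps2 (fps_const a) z w = eval_fps a z) (nhds (0, 0))"
proof -
  obtain C R where b: "geometric_bound2 C R (fps_const a)"
    using assms by (auto simp: convergent2_iff_geometric)
  hence R: "R > 0" by (simp add: geometric_bound2_def)
  have "eval_inner (fps_const a) z = fps_const (eval_fps a z)" for z
    by (rule fps_ext) (simp add: eval_inner_def)
  thus ?thesis
    by (intro eventually_nhds_pair_zeroI[of "1 / (2 * R)"])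
       (use R in \<open>simp_all add: eval_fps2_conv_eval_fps[OF b]\<close>)
qed

lemma eval_fps2_w: "eventually (\<lambda>(z, w). eval_fps2 w_fps2 z w = w) (nhds (0, 0))"
proof -
  obtain C R where b: "geometric_bound2 C R w_fps2"
    using convergent2_w by (auto simp: convergent2_iff_geometric)
  hence R: "R > 0" by (simp add: geometric_bound2_def)
  have "eval_inner w_fps2 z = fps_X" for z
    by (rule fps_ext) (simp add: eval_inner_def w_fps2_def fps_X_def)
  thus ?thesis
    by (intro eventually_nhds_pair_zeroI[of "1 / (2 * R)"])
       (use R in \<open>simp_all add: eval_fps2_conv_eval_fps[OF b]\<close>)
qed

text \<open>Identifies the series in z alone with C{z}, so that their convergence can be treated by
  \<open>fps_conv_radius\<close>.\<close>

lemma convergent2_const_iff: "convergent2 (fps_const a) \<longleftrightarrow> fps_conv_radius a > 0"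
proof
  assume "convergent2 (fps_const a)"
  then obtain C R where b: "geometric_bound2 C R (fps_const a)"
    by (auto simp: convergent2_iff_geometric)
  hence R: "R > 0" by (simp add: geometric_bound2_def)
  have "norm (fps_nth a i) \<le> C * R ^ i" for i
  proof -
    have "norm (coeff2 (fps_const a) i 0) \<le> C * R ^ (i + 0)"
      using b unfolding geometric_bound2_def by blast
    thus ?thesis by simp
  qed
  hence "ereal (1 / R) \<le> fps_conv_radius a" by (rule fps_conv_radius_ge_geometric[OF R])
  moreover have "0 < ereal (1 / R)" using R by simp
  ultimately show "fps_conv_radius a > 0" by (rule order.strict_trans2[rotated])
next
  assume "fps_conv_radius a > 0"
  then obtain r' where r': "0 < ereal r'" "ereal r' < fps_conv_radius a"
    by (rule ereal_dense2[THEN exE]) blast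
  define r where "r = r'"
  have r: "r > 0" "ereal r < fps_conv_radius a" using r' by (simp_all add: r_def)
  \<comment> \<open>The terms of a series convergent at r are bounded, which is a Cauchy estimate of
    ratio 1/r.\<close>
  have "(\<lambda>i. fps_nth a i * of_real r ^ i) \<longlonglongrightarrow> 0"
    by (rule summable_LIMSEQ_zero, rule summable_fps) (use r in simp)
  hence "Bseq (\<lambda>i. fps_nth a i * of_real r ^ i)"
    by (intro convergent_imp_Bseq convergentI)
  then obtain B where B: "\<And>i. norm (fps_nth a i * of_real r ^ i) \<le> B"
    by (auto simp: Bseq_def)
  have "norm (fps_nth a i) \<le> B * (1 / r) ^ i" for i
    using B[of i] r(1) by (simp add: norm_mult norm_power field_simps)
  moreover have "B \<ge> 0" using order_trans[OF norm_ge_zero B[of 0]] .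
  ultimately have "geometric_bound2 B (1 / r) (fps_const a)"
    unfolding geometric_bound2_def using r(1) by simp
  thus "convergent2 (fps_const a)" by (auto simp: convergent2_iff_geometric)
qed

text \<open>Continuity at the origin, from f = f_0(z) + w g(z, w): the first summand is a series in
  one variable, and g is bounded. This keeps the unit of the Weierstrass factorization away from
  0.\<close>

lemma eval_fps2_tendsto:
  assumes f: "convergent2 f"
  shows "((\<lambda>(z, w). eval_fps2 f z w) \<longlongrightarrow> eval_fps2 f 0 0) (nhds (0, 0))"
proof -
  obtain C R where b: "geometric_bound2 C R f"
    using f by (auto simp: convergent2_iff_geometric)
  hence R: "R > 0" and a: "\<And>i j. norm (coeff2 f i j) \<le> C * R ^ (i + j)"
    by (auto simp: geometric_bound2_def)
  define a0 where "a0 = fps_nth f 0"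
  have f_eq: "f = fps_const a0 + w_fps2 * fps_shift 1 f"
    by (rule fps_ext) (simp add: w_fps2_def a0_def)
  have "norm (coeff2 (fps_shift 1 f) i j) \<le> (C * R) * R ^ (i + j)" for i j
    using a[where i = i and j = "Suc j"] by (simp add: mult.assoc)
  hence "geometric_bound2 (C * R) R (fps_shift 1 f)"
    using R by (auto simp: geometric_bound2_def)
  hence sh: "convergent2 (fps_shift 1 f)" by (auto simp: convergent2_iff_geometric)
  have C: "C \<ge> 0" using order_trans[OF norm_ge_zero a[of 0 0]] by simp
  have "norm (fps_nth a0 i) \<le> C * R ^ i" for i using a[where i = i and j = 0] by (simp add: a0_def)
  hence "ereal (1 / R) \<le> fps_conv_radius a0" by (rule fps_conv_radius_ge_geometric[OF R])
  moreover have "0 < ereal (1 / R)" using R by simp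
  ultimately have rad: "fps_conv_radius a0 > 0" by (rule order.strict_trans2[rotated])
  hence ca: "convergent2 (fps_const a0)" by (simp add: convergent2_const_iff)
  obtain B where B: "eventually (\<lambda>(z, w). norm (eval_fps2 (fps_shift 1 f) z w) \<le> B) (nhds (0, 0))"
    using eval_fps2_bounded[OF sh] by blast
  have ev: "eventually (\<lambda>(z, w). eval_fps2 f z w = eval_fps a0 z + w * eval_fps2 (fps_shift 1 f) z w) (nhds (0, 0))"
    using eval_fps2_add[OF ca convergent2_mult[OF convergent2_w sh]] eval_fps2_mult[OF convergent2_w sh]
      eval_fps2_w eval_fps2_const[OF ca]
    by eventually_elim (use f_eq in auto)
  have z: "filterlim fst (nhds 0) (nhds (0 :: complex, 0 :: complex))"
    and w: "filterlim snd (nhds 0) (nhds (0 :: complex, 0 :: complex))"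
    by (auto simp: nhds_prod filterlim_fst filterlim_snd)
  have "isCont (eval_fps a0) 0"
    using rad by (intro continuous_eval_fps) (simp add: zero_ereal_def)
  hence "filterlim (eval_fps a0) (nhds (eval_fps a0 0)) (nhds 0)"
    by (metis continuous_at tendsto_at_iff_tendsto_nhds)
  hence t1: "((\<lambda>x. eval_fps a0 (fst x)) \<longlongrightarrow> eval_fps a0 0) (nhds (0 :: complex, 0 :: complex))"
    by (rule filterlim_compose[OF _ z])
  have t2: "((\<lambda>x. snd x * eval_fps2 (fps_shift 1 f) (fst x) (snd x)) \<longlongrightarrow> 0) (nhds (0, 0))"
  proof (rule Lim_null_comparison)
    show "eventually (\<lambda>x. norm (snd x * eval_fps2 (fps_shift 1 f) (fst x) (snd x)) \<le> norm (snd x) * B) (nhds (0, 0))"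
      using B by (rule eventually_mono) (auto simp: norm_mult intro!: mult_left_mono)
    show "((\<lambda>x. norm (snd x) * B) \<longlongrightarrow> 0) (nhds (0 :: complex, 0 :: complex))"
      using tendsto_mult_right[OF tendsto_norm[OF w], of B] by simp
  qed
  have "((\<lambda>(z, w). eval_fps2 f z w) \<longlongrightarrow> eval_fps a0 0) (nhds (0, 0))"
    by (rule Lim_transform_eventually[OF tendsto_add[OF t1 t2, simplified]])
       (use ev in \<open>auto elim: eventually_mono\<close>)
  moreover have "eval_fps a0 0 = eval_fps2 f 0 0"
    using eventually_nhds_x_imp_x[OF ev] by simp
  ultimately show ?thesis by simp
qed

section \<open>Division by w - f(z)\<close>

text \<open>The coefficients of Q in q = a + (w - f) Q. Comparing coefficients of w^(k+1) gives Q_k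
  = q_(k+1) + f Q_(k+1); since f(0) = 0, entry i of Q_k only uses entries l < i of Q_(k+1), so the
  recursion ends although k grows.\<close>

fun linear_quotient_coeff :: "complex fps \<Rightarrow> complex fps fps \<Rightarrow> nat \<Rightarrow> nat \<Rightarrow> complex" where
  "linear_quotient_coeff f q i k =
     coeff2 q i (Suc k) + (\<Sum>l<i. fps_nth f (i - l) * linear_quotient_coeff f q l (Suc k))"

declare linear_quotient_coeff.simps [simp del]

text \<open>Weierstrass division by a polynomial of degree one in w; the remainder is a(z) = q(z,
  f(z)). The recursion for Q preserves Cauchy estimates once the ratio in z is enlarged from R to R
  B.\<close>

lemma convergent2_linear_division:
  assumes q: "convergent2 q" and f: "convergent2 (fps_const f)" and f0: "fps_nth f 0 = 0"
  obtains a Q where "convergent2 (fps_const a)" "convergent2 Q"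
    "q = fps_const a + (w_fps2 - fps_const f) * Q"
proof -
  define G where "G = linear_quotient_coeff f q"
  have G: "G i k = coeff2 q i (Suc k) + (\<Sum>l<i. fps_nth f (i - l) * G l (Suc k))" for i k
    unfolding G_def by (rule linear_quotient_coeff.simps)
  obtain C R where "geometric_bound2 C R q" "geometric_bound2 C R (fps_const f)"
    using convergent2_common_geometric[OF q f] .
  hence R: "R > 0" and qb: "norm (coeff2 q i j) \<le> C * R ^ (i + j)"
    and fb': "norm (coeff2 (fps_const f) i j) \<le> C * R ^ (i + j)" for i j
    unfolding geometric_bound2_def by blast+
  have fb: "norm (fps_nth f i) \<le> C * R ^ i" for i
    using fb'[where i = i and j = 0] by simp
  have C: "C \<ge> 0" using order_trans[OF norm_ge_zero qb[of 0 0]] by simp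
  define D where "D = C + 1"
  \<comment> \<open>The recursion produces 2 D R times the sum of B^l over l < i; with B - 1 = 2 D R
    this is the telescoping sum B^i - 1.\<close>
  define B where "B = 1 + 2 * D * R"
  have D: "D > 0" "C \<le> D" using C by (auto simp: D_def)
  have B: "B \<ge> 1" using D R by (simp add: B_def)
  \<comment> \<open>Induction on i for all k at once, since entry (i, k) refers to entries (l, k +
    1) with l < i.\<close>
  have bound: "norm (G i k) \<le> (2 * C * R) * (R * B) ^ i * R ^ k" for i k
  proof (induction i arbitrary: k rule: less_induct)
    case (less i)
    have "norm (G i k) \<le> C * R ^ (i + Suc k) + (\<Sum>l<i. norm (fps_nth f (i - l)) * norm (G l (Suc k)))"
      unfolding G[of i k] using qb[where i = i and j = "Suc k"]
      by (intro order_trans[OF norm_triangle_ineq] add_mono order_trans[OF norm_sum])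
         (simp_all add: norm_mult)
    also have "(\<Sum>l<i. norm (fps_nth f (i - l)) * norm (G l (Suc k))) \<le>
        (\<Sum>l<i. (D * R ^ (i - l)) * ((2 * C * R) * (R * B) ^ l * R ^ Suc k))"
    proof (intro sum_mono mult_mono)
      fix l assume l: "l \<in> {..<i}"
      show "norm (G l (Suc k)) \<le> (2 * C * R) * (R * B) ^ l * R ^ Suc k" using less l by blast
      show "norm (fps_nth f (i - l)) \<le> D * R ^ (i - l)"
        using R by (intro order_trans[OF fb mult_right_mono[OF D(2)]]) simp
    qed (use D R in auto)
    also have "\<dots> = (\<Sum>l<i. (2 * D * R) * (C * R ^ (i + Suc k)) * B ^ l)"
    proof (intro sum.cong refl)
      fix l assume "l \<in> {..<i}"
      hence "R ^ (i + Suc k) = R ^ (i - l) * R ^ l * R ^ Suc k" by (simp flip: power_add)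
      thus "(D * R ^ (i - l)) * ((2 * C * R) * (R * B) ^ l * R ^ Suc k)
          = (2 * D * R) * (C * R ^ (i + Suc k)) * B ^ l"
        by (simp add: power_mult_distrib del: power_Suc)
    qed
    also have "\<dots> = (C * R ^ (i + Suc k)) * ((B - 1) * (\<Sum>l<i. B ^ l))"
      by (simp add: sum_distrib_left B_def mult_ac)
    also have "(B - 1) * (\<Sum>l<i. B ^ l) = B ^ i - 1" by (rule power_diff_1_eq[symmetric])
    also have "C * R ^ (i + Suc k) + (C * R ^ (i + Suc k)) * (B ^ i - 1) = C * R * (R * B) ^ i * R ^ k"
      by (simp add: algebra_simps power_mult_distrib power_add)
    also have "\<dots> \<le> (2 * C * R) * (R * B) ^ i * R ^ k"
      using C R B by (intro mult_right_mono) auto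
    finally show ?case by simp
  qed
  define Q where "Q = Abs_fps (\<lambda>k. Abs_fps (\<lambda>i. G i k))"
  have "norm (coeff2 Q i k) \<le> (2 * C * R) * (R * B) ^ (i + k)" for i k
  proof -
    have "norm (coeff2 Q i k) \<le> (2 * C * R) * (R * B) ^ i * R ^ k" using bound by (simp add: Q_def)
    also have "\<dots> \<le> (2 * C * R) * (R * B) ^ i * (R * B) ^ k"
      using C R B by (intro mult_left_mono power_mono) auto
    finally show ?thesis by (simp add: power_add mult_ac)
  qed
  hence "geometric_bound2 (2 * C * R) (R * B) Q"
    using R B by (auto simp: geometric_bound2_def)
  hence Q: "convergent2 Q" by (auto simp: convergent2_iff_geometric)
  define a where "a = fps_nth q 0 + f * fps_nth Q 0"
  have q_eq: "q = fps_const a + (w_fps2 - fps_const f) * Q"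
  proof (rule fps_ext)
    fix n show "fps_nth q n = fps_nth (fps_const a + (w_fps2 - fps_const f) * Q) n"
    proof (cases n)
      case 0
      thus ?thesis by (simp add: w_fps2_def a_def algebra_simps)
    next
      case (Suc k)
      have "fps_nth q (Suc k) = fps_nth Q k - f * fps_nth Q (Suc k)"
      proof (rule fps_ext)
        fix i
        have "fps_nth (f * fps_nth Q (Suc k)) i = (\<Sum>l\<le>i. fps_nth f (i - l) * G l (Suc k))"
          unfolding mult.commute[of f] fps_mult_nth by (simp add: Q_def atLeast0AtMost mult.commute)
        \<comment> \<open>The summand l = i disappears because f(0) = 0.\<close>
        also have "\<dots> = (\<Sum>l<i. fps_nth f (i - l) * G l (Suc k))"
          by (simp add: f0 flip: lessThan_Suc_atMost)
        finally show "fps_nth (fps_nth q (Suc k)) i = fps_nth (fps_nth Q k - f * fps_nth Q (Suc k)) i"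
          using G[of i k] by (simp add: Q_def)
      qed
      thus ?thesis by (simp add: Suc w_fps2_def algebra_simps)
    qed
  qed
  have "fps_const a = q + - ((w_fps2 + - fps_const f) * Q)" by (subst q_eq) (simp only: diff_conv_add_uminus add.assoc right_minus add_0_right)
  also have "convergent2 \<dots>"
    by (intro convergent2_add convergent2_uminus convergent2_mult q Q f convergent2_w)
  finally show ?thesis using that Q q_eq by blast
qed

text \<open>The quotient is divided by w - f again and again; each division contributes its
  remainder as the next coefficient.\<close>

lemma convergent2_taylor_linear:
  assumes q: "convergent2 q" and f: "convergent2 (fps_const f)" and f0: "fps_nth f 0 = 0"
  shows "\<exists>a Q. (\<forall>j. convergent2 (fps_const (a j))) \<and> convergent2 Q \<and>
           q = (\<Sum>j<M. fps_const (a j) * (w_fps2 - fps_const f) ^ j) + (w_fps2 - fps_const f) ^ M * Q"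
proof (induction M)
  case 0
  \<comment> \<open>The sum is empty, so any convergent series may stand for \<open>a j\<close>;
    \<open>f\<close> is one at hand.\<close>
  show ?case using q f by (intro exI[of _ "\<lambda>_. f"] exI[of _ q]) auto
next
  case (Suc M)
  then obtain a Q where a: "\<And>j. convergent2 (fps_const (a j))" and Q: "convergent2 Q"
    and q_eq: "q = (\<Sum>j<M. fps_const (a j) * (w_fps2 - fps_const f) ^ j) + (w_fps2 - fps_const f) ^ M * Q"
    by blast
  obtain b Q' where b: "convergent2 (fps_const b)" "convergent2 Q'"
    "Q = fps_const b + (w_fps2 - fps_const f) * Q'"
    using convergent2_linear_division[OF Q f f0] .
  have "(\<Sum>j<M. fps_const ((a(M := b)) j) * (w_fps2 - fps_const f) ^ j)
      = (\<Sum>j<M. fps_const (a j) * (w_fps2 - fps_const f) ^ j)"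
    by (intro sum.cong) auto
  hence "q = (\<Sum>j<Suc M. fps_const ((a(M := b)) j) * (w_fps2 - fps_const f) ^ j)
      + (w_fps2 - fps_const f) ^ Suc M * Q'"
    by (subst q_eq, subst b(3)) (simp add: algebra_simps)
  thus ?case using a b by (intro exI[of _ "a(M := b)"] exI[of _ Q']) auto
qed

lemma convergent2_const_shift:
  assumes "convergent2 (fps_const a)" and "\<And>i. i < k \<Longrightarrow> fps_nth a i = 0"
  obtains b where "convergent2 b" "fps_const a = b * z_fps2 ^ k"
proof (rule that)
  show "convergent2 (fps_const (fps_shift k a))"
    using assms(1) by (simp add: convergent2_const_iff)
  have "a = fps_shift k a * fps_X ^ k"
    by (rule fps_ext) (use assms(2) in \<open>simp add: fps_X_power_mult_right_nth\<close>)
  thus "fps_const a = fps_const (fps_shift k a) * z_fps2 ^ k"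
    by (simp add: z_fps2_def)
qed

lemma sum_in_genideal_conv_ring:
  assumes "finite A" "\<And>j. j \<in> A \<Longrightarrow> convergent2 (g j) \<and> s j \<in> S" and S: "\<And>t. t \<in> S \<Longrightarrow> convergent2 t"
  shows "(\<Sum>j\<in>A. g j * s j) \<in> genideal conv_ring S"
proof -
  interpret cring conv_ring by (rule cring_conv_ring)
  have S': "S \<subseteq> carrier conv_ring" using S by auto
  interpret I: ideal "genideal conv_ring S" conv_ring by (rule genideal_ideal[OF S'])
  show ?thesis using assms(1,2)
  proof (induction A rule: finite_induct)
    case empty
    show ?case using I.zero_closed by simp
  next
    case (insert j A)
    have "g j * s j \<in> genideal conv_ring S"
      using I.I_l_closed[of "s j" "g j"] insert.prems genideal_self[OF S'] by auto
    thus ?case using I.a_closed insert by auto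
  qed
qed

section \<open>Estimates for the defect in the parameter s\<close>

text \<open>First-order expansion in y = Im z. With m = n + 2, multiplication by z sends the
  remainder E to Re z * E + m y^2 Im (z^(m-1)), so it stays quadratic in y, and m^2 + m \<le> (m +
  1)^2 preserves the constant.\<close>

lemma Im_power_linearization:
  fixes z :: complex
  shows "\<bar>Im (z ^ (n + 2)) - real (n + 2) * Im z * Re (z ^ (n + 1))\<bar> \<le> (real (n + 2))\<^sup>2 * (Im z)\<^sup>2 * norm z ^ n"
proof (induction n)
  case 0
  show ?case by (simp add: power2_eq_square)
next
  case (Suc n)
  define m where "m = real (n + 2)"
  define E where "E = Im (z ^ (n + 2)) - m * Im z * Re (z ^ (n + 1))"
  have "Im (z ^ (Suc n + 2)) - real (Suc n + 2) * Im z * Re (z ^ (Suc n + 1))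
      = Re z * E + m * (Im z)\<^sup>2 * Im (z ^ (n + 1))"
    by (simp add: E_def m_def algebra_simps power2_eq_square)
  also have "\<bar>\<dots>\<bar> \<le> norm z * (m\<^sup>2 * (Im z)\<^sup>2 * norm z ^ n) + m * (Im z)\<^sup>2 * norm z ^ (n + 1)"
  proof (intro order_trans[OF abs_triangle_ineq] add_mono)
    show "\<bar>Re z * E\<bar> \<le> norm z * (m\<^sup>2 * (Im z)\<^sup>2 * norm z ^ n)"
      unfolding abs_mult using Suc by (intro mult_mono abs_Re_le_cmod) (auto simp: E_def m_def)
    have "\<bar>Im (z ^ (n + 1))\<bar> \<le> norm z ^ (n + 1)"
      using abs_Im_le_cmod[of "z ^ (n + 1)"] by (simp only: norm_power)
    thus "\<bar>m * (Im z)\<^sup>2 * Im (z ^ (n + 1))\<bar> \<le> m * (Im z)\<^sup>2 * norm z ^ (n + 1)"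
      unfolding abs_mult by (intro mult_mono) (auto simp: m_def)
  qed
  also have "\<dots> = (m\<^sup>2 + m) * ((Im z)\<^sup>2 * norm z ^ Suc n)" by (simp add: algebra_simps)
  also have "\<dots> \<le> (real (Suc n + 2))\<^sup>2 * ((Im z)\<^sup>2 * norm z ^ Suc n)"
    by (intro mult_right_mono mult_nonneg_nonneg) (auto simp: m_def power2_eq_square algebra_simps)
  finally show ?case by (simp only: mult.assoc)
qed

text \<open>This is the imaginary part of |z|^2 z^n = z^(n+1) (z - 2 i Im z).\<close>

lemma norm_square_Im_power:
  "(norm z)\<^sup>2 * Im (z ^ n) = Im (z ^ (n + 2)) - 2 * Im z * Re (z ^ (n + 1))"
  unfolding cmod_power2 by (simp add: power2_eq_square algebra_simps)

text \<open>Both terms have the linear part n Im z Re (z^(n+1)). This is the cancellation for a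
  single monomial of A_0.\<close>

lemma Im_power_defect:
  fixes z :: complex
  shows "\<bar>real n / real (n + 2) * Im (z ^ (n + 2)) - (norm z)\<^sup>2 * Im (z ^ n)\<bar>
     \<le> 2 * real (n + 2) * (Im z)\<^sup>2 * norm z ^ n"
proof -
  define E where "E = Im (z ^ (n + 2)) - real (n + 2) * Im z * Re (z ^ (n + 1))"
  have "real n / real (n + 2) * Im (z ^ (n + 2)) - (norm z)\<^sup>2 * Im (z ^ n) = - (2 / real (n + 2)) * E"
    unfolding E_def norm_square_Im_power by (simp add: field_simps)
  also have "\<bar>\<dots>\<bar> = (2 / real (n + 2)) * \<bar>E\<bar>" by (simp add: abs_mult)
  also have "\<dots> \<le> (2 / real (n + 2)) * ((real (n + 2))\<^sup>2 * (Im z)\<^sup>2 * norm z ^ n)"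
    unfolding E_def by (intro mult_left_mono Im_power_linearization) auto
  also have "\<dots> = 2 * real (n + 2) * (Im z)\<^sup>2 * norm z ^ n"
    by (simp add: power2_eq_square field_simps)
  finally show ?thesis .
qed

text \<open>By induction from z^2 - |z|^2 = 2 i (Im z) z. The exponent is even because on the
  negative real axis odd powers of z and of |z| differ in sign.\<close>

lemma norm_even_power_diff:
  fixes z :: complex
  shows "norm (z ^ (2 * k + 2) - of_real (norm z ^ (2 * k + 2))) \<le> 2 * real (k + 1) * \<bar>Im z\<bar> * norm z ^ (2 * k + 1)"
proof (induction k)
  case 0
  have "z\<^sup>2 - of_real ((norm z)\<^sup>2) = 2 * \<i> * of_real (Im z) * z"
    unfolding complex_norm_square by (simp add: complex_eq_iff power2_eq_square)
  hence "norm (z\<^sup>2 - of_real ((norm z)\<^sup>2)) = 2 * \<bar>Im z\<bar> * norm z" by (simp add: norm_mult)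
  thus ?case by (simp flip: numeral_2_eq_2)
next
  case (Suc k)
  have "z\<^sup>2 - of_real ((norm z)\<^sup>2) = 2 * \<i> * of_real (Im z) * z"
    unfolding complex_norm_square by (simp add: complex_eq_iff power2_eq_square)
  hence n2: "norm (z\<^sup>2 - of_real ((norm z)\<^sup>2)) = 2 * \<bar>Im z\<bar> * norm z" by (simp add: norm_mult)
  have "z ^ (2 * Suc k + 2) - of_real (norm z ^ (2 * Suc k + 2))
      = z\<^sup>2 * (z ^ (2 * k + 2) - of_real (norm z ^ (2 * k + 2)))
        + (z\<^sup>2 - of_real ((norm z)\<^sup>2)) * of_real (norm z ^ (2 * k + 2))"
    by (simp add: algebra_simps power2_eq_square)
  also have "norm \<dots> \<le> (norm z)\<^sup>2 * (2 * real (k + 1) * \<bar>Im z\<bar> * norm z ^ (2 * k + 1))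
      + (2 * \<bar>Im z\<bar> * norm z) * norm z ^ (2 * k + 2)"
    using Suc n2
    by (intro order_trans[OF norm_triangle_ineq] add_mono)
       (auto simp: norm_mult norm_power intro!: mult_left_mono)
  also have "\<dots> = 2 * real (Suc k + 1) * \<bar>Im z\<bar> * norm z ^ (2 * Suc k + 1)"
    by (simp add: algebra_simps power2_eq_square)
  finally show ?case .
qed

lemma Re_even_power_mult:
  fixes z l :: complex
  shows "\<bar>Re (z ^ (2 * k + 2) * l) - norm z ^ (2 * k + 2) * Re l\<bar>
     \<le> 2 * real (k + 1) * norm l * (\<bar>Im z\<bar> * norm z ^ (2 * k + 1))"
proof -
  have "Re (z ^ (2 * k + 2) * l) - norm z ^ (2 * k + 2) * Re l
      = Re ((z ^ (2 * k + 2) - of_real (norm z ^ (2 * k + 2))) * l)"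
    by (simp add: algebra_simps flip: of_real_power)
  also have "\<bar>\<dots>\<bar> \<le> norm (z ^ (2 * k + 2) - of_real (norm z ^ (2 * k + 2))) * norm l"
    using abs_Re_le_cmod by (metis norm_mult)
  also have "\<dots> \<le> (2 * real (k + 1) * \<bar>Im z\<bar> * norm z ^ (2 * k + 1)) * norm l"
    by (intro mult_right_mono norm_even_power_diff) auto
  finally show ?thesis by (simp add: mult_ac)
qed

text \<open>\<open>\<sigma> = s\<^sup>M\<close>, \<open>\<rho> = \<bar>s\<bar>\<close>; the quadratic term \<open>2 (Im \<sigma>)\<^sup>2\<close> absorbs all errors that vanish on the real axis.
  Here \<open>K\<close> is one less than the \<open>K\<close> of \<^const>\<open>isolated_type\<close>, so that the exponents are \<open>2K + 2\<close> and \<open>N = 2K + 4\<close>.\<close>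

lemma defect_lower_bound_aux:
  fixes \<sigma> l0 l1 l2 :: complex and a :: "real poly" and K M :: nat and C \<rho> :: real
  defines "A \<equiv> (\<Sum>n\<le>degree a. \<bar>coeff a n\<bar> * (2 * real (n + 2)))"
    and "B \<equiv> 4 * real (K + 1) * norm l0"
    and "\<alpha> \<equiv> Re l0 / (real K + 2)"
  assumes a0: "coeff a 0 = 0" and \<rho>: "norm \<sigma> \<le> \<rho>" "\<rho> \<le> 1" and M: "M \<ge> 1" and C: "C \<ge> 0"
    and l1: "norm (l1 - l0) \<le> C * \<rho>"
    and l2: "norm (l2 - of_real (real (K + 1) / (real K + 2)) * l0) \<le> C * \<rho>"
    and small: "2 * real M * A * \<rho> \<le> 1" "2 * C * \<rho> \<le> \<alpha> / 4" "real M * B\<^sup>2 * \<rho> \<le> \<alpha> / 2"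
  shows "real M * \<alpha> * norm \<sigma> ^ (2 * K + 4) \<le>
     (norm \<sigma>)\<^sup>2 * exp (2 * real M * Re (\<i> * poly (map_poly of_real a) \<sigma> + \<sigma> ^ (2 * K + 2) * l1))
     - Re (\<sigma>\<^sup>2 + 2 * of_nat M * \<sigma>\<^sup>2 * ((\<Sum>n\<le>degree a. \<i> * of_real (coeff a n * (real n / real (n + 2))) * \<sigma> ^ n)
          + \<sigma> ^ (2 * K + 2) * l2))"
proof -
  define r where "r = norm \<sigma>"
  define y where "y = Im \<sigma>"
  have r: "0 \<le> r" "r \<le> \<rho>" "r \<le> 1" using \<rho> by (auto simp: r_def)
  have \<rho>0: "\<rho> \<ge> 0" using r by simp
  have M0: "real M \<ge> 1" using M by simp
  \<comment> \<open>After linearization of exp, the defect is 2 y^2 + 2 M (S + T), where S comes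
    from A_0 and T from L_1.\<close>
  define S where "S = (\<Sum>n\<le>degree a. coeff a n * (real n / real (n + 2) * Im (\<sigma> ^ (n + 2)) - r\<^sup>2 * Im (\<sigma> ^ n)))"
  have S: "\<bar>S\<bar> \<le> A * (y\<^sup>2 * r)"
    unfolding S_def A_def sum_distrib_right
  proof (intro order_trans[OF sum_abs] sum_mono)
    fix n
    show "\<bar>coeff a n * (real n / real (n + 2) * Im (\<sigma> ^ (n + 2)) - r\<^sup>2 * Im (\<sigma> ^ n))\<bar>
        \<le> \<bar>coeff a n\<bar> * (2 * real (n + 2)) * (y\<^sup>2 * r)"
    \<comment> \<open>For n \<ge> 1 the power r^n supplies a factor r, which makes S small compared
      with y^2.\<close>
    proof (cases "n = 0")
      case False
      have "\<bar>coeff a n * (real n / real (n + 2) * Im (\<sigma> ^ (n + 2)) - r\<^sup>2 * Im (\<sigma> ^ n))\<bar>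
          \<le> \<bar>coeff a n\<bar> * (2 * real (n + 2) * y\<^sup>2 * r ^ n)"
        unfolding abs_mult r_def y_def by (intro mult_left_mono Im_power_defect) auto
      also have "\<dots> \<le> \<bar>coeff a n\<bar> * (2 * real (n + 2) * y\<^sup>2 * r)"
        using power_decreasing[of 1 n r] r False by (intro mult_left_mono) auto
      finally show ?thesis by (simp add: mult_ac)
    qed (simp add: a0)
  qed
  define T where "T = r\<^sup>2 * Re (\<sigma> ^ (2 * K + 2) * l1) - Re (\<sigma> ^ (2 * K + 4) * l2)"
  \<comment> \<open>The ratio of the leading coefficients of L_2 and L_1; the part of Re l0 left
    over in the defect is 1 - b = 1 / (K + 2).\<close>
  define b where "b = real (K + 1) / (real K + 2)"
  have b: "0 \<le> b" "b \<le> 1" "b * (real K + 2) = real (K + 1)" "(1 - b) * Re l0 = \<alpha>"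
    by (auto simp: b_def \<alpha>_def field_simps)
  have T1: "Re (\<sigma> ^ (2 * K + 2) * l1) \<ge> r ^ (2 * K + 2) * Re l0 - r ^ (2 * K + 2) * (C * \<rho>)
      - 2 * real (K + 1) * norm l0 * (\<bar>y\<bar> * r ^ (2 * K + 1))"
  proof -
    have "\<bar>Re (\<sigma> ^ (2 * K + 2) * (l1 - l0))\<bar> \<le> r ^ (2 * K + 2) * (C * \<rho>)"
      using abs_Re_le_cmod[of "\<sigma> ^ (2 * K + 2) * (l1 - l0)"]
        mult_left_mono[OF l1, of "r ^ (2 * K + 2)", OF zero_le_power[OF r(1)]]
      unfolding norm_mult norm_power r_def by linarith
    moreover have "Re (\<sigma> ^ (2 * K + 2) * (l1 - l0)) = Re (\<sigma> ^ (2 * K + 2) * l1) - Re (\<sigma> ^ (2 * K + 2) * l0)"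
      by (simp add: right_diff_distrib)
    ultimately show ?thesis
      using Re_even_power_mult[of \<sigma> K l0] unfolding r_def y_def by linarith
  qed
  have T2: "Re (\<sigma> ^ (2 * K + 4) * l2) \<le> b * (r ^ (2 * K + 4) * Re l0) + r ^ (2 * K + 4) * (C * \<rho>)
      + 2 * real (K + 1) * norm l0 * (\<bar>y\<bar> * r ^ (2 * K + 3))"
  proof -
    have "\<bar>Re (\<sigma> ^ (2 * K + 4) * (l2 - of_real b * l0))\<bar> \<le> r ^ (2 * K + 4) * (C * \<rho>)"
      using abs_Re_le_cmod[of "\<sigma> ^ (2 * K + 4) * (l2 - of_real b * l0)"]
        mult_left_mono[OF l2, of "r ^ (2 * K + 4)", OF zero_le_power[OF r(1)]]
      unfolding norm_mult norm_power r_def b_def by linarith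
    moreover have "Re (\<sigma> ^ (2 * K + 4) * (l2 - of_real b * l0))
        = Re (\<sigma> ^ (2 * K + 4) * l2) - b * Re (\<sigma> ^ (2 * K + 4) * l0)"
      by (simp add: algebra_simps)
    moreover have "b * Re (\<sigma> ^ (2 * K + 4) * l0) \<le>
        b * (r ^ (2 * K + 4) * Re l0 + 2 * (real K + 2) * norm l0 * (\<bar>y\<bar> * r ^ (2 * K + 3)))"
      using Re_even_power_mult[of \<sigma> "K + 1" l0] b(1)
      by (intro mult_left_mono) (auto simp: r_def y_def algebra_simps eval_nat_numeral)
    moreover have "b * (r ^ (2 * K + 4) * Re l0 + 2 * (real K + 2) * norm l0 * (\<bar>y\<bar> * r ^ (2 * K + 3)))
        = b * (r ^ (2 * K + 4) * Re l0) + 2 * (b * (real K + 2)) * norm l0 * (\<bar>y\<bar> * r ^ (2 * K + 3))"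
      by (simp only: distrib_left mult_ac)
    ultimately show ?thesis unfolding b(3) by linarith
  qed
  \<comment> \<open>Replacing even powers of \<sigma> by powers of r costs 2 (K + 1) |l0| times |y|
    r^(2K+3) in both terms of T, in the second because b (K + 2) = K + 1. Together this is
    B.\<close>
  have T: "T \<ge> r ^ (2 * K + 4) * (\<alpha> - 2 * C * \<rho>) - B * (\<bar>y\<bar> * r ^ (2 * K + 3))"
  proof -
    have "r\<^sup>2 * Re (\<sigma> ^ (2 * K + 2) * l1) \<ge> r\<^sup>2 * (r ^ (2 * K + 2) * Re l0 - r ^ (2 * K + 2) * (C * \<rho>)
      - 2 * real (K + 1) * norm l0 * (\<bar>y\<bar> * r ^ (2 * K + 1)))"
      using T1 by (intro mult_left_mono) auto
    moreover have "r\<^sup>2 * (r ^ (2 * K + 2) * Re l0 - r ^ (2 * K + 2) * (C * \<rho>)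
      - 2 * real (K + 1) * norm l0 * (\<bar>y\<bar> * r ^ (2 * K + 1)))
      = r ^ (2 * K + 4) * Re l0 - r ^ (2 * K + 4) * (C * \<rho>)
      - 2 * real (K + 1) * norm l0 * (\<bar>y\<bar> * r ^ (2 * K + 3))"
      by (simp add: algebra_simps power2_eq_square eval_nat_numeral)
    ultimately have "T \<ge> r ^ (2 * K + 4) * ((1 - b) * Re l0) - 2 * (r ^ (2 * K + 4) * (C * \<rho>))
      - 4 * real (K + 1) * norm l0 * (\<bar>y\<bar> * r ^ (2 * K + 3))"
      using T2 unfolding T_def by (simp add: algebra_simps)
    thus ?thesis unfolding b(4) B_def by (simp add: algebra_simps)
  qed
  have Re_of_real_mult: "Re (of_real x * z) = x * Re z" and Im_of_real_mult: "Im (of_real x * z) = x * Im z"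
    for x z by simp_all
  have W: "Re (\<sigma>\<^sup>2 + 2 * of_nat M * \<sigma>\<^sup>2 * ((\<Sum>n\<le>degree a. \<i> * of_real (coeff a n * (real n / real (n + 2))) * \<sigma> ^ n)
          + \<sigma> ^ (2 * K + 2) * l2))
      = Re (\<sigma>\<^sup>2) + 2 * real M * (Re (\<sigma> ^ (2 * K + 4) * l2)
          - (\<Sum>n\<le>degree a. coeff a n * (real n / real (n + 2)) * Im (\<sigma> ^ (n + 2))))"
  proof -
    have "\<sigma>\<^sup>2 * (\<Sum>n\<le>degree a. \<i> * of_real (coeff a n * (real n / real (n + 2))) * \<sigma> ^ n)
        = \<i> * (\<Sum>n\<le>degree a. of_real (coeff a n * (real n / real (n + 2))) * \<sigma> ^ (n + 2))"
      by (simp add: sum_distrib_left power_add power2_eq_square mult_ac)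
    hence "2 * of_nat M * \<sigma>\<^sup>2 * ((\<Sum>n\<le>degree a. \<i> * of_real (coeff a n * (real n / real (n + 2))) * \<sigma> ^ n)
          + \<sigma> ^ (2 * K + 2) * l2)
      = of_real (2 * real M) * (\<i> * (\<Sum>n\<le>degree a. of_real (coeff a n * (real n / real (n + 2))) * \<sigma> ^ (n + 2)) + \<sigma> ^ (2 * K + 4) * l2)"
      by (simp add: algebra_simps eval_nat_numeral)
    moreover have "Re (\<i> * (\<Sum>n\<le>degree a. of_real (coeff a n * (real n / real (n + 2))) * \<sigma> ^ (n + 2)))
        = - (\<Sum>n\<le>degree a. coeff a n * (real n / real (n + 2)) * Im (\<sigma> ^ (n + 2)))"
      by (simp only: Re_i_times Im_sum Im_of_real_mult sum_negf)
    ultimately show ?thesis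
      by (simp only: plus_complex.sel Re_of_real_mult) (simp add: algebra_simps)
  qed
  have L: "Re (\<i> * poly (map_poly of_real a) \<sigma> + \<sigma> ^ (2 * K + 2) * l1)
      = - (\<Sum>n\<le>degree a. coeff a n * Im (\<sigma> ^ n)) + Re (\<sigma> ^ (2 * K + 2) * l1)"
  proof -
    have "poly (map_poly of_real a) \<sigma> = (\<Sum>n\<le>degree a. of_real (coeff a n) * \<sigma> ^ n)"
      by (simp add: poly_altdef coeff_map_poly degree_map_poly)
    thus ?thesis by (simp add: Im_of_real_mult)
  qed
  \<comment> \<open>Only a lower bound is sought, so exp may be replaced by its tangent at
    0.\<close>
  let ?e = "2 * real M * Re (\<i> * poly (map_poly of_real a) \<sigma> + \<sigma> ^ (2 * K + 2) * l1)"
  have "r\<^sup>2 * exp ?e \<ge> r\<^sup>2 * (1 + ?e)"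
    by (intro mult_left_mono exp_ge_add_one_self) auto
  moreover have "r\<^sup>2 - Re (\<sigma>\<^sup>2) = 2 * y\<^sup>2"
    unfolding r_def y_def cmod_power2 by (simp add: power2_eq_square)
  moreover have "r\<^sup>2 * ?e - 2 * real M * (Re (\<sigma> ^ (2 * K + 4) * l2)
          - (\<Sum>n\<le>degree a. coeff a n * (real n / real (n + 2)) * Im (\<sigma> ^ (n + 2)))) = 2 * real M * (S + T)"
    unfolding L S_def T_def right_diff_distrib sum_subtractf
    by (simp add: algebra_simps sum_distrib_left)
  ultimately have main: "r\<^sup>2 * exp ?e - (Re (\<sigma>\<^sup>2) + 2 * real M * (Re (\<sigma> ^ (2 * K + 4) * l2)
          - (\<Sum>n\<le>degree a. coeff a n * (real n / real (n + 2)) * Im (\<sigma> ^ (n + 2)))))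
       \<ge> 2 * y\<^sup>2 + 2 * real M * (S + T)"
    by (simp add: distrib_left)
  \<comment> \<open>Of the two copies of y^2, one pays for S and the other for the mixed term in
    T.\<close>
  have "2 * real M * S \<ge> - y\<^sup>2"
  proof -
    have "A \<ge> 0" unfolding A_def by (intro sum_nonneg) auto
    have "2 * real M * \<bar>S\<bar> \<le> 2 * real M * (A * (y\<^sup>2 * r))"
      using S by (intro mult_left_mono) auto
    also have "\<dots> \<le> 2 * real M * (A * (y\<^sup>2 * \<rho>))"
      using r \<open>A \<ge> 0\<close> by (intro mult_left_mono) auto
    also have "\<dots> = (2 * real M * A * \<rho>) * y\<^sup>2" by (simp add: mult_ac)
    also have "\<dots> \<le> 1 * y\<^sup>2" using small(1) by (intro mult_right_mono) auto
    finally have "2 * real M * \<bar>S\<bar> \<le> y\<^sup>2" by simp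
    moreover have "2 * real M * (- \<bar>S\<bar>) \<le> 2 * real M * S" by (intro mult_left_mono) auto
    ultimately show ?thesis by linarith
  qed
  moreover have "2 * real M * T \<ge> real M * \<alpha> * r ^ (2 * K + 4) - y\<^sup>2"
  proof -
    \<comment> \<open>Young's inequality for the mixed term: the square of r^(2K+3) is r^(2K+4)
      times r^(2K+2), and the surplus factor makes it small.\<close>
    have "0 \<le> (\<bar>y\<bar> - real M * B * r ^ (2 * K + 3))\<^sup>2" by simp
    hence "2 * real M * (B * (\<bar>y\<bar> * r ^ (2 * K + 3))) \<le> y\<^sup>2 + (real M * B * r ^ (2 * K + 3))\<^sup>2"
      by (simp add: power2_diff mult_ac)
    also have "(real M * B * r ^ (2 * K + 3))\<^sup>2 = real M * ((real M * B\<^sup>2) * (r ^ (2 * K + 4) * r ^ (2 * K + 2)))"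
      by (simp add: power2_eq_square eval_nat_numeral mult_ac)
    also have "\<dots> \<le> real M * ((real M * B\<^sup>2) * (r ^ (2 * K + 4) * \<rho>))"
      using r power_decreasing[of 1 "2 * K + 2" r]
      by (intro mult_left_mono) auto
    also have "\<dots> = real M * r ^ (2 * K + 4) * (real M * B\<^sup>2 * \<rho>)" by (simp add: mult_ac)
    also have "\<dots> \<le> real M * r ^ (2 * K + 4) * (\<alpha> / 2)"
      using small(3) r by (intro mult_left_mono) auto
    finally have 1: "2 * real M * (B * (\<bar>y\<bar> * r ^ (2 * K + 3))) \<le> y\<^sup>2 + real M * r ^ (2 * K + 4) * (\<alpha> / 2)"
      by simp
    \<comment> \<open>Of 2 M \<alpha>, a quarter goes to the error C \<rho> and a quarter to the
      mixed term; M \<alpha> remains.\<close>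
    have "2 * real M * r ^ (2 * K + 4) * (\<alpha> - 2 * C * \<rho>) \<ge> 2 * real M * r ^ (2 * K + 4) * (3 * \<alpha> / 4)"
      using small(2) r by (intro mult_left_mono) auto
    moreover have "2 * real M * T \<ge> 2 * real M * (r ^ (2 * K + 4) * (\<alpha> - 2 * C * \<rho>) - B * (\<bar>y\<bar> * r ^ (2 * K + 3)))"
      using T by (intro mult_left_mono) auto
    ultimately show ?thesis using 1 by (simp add: right_diff_distrib mult_ac)
  qed
  ultimately show ?thesis using main unfolding W r_def[symmetric] by (simp add: distrib_left)
qed

text \<open>The preceding estimate with \<sigma> = s^M and \<rho> = |s|. L_1 and L_2 are series in s
  and not in s^M, so their deviation from the value at 0 is measured by |s|; this is why \<rho> is
  kept apart from |\<sigma>|.\<close>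

lemma defect_lower_bound:
  fixes l0 :: complex and L1 L2 :: "complex \<Rightarrow> complex" and a :: "real poly" and K M :: nat
  assumes a0: "coeff a 0 = 0" and l0: "Re l0 > 0" and M: "M \<ge> 1" and C: "C \<ge> 0"
    and L1: "eventually (\<lambda>s. norm (L1 s - l0) \<le> C * norm s) (nhds 0)"
    and L2: "eventually (\<lambda>s. norm (L2 s - of_real (real (K + 1) / (real K + 2)) * l0) \<le> C * norm s) (nhds 0)"
  shows "\<exists>\<kappa>>0. eventually (\<lambda>s. \<kappa> * norm s ^ (M * (2 * K + 4)) \<le>
     norm (s * exp (\<i> * poly (map_poly of_real a) (s ^ M) + s ^ (M * (2 * K + 2)) * L1 s)) ^ (2 * M)
     - Im (\<i> * (s ^ (2 * M) + 2 * of_nat M * s ^ (2 * M) *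
          ((\<Sum>n\<le>degree a. \<i> * of_real (coeff a n * (real n / real (n + 2))) * s ^ (M * n))
          + s ^ (M * (2 * K + 2)) * L2 s)))) (nhds 0)"
proof -
  define A where "A = (\<Sum>n\<le>degree a. \<bar>coeff a n\<bar> * (2 * real (n + 2)))"
  define B where "B = 4 * real (K + 1) * norm l0"
  define \<alpha> where "\<alpha> = Re l0 / (real K + 2)"
  have \<alpha>: "\<alpha> > 0" using l0 by (simp add: \<alpha>_def)
  hence \<alpha>4: "\<alpha> / 4 > 0" and \<alpha>2: "\<alpha> / 2 > 0" by simp_all
  have small: "eventually (\<lambda>s::complex. D * norm s < e) (nhds 0)" if "e > 0" for D e :: real
  proof (rule order_tendstoD(2)[OF _ that])
    show "((\<lambda>s::complex. D * norm s) \<longlongrightarrow> 0) (nhds 0)"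
      using tendsto_mult[OF tendsto_const tendsto_norm[OF filterlim_ident], of D "0::complex"] by simp
  qed
  have "eventually (\<lambda>s. real M * \<alpha> * norm s ^ (M * (2 * K + 4)) \<le>
     norm (s * exp (\<i> * poly (map_poly of_real a) (s ^ M) + s ^ (M * (2 * K + 2)) * L1 s)) ^ (2 * M)
     - Im (\<i> * (s ^ (2 * M) + 2 * of_nat M * s ^ (2 * M) *
          ((\<Sum>n\<le>degree a. \<i> * of_real (coeff a n * (real n / real (n + 2))) * s ^ (M * n))
          + s ^ (M * (2 * K + 2)) * L2 s)))) (nhds 0)"
    using L1 L2 small[OF zero_less_one, of 1] small[OF zero_less_one, of "2 * real M * A"]
      small[OF \<alpha>4, of "2 * C"] small[OF \<alpha>2, of "real M * B\<^sup>2"]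
  proof eventually_elim
    case (elim s)
    have s1: "norm s \<le> 1" using elim by simp
    have le: "norm (s ^ M) \<le> norm s"
      using power_decreasing[of 1 M "norm s"] s1 M by (simp add: norm_power)
    have "real M * \<alpha> * norm (s ^ M) ^ (2 * K + 4) \<le>
     (norm (s ^ M))\<^sup>2 * exp (2 * real M * Re (\<i> * poly (map_poly of_real a) (s ^ M) + (s ^ M) ^ (2 * K + 2) * L1 s))
     - Re ((s ^ M)\<^sup>2 + 2 * of_nat M * (s ^ M)\<^sup>2 * ((\<Sum>n\<le>degree a. \<i> * of_real (coeff a n * (real n / real (n + 2))) * (s ^ M) ^ n)
          + (s ^ M) ^ (2 * K + 2) * L2 s))"
      unfolding \<alpha>_def
      by (rule defect_lower_bound_aux[OF a0 le s1 M C elim(1,2)])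
         (use elim(4-6) in \<open>simp_all add: A_def B_def \<alpha>_def\<close>)
    moreover have "norm (s * exp X) ^ (2 * M) = (norm (s ^ M))\<^sup>2 * exp (2 * real M * Re X)" for X
    proof -
      have "exp (2 * real M * Re X) = exp (Re X) ^ (2 * M)"
        by (subst exp_of_nat_mult[symmetric]) simp
      thus ?thesis by (simp add: norm_mult power_mult_distrib norm_power mult.commute flip: power_mult)
    qed
    moreover have "s ^ (2 * M) = (s ^ M)\<^sup>2" and "norm s ^ (M * (2 * K + 4)) = norm (s ^ M) ^ (2 * K + 4)"
      and "\<And>j. s ^ (M * j) = (s ^ M) ^ j"
      by (simp_all only: norm_power power_mult mult.commute[of 2 M])
    ultimately show ?case by (simp only: Im_i_times)
  qed
  thus ?thesis using \<alpha> M by (intro exI[of _ "real M * \<alpha>"]) auto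
qed

text \<open>For real s the value A_0(s^M) is real, so A_0 affects neither |t| nor Im phi(t), and
  only L_1 and L_2 contribute.\<close>

lemma defect_upper_bound:
  fixes L1 L2 :: "complex \<Rightarrow> complex" and a :: "real poly" and K M :: nat
  assumes M: "M \<ge> 1"
    and L1: "eventually (\<lambda>s. norm (L1 s) \<le> B) (nhds 0)" and L2: "eventually (\<lambda>s. norm (L2 s) \<le> B) (nhds 0)"
  shows "\<exists>C. eventually (\<lambda>x. 
     norm (of_real x * exp (\<i> * poly (map_poly of_real a) (of_real x ^ M) + of_real x ^ (M * (2 * K + 2)) * L1 (of_real x))) ^ (2 * M)
     - Im (\<i> * (of_real x ^ (2 * M) + 2 * of_nat M * of_real x ^ (2 * M) *
          ((\<Sum>n\<le>degree a. \<i> * of_real (coeff a n * (real n / real (n + 2))) * of_real x ^ (M * n))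
          + of_real x ^ (M * (2 * K + 2)) * L2 (of_real x)))) \<le> C * x ^ (M * (2 * K + 4))) (at_right 0)"
proof -
  have lim: "filterlim (\<lambda>x. of_real x :: complex) (nhds 0) (at_right 0)"
    using tendsto_of_real[OF tendsto_ident_at, of 0 "{0<..}"] by simp
  have small: "eventually (\<lambda>x. D * x < 1) (at_right (0::real))" for D
  proof (rule order_tendstoD(2))
    show "((\<lambda>x. D * x) \<longlongrightarrow> 0) (at_right 0)"
      using tendsto_mult[OF tendsto_const tendsto_ident_at, of D "0::real" "{0<..}"] by simp
  qed simp
  \<comment> \<open>Of the constant 6 M B, 4 M B stems from exp u \<le> 1 + 2 |u| with |u| \<le> 2 M
    B x^(M(2K+2)), and 2 M B from L_2.\<close>
  have "eventually (\<lambda>x. 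
     norm (of_real x * exp (\<i> * poly (map_poly of_real a) (of_real x ^ M) + of_real x ^ (M * (2 * K + 2)) * L1 (of_real x))) ^ (2 * M)
     - Im (\<i> * (of_real x ^ (2 * M) + 2 * of_nat M * of_real x ^ (2 * M) *
          ((\<Sum>n\<le>degree a. \<i> * of_real (coeff a n * (real n / real (n + 2))) * of_real x ^ (M * n))
          + of_real x ^ (M * (2 * K + 2)) * L2 (of_real x)))) \<le> (6 * real M * B) * x ^ (M * (2 * K + 4))) (at_right 0)"
    using eventually_compose_filterlim[OF L1 lim] eventually_compose_filterlim[OF L2 lim]
      small[of 1] small[of "2 * real M * B"] eventually_at_right_less[of 0]
  proof eventually_elim
    case (elim x)
    define l1 where "l1 = L1 (of_real x)"
    define l2 where "l2 = L2 (of_real x)"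
    have x: "0 < x" "x \<le> 1" using elim by auto
    have B: "B \<ge> 0" using elim(1) norm_ge_zero order_trans by blast
    let ?p = "M * (2 * K + 2)"
    define u where "u = 2 * real M * (x ^ ?p * Re l1)"
    have Rl: "\<bar>Re l1\<bar> \<le> B" "\<bar>Re l2\<bar> \<le> B"
      using elim(1,2) abs_Re_le_cmod order_trans unfolding l1_def l2_def by blast+
    have u: "\<bar>u\<bar> \<le> 2 * real M * B * x ^ ?p"
    proof -
      have "\<bar>u\<bar> = 2 * real M * (x ^ ?p * \<bar>Re l1\<bar>)" using x by (simp add: u_def abs_mult)
      also have "\<dots> \<le> 2 * real M * (x ^ ?p * B)" using Rl x by (intro mult_left_mono) auto
      finally show ?thesis by (simp add: mult_ac)
    qed
    have "2 * real M * B * x ^ ?p \<le> 2 * real M * B * x"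
      using power_decreasing[of 1 ?p x] x M B by (intro mult_left_mono) auto
    hence u1: "\<bar>u\<bar> \<le> 1" using u elim by linarith
    have "exp u \<le> exp \<bar>u\<bar>" by simp
    also have "\<dots> \<le> 1 + \<bar>u\<bar> + \<bar>u\<bar>\<^sup>2" using u1 by (intro exp_bound) auto
    also have "\<bar>u\<bar>\<^sup>2 \<le> \<bar>u\<bar>" 
      using mult_left_le[of "\<bar>u\<bar>" "\<bar>u\<bar>"] u1 unfolding power2_eq_square by simp
    finally have eu: "exp u \<le> 1 + 2 * \<bar>u\<bar>" by simp
    have "poly (map_poly of_real a) (of_real x ^ M) = (of_real (poly a (x ^ M)) :: complex)"
      by (simp add: poly_altdef coeff_map_poly degree_map_poly)
    hence "Re (\<i> * poly (map_poly of_real a) (of_real x ^ M) + of_real x ^ ?p * l1) = x ^ ?p * Re l1"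
      by (simp flip: of_real_power)
    moreover have "norm (of_real x * exp X) ^ (2 * M) = x ^ (2 * M) * exp (2 * real M * Re X)" for X
    proof -
      have "exp (2 * real M * Re X) = exp (Re X) ^ (2 * M)"
        by (subst exp_of_nat_mult[symmetric]) simp
      thus ?thesis using x by (simp add: norm_mult power_mult_distrib)
    qed
    ultimately have 1: "norm (of_real x * exp (\<i> * poly (map_poly of_real a) (of_real x ^ M) + of_real x ^ ?p * l1)) ^ (2 * M)
        = x ^ (2 * M) * exp u" by (simp add: u_def)
    have "(\<Sum>n\<le>degree a. \<i> * of_real (coeff a n * (real n / real (n + 2))) * of_real x ^ (M * n))
        = \<i> * of_real (\<Sum>n\<le>degree a. coeff a n * (real n / real (n + 2)) * x ^ (M * n))"
      by (simp add: sum_distrib_left mult_ac)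
    hence 2: "Im (\<i> * (of_real x ^ (2 * M) + 2 * of_nat M * of_real x ^ (2 * M) *
          ((\<Sum>n\<le>degree a. \<i> * of_real (coeff a n * (real n / real (n + 2))) * of_real x ^ (M * n))
          + of_real x ^ ?p * l2))) = x ^ (2 * M) + 2 * real M * x ^ (2 * M) * (x ^ ?p * Re l2)"
      by (simp flip: of_real_power)
    have "x ^ (2 * M) * exp u - (x ^ (2 * M) + 2 * real M * x ^ (2 * M) * (x ^ ?p * Re l2))
        \<le> x ^ (2 * M) * (1 + 2 * \<bar>u\<bar>) - (x ^ (2 * M) - 2 * real M * x ^ (2 * M) * (x ^ ?p * B))"
    proof (intro diff_mono mult_left_mono eu)
      have "x ^ ?p * (- B) \<le> x ^ ?p * Re l2" using Rl x by (intro mult_left_mono) auto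
      hence "2 * real M * x ^ (2 * M) * (x ^ ?p * (- B)) \<le> 2 * real M * x ^ (2 * M) * (x ^ ?p * Re l2)"
        by (rule mult_left_mono) (use x in auto)
      hence "- (2 * real M * x ^ (2 * M) * (x ^ ?p * B)) \<le> 2 * real M * x ^ (2 * M) * (x ^ ?p * Re l2)"
        by (simp only: mult_minus_right)
      thus "x ^ (2 * M) - 2 * real M * x ^ (2 * M) * (x ^ ?p * B) \<le> x ^ (2 * M) + 2 * real M * x ^ (2 * M) * (x ^ ?p * Re l2)"
        by linarith
    qed (use x in auto)
    also have "\<dots> \<le> x ^ (2 * M) * (1 + 2 * (2 * real M * B * x ^ ?p)) - (x ^ (2 * M) - 2 * real M * x ^ (2 * M) * (x ^ ?p * B))"
      by (intro diff_right_mono mult_left_mono add_left_mono u) (use x in auto)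
    also have "\<dots> = 6 * real M * B * (x ^ (2 * M) * x ^ ?p)" by (simp add: algebra_simps)
    also have "x ^ (2 * M) * x ^ ?p = x ^ (M * (2 * K + 4))"
      by (simp add: algebra_simps flip: power_add)
    finally show ?case unfolding l1_def[symmetric] l2_def[symmetric] 1 2 .
  qed
  thus ?thesis by blast
qed

section \<open>The normalized parameter s = \<Phi>(t) and the series of phi in s\<close>

lemma eval_fps_minus_nth_0_le:
  fixes f :: "complex fps"
  assumes "fps_conv_radius f > 0"
  shows "\<exists>C\<ge>0. eventually (\<lambda>s. norm (eval_fps f s - fps_nth f 0) \<le> C * norm s) (nhds 0)"
proof -
  define g where "g = fps_shift 1 f"
  have f_eq: "f = fps_const (fps_nth f 0) + fps_X * g"
    by (rule fps_ext) (simp add: g_def)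
  have g: "fps_conv_radius g > 0" using assms by (simp add: g_def)
  hence ex: "eval_fps g has_fps_expansion g" by (rule eval_fps_has_fps_expansion)
  have "(\<lambda>s. fps_nth f 0 + s * eval_fps g s) has_fps_expansion f"
    by (subst f_eq) (intro fps_expansion_intros ex)
  hence ev: "eventually (\<lambda>s. eval_fps f s = fps_nth f 0 + s * eval_fps g s) (nhds 0)"
    by (simp add: has_fps_expansion_def)
  have "eval_fps g \<midarrow>0\<rightarrow> eval_fps g 0"
    using g by (intro isContD continuous_eval_fps) (simp add: zero_ereal_def)
  hence "((\<lambda>s. norm (eval_fps g s)) \<longlongrightarrow> norm (eval_fps g 0)) (nhds 0)"
    using tendsto_at_iff_tendsto_nhds tendsto_norm by blast
  hence "eventually (\<lambda>s. norm (eval_fps g s) < norm (eval_fps g 0) + 1) (nhds 0)"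
    by (rule order_tendstoD) simp
  with ev have "eventually (\<lambda>s. norm (eval_fps f s - fps_nth f 0) \<le> (norm (eval_fps g 0) + 1) * norm s) (nhds 0)"
  proof eventually_elim
    case (elim s)
    have "norm s * norm (eval_fps g s) \<le> norm s * (norm (eval_fps g 0) + 1)"
      using elim by (intro mult_left_mono) auto
    thus ?case using elim by (simp add: norm_mult mult.commute)
  qed
  thus ?thesis by (intro exI[of _ "norm (eval_fps g 0) + 1"]) auto
qed

text \<open>The Euler operator X d/dX takes the place of integration: it multiplies the n-th
  coefficient by n and shifts no exponent.\<close>

lemma fps_eq_of_X_deriv:
  fixes f g :: "complex fps"
  assumes "fps_X * fps_deriv f = fps_X * fps_deriv g" "fps_nth f 0 = fps_nth g 0"
  shows "f = g"
  using assms by (simp add: fps_deriv_eq_iff)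

lemma X_deriv_nth: "fps_nth (fps_X * fps_deriv f) n = of_nat n * fps_nth (f :: complex fps) n"
  by (cases n) simp_all

lemma X_deriv_X_power: "fps_X * fps_deriv (fps_X ^ m) = (of_nat m * fps_X ^ m :: complex fps)"
  by (rule fps_ext) (simp add: X_deriv_nth fps_X_power_nth fps_mult_of_nat_nth)

lemma X_deriv_X_power_mult:
  fixes g :: "complex fps"
  shows "fps_X * fps_deriv (fps_X ^ m * g) = fps_X ^ m * (of_nat m * g + fps_X * fps_deriv g)"
proof -
  have "fps_X * fps_deriv (fps_X ^ m * g) = (fps_X * fps_deriv (fps_X ^ m)) * g + fps_X ^ m * (fps_X * fps_deriv g)"
    by (simp only: fps_deriv_mult distrib_left mult_ac add.commute)
  thus ?thesis by (simp only: X_deriv_X_power distrib_left mult_ac)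
qed

lemma fps_of_poly_compose:
  fixes g :: "complex fps"
  assumes "fps_nth g 0 = 0"
  shows "fps_compose (fps_of_poly p) g = (\<Sum>n\<le>degree p. fps_const (coeff p n) * g ^ n)"
proof -
  have "fps_of_poly p = (\<Sum>n\<le>degree p. fps_const (coeff p n) * fps_X ^ n)"
    by (rule fps_ext) (auto simp: fps_sum_nth coeff_eq_0 if_distrib [of "\<lambda>x. _ * x"] cong: if_cong)
  thus ?thesis
    using assms by (simp add: fps_compose_sum_distrib fps_compose_mult_distrib flip: fps_compose_power)
qed

text \<open>Here \<psi> = s e^(L(s)) is the compositional inverse of \<Phi>. Substituting t =
  \<psi>(s) into the definition of \<Phi> gives \<psi> phi'(\<psi>) = 2 M i s^(2M), and s \<psi>' =
  \<psi> (1 + s L'); the product is the differentiated form of the parametrization by s.\<close>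

lemma associated_series_compose:
  assumes L: "fps_nth L 0 = 0" and M: "M \<ge> 1"
    and \<Phi>: "fps_nth \<Phi> 0 = 0" "fps_nth \<Phi> 1 = 1"
      "\<Phi> ^ (2 * M) = fps_const (\<i> / (- 2 * of_nat M)) * fps_X * fps_deriv \<phi>"
      "fps_compose (fps_exp 1) L = fps_shift 1 (fps_inv \<Phi>)"
  defines "\<psi> \<equiv> fps_X * fps_compose (fps_exp 1) L"
  shows "fps_compose \<psi> \<Phi> = fps_X"
    and "fps_X * fps_deriv (fps_compose \<phi> \<psi>)
          = fps_const (2 * of_nat M * \<i>) * fps_X ^ (2 * M) * (1 + fps_X * fps_deriv L)"
proof -
  define E where "E = fps_compose (fps_exp 1) L"
  \<comment> \<open>Multiplication by X undoes the shift because the inverse series has constant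
    coefficient 0.\<close>
  have \<psi>: "\<psi> = fps_inv \<Phi>"
    unfolding \<psi>_def \<Phi>(4) by (rule fps_ext) (auto simp: fps_inv_def)
  show \<psi>\<Phi>: "fps_compose \<psi> \<Phi> = fps_X"
    unfolding \<psi> by (rule fps_inv) (use \<Phi> in auto)
  have \<Phi>\<psi>: "fps_compose \<Phi> \<psi> = fps_X"
    unfolding \<psi> by (rule fps_inv_right) (use \<Phi> in auto)
  have \<psi>0: "fps_nth \<psi> 0 = 0" by (simp add: \<psi>_def)
  have "fps_const (\<i> / (- 2 * of_nat M)) * (\<psi> * fps_compose (fps_deriv \<phi>) \<psi>) = fps_compose (\<Phi> ^ (2 * M)) \<psi>"
    unfolding \<Phi>(3) using \<psi>0 by (simp add: fps_compose_mult_distrib mult.assoc)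
  also have "\<dots> = fps_X ^ (2 * M)"
    by (simp add: fps_compose_power[OF \<psi>0, symmetric] \<Phi>\<psi>)
  finally have "fps_const (2 * of_nat M * \<i>) * (fps_const (\<i> / (- 2 * of_nat M)) * (\<psi> * fps_compose (fps_deriv \<phi>) \<psi>))
      = fps_const (2 * of_nat M * \<i>) * fps_X ^ (2 * M)" by simp
  also have "fps_const (2 * of_nat M * \<i>) * (fps_const (\<i> / (- 2 * of_nat M)) * (\<psi> * fps_compose (fps_deriv \<phi>) \<psi>))
      = \<psi> * fps_compose (fps_deriv \<phi>) \<psi>"
    using M unfolding mult.assoc[symmetric] fps_const_mult by simp
  finally have eq: "\<psi> * fps_compose (fps_deriv \<phi>) \<psi> = fps_const (2 * of_nat M * \<i>) * fps_X ^ (2 * M)" .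
  have "fps_deriv E = E * fps_deriv L"
    unfolding E_def using L by (simp add: fps_compose_deriv)
  hence d\<psi>: "fps_deriv \<psi> = E * (1 + fps_X * fps_deriv L)"
    unfolding \<psi>_def E_def[symmetric] by (simp add: algebra_simps)
  have "fps_X * fps_deriv (fps_compose \<phi> \<psi>) = fps_X * (fps_compose (fps_deriv \<phi>) \<psi> * fps_deriv \<psi>)"
    using \<psi>0 by (simp add: fps_compose_deriv)
  also have "\<dots> = (\<psi> * fps_compose (fps_deriv \<phi>) \<psi>) * (1 + fps_X * fps_deriv L)"
    unfolding d\<psi> by (simp add: \<psi>_def E_def mult_ac)
  finally show "fps_X * fps_deriv (fps_compose \<phi> \<psi>)
          = fps_const (2 * of_nat M * \<i>) * fps_X ^ (2 * M) * (1 + fps_X * fps_deriv L)"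
    unfolding eq .
qed

text \<open>A term x^m of L yields m/(m + 2M) x^(m+2M) in the integral of x^(2M) L'(x). For m = M n
  the factor is n/(n+2); for m = 2 M k + n it is the weight in \<open>L2\<close>.\<close>

lemma isolated_type_compose:
  fixes a :: "real poly" and L1 :: "complex fps"
  assumes M: "M \<ge> 1" and \<psi>0: "fps_nth \<psi> 0 = 0" and \<phi>0: "fps_nth \<phi> 0 = 0"
    and deriv: "fps_X * fps_deriv (fps_compose \<phi> \<psi>)
          = fps_const (2 * of_nat M * \<i>) * fps_X ^ (2 * M) * (1 + fps_X * fps_deriv L)"
    and L: "L = (\<Sum>n\<le>degree a. fps_const (\<i> * of_real (coeff a n)) * fps_X ^ (M * n)) + fps_X ^ (2 * M * k) * L1"
  defines "L2 \<equiv> Abs_fps (\<lambda>n. fps_nth L1 n * of_real (real (2 * M * k + n) / real (2 * M * k + 2 * M + n)))"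
  shows "fps_compose \<phi> \<psi> = fps_const \<i> * (fps_X ^ (2 * M) + 2 * of_nat M * (fps_X ^ (2 * M) *
           ((\<Sum>n\<le>degree a. fps_const (\<i> * of_real (coeff a n * (real n / real (n + 2)))) * fps_X ^ (M * n))
              + fps_X ^ (2 * M * k) * L2)))"
proof (rule fps_eq_of_X_deriv)
  define J1 where "J1 = (\<Sum>n\<le>degree a. fps_const (\<i> * of_real (coeff a n * (real n / real (n + 2)))) * (fps_X :: complex fps) ^ (M * n))"
  \<comment> \<open>\<open>fps_X ^ (2 * M) * J\<close> is the integral of x^(2M) L'(x), which
    amounts to the equation 2 M J + X J' = X L'.\<close>
  define J where "J = J1 + fps_X ^ (2 * M * k) * L2"
  have XdX: "fps_X * fps_deriv (fps_const c * fps_X ^ m) = fps_const c * (of_nat m * fps_X ^ m)"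
    for c :: complex and m
    by (rule fps_ext) (simp add: X_deriv_nth)
  have distrib': "of_nat (2 * M) * (fps_const c * fps_X ^ (M * n)) + fps_const c * (of_nat (M * n) * fps_X ^ (M * n))
      = fps_const (of_nat (2 * M + M * n) * c) * fps_X ^ (M * n)" for c :: complex and n
    by (rule fps_ext) (simp add: algebra_simps)
  have mult_of_nat: "fps_const (c * of_nat m) * f = fps_const c * (of_nat m * f)" for c :: complex and m f
    by (rule fps_ext) simp
  have "of_nat (2 * M) * J1 + fps_X * fps_deriv J1
      = (\<Sum>n\<le>degree a. fps_X * fps_deriv (fps_const (\<i> * of_real (coeff a n)) * fps_X ^ (M * n)))"
    unfolding J1_def fps_deriv_sum sum_distrib_left XdX sum.distrib[symmetric]
  proof (intro sum.cong refl)
    fix n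
    have "of_nat (2 * M) * (fps_const (\<i> * of_real (coeff a n * (real n / real (n + 2)))) * (fps_X :: complex fps) ^ (M * n)) +
        fps_const (\<i> * of_real (coeff a n * (real n / real (n + 2)))) * (of_nat (M * n) * fps_X ^ (M * n))
      = fps_const (of_nat (2 * M + M * n) * (\<i> * of_real (coeff a n * (real n / real (n + 2))))) * fps_X ^ (M * n)"
      by (rule distrib')
    also have "of_nat (2 * M + M * n) * (\<i> * of_real (coeff a n * (real n / real (n + 2)))) = \<i> * of_real (coeff a n) * of_nat (M * n)"
    proof -
      have "real (2 * M + M * n) * (coeff a n * (real n / real (n + 2))) = coeff a n * real (M * n)"
        by (simp add: field_simps)
      hence "of_real (real (2 * M + M * n) * (coeff a n * (real n / real (n + 2)))) = (of_real (coeff a n * real (M * n)) :: complex)"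
        by simp
      thus ?thesis by (simp only: of_real_mult of_real_of_nat_eq mult_ac)
    qed
    finally show "of_nat (2 * M) * (fps_const (\<i> * of_real (coeff a n * (real n / real (n + 2)))) * (fps_X :: complex fps) ^ (M * n)) +
        fps_const (\<i> * of_real (coeff a n * (real n / real (n + 2)))) * (of_nat (M * n) * fps_X ^ (M * n))
      = fps_const (\<i> * of_real (coeff a n)) * (of_nat (M * n) * fps_X ^ (M * n))"
      by (simp only: mult_of_nat)
  qed
  moreover have "of_nat (2 * M) * (fps_X ^ (2 * M * k) * L2) + fps_X * fps_deriv (fps_X ^ (2 * M * k) * L2)
      = fps_X * fps_deriv (fps_X ^ (2 * M * k) * L1)"
  proof -
    have "of_nat (2 * M + 2 * M * k) * L2 + fps_X * fps_deriv L2 = of_nat (2 * M * k) * L1 + fps_X * fps_deriv L1"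
    proof (rule fps_ext)
      fix n
      have "of_nat (2 * M * k + 2 * M + n) * (of_real (real (2 * M * k + n) / real (2 * M * k + 2 * M + n)))
          = (of_nat (2 * M * k + n) :: complex)"
      proof -
        have "real (2 * M * k + 2 * M + n) * (real (2 * M * k + n) / real (2 * M * k + 2 * M + n)) = real (2 * M * k + n)"
        proof -
          have "real (2 * M * k + 2 * M + n) \<noteq> 0" using M unfolding of_nat_eq_0_iff by simp
          thus ?thesis unfolding times_divide_eq_right by (rule nonzero_mult_div_cancel_left)
        qed
        hence "of_real (real (2 * M * k + 2 * M + n) * (real (2 * M * k + n) / real (2 * M * k + 2 * M + n)))
            = (of_real (real (2 * M * k + n)) :: complex)" by (simp only:)
        thus ?thesis by (simp only: of_real_mult of_real_of_nat_eq)
      qed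
      hence "fps_nth L1 n * (of_nat (2 * M * k + 2 * M + n) * (of_real (real (2 * M * k + n) / real (2 * M * k + 2 * M + n))))
          = fps_nth L1 n * of_nat (2 * M * k + n)" by (simp only:)
      hence "of_nat (2 * M * k + 2 * M + n) * fps_nth L2 n = of_nat (2 * M * k + n) * fps_nth L1 n"
        by (simp only: L2_def fps_nth_Abs_fps mult_ac)
      thus "fps_nth (of_nat (2 * M + 2 * M * k) * L2 + fps_X * fps_deriv L2) n
          = fps_nth (of_nat (2 * M * k) * L1 + fps_X * fps_deriv L1) n"
        by (simp only: fps_add_nth fps_mult_of_nat_nth X_deriv_nth distrib_right[symmetric] of_nat_add[symmetric] add_ac)
    qed
    hence "fps_X ^ (2 * M * k) * (of_nat (2 * M + 2 * M * k) * L2 + fps_X * fps_deriv L2)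
        = fps_X ^ (2 * M * k) * (of_nat (2 * M * k) * L1 + fps_X * fps_deriv L1)" by simp
    thus ?thesis unfolding X_deriv_X_power_mult by (simp only: of_nat_add distrib_left distrib_right mult_ac add_ac)
  qed
  ultimately have "(of_nat (2 * M) * J1 + fps_X * fps_deriv J1)
        + (of_nat (2 * M) * (fps_X ^ (2 * M * k) * L2) + fps_X * fps_deriv (fps_X ^ (2 * M * k) * L2))
      = fps_X * fps_deriv L"
    by (simp only: L fps_deriv_add fps_deriv_sum distrib_left sum_distrib_left)
  hence J: "of_nat (2 * M) * J + fps_X * fps_deriv J = fps_X * fps_deriv L"
    by (simp only: J_def fps_deriv_add distrib_left add_ac)
  show "fps_X * fps_deriv (fps_compose \<phi> \<psi>) = fps_X * fps_deriv (fps_const \<i> * (fps_X ^ (2 * M) + 2 * of_nat M * (fps_X ^ (2 * M) *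
           ((\<Sum>n\<le>degree a. fps_const (\<i> * of_real (coeff a n * (real n / real (n + 2)))) * fps_X ^ (M * n))
              + fps_X ^ (2 * M * k) * L2))))"
  proof -
    have X: "fps_X * fps_deriv (fps_X ^ (2 * M)) = (of_nat (2 * M) * fps_X ^ (2 * M) :: complex fps)"
      by (rule X_deriv_X_power)
    have linear: "fps_X * fps_deriv (fps_const c * (f + of_nat m * g)) = fps_const c * (fps_X * fps_deriv f + of_nat m * (fps_X * fps_deriv g))"
      for c :: complex and m f g
      by (rule fps_ext) (simp only: X_deriv_nth fps_mult_left_const_nth fps_add_nth fps_mult_of_nat_nth,
        simp only: distrib_left mult_ac)
    have "fps_X * fps_deriv (fps_const \<i> * (fps_X ^ (2 * M) + of_nat (2 * M) * (fps_X ^ (2 * M) * J)))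
        = fps_const \<i> * (fps_X * fps_deriv (fps_X ^ (2 * M)) + of_nat (2 * M) * (fps_X * fps_deriv (fps_X ^ (2 * M) * J)))"
      by (rule linear)
    also have "\<dots> = fps_const \<i> * of_nat (2 * M) * fps_X ^ (2 * M) * (1 + (of_nat (2 * M) * J + fps_X * fps_deriv J))"
      unfolding X X_deriv_X_power_mult by (simp only: distrib_left mult_ac mult_1_right mult_1_left)
    also have "fps_const \<i> * of_nat (2 * M) = fps_const (2 * of_nat M * \<i>)"
      unfolding fps_of_nat[symmetric] fps_const_mult by (simp add: mult_ac)
    finally show ?thesis unfolding deriv J by (simp only: J_def J1_def of_nat_mult of_nat_numeral)
  qed
  show "fps_nth (fps_compose \<phi> \<psi>) 0 = fps_nth (fps_const \<i> * (fps_X ^ (2 * M) + 2 * of_nat M * (fps_X ^ (2 * M) *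
           ((\<Sum>n\<le>degree a. fps_const (\<i> * of_real (coeff a n * (real n / real (n + 2)))) * fps_X ^ (M * n))
              + fps_X ^ (2 * M * k) * L2)))) 0"
    using M \<phi>0 by (simp add: fps_mult_nth_0 fps_X_power_nth)
qed

lemma has_fps_expansion_eventually_eq:
  fixes f g :: "complex \<Rightarrow> complex"
  assumes "f has_fps_expansion F" "g has_fps_expansion F"
  shows "eventually (\<lambda>z. f z = g z) (nhds 0)"
proof -
  have "eventually (\<lambda>z. eval_fps F z = f z) (nhds 0)" "eventually (\<lambda>z. eval_fps F z = g z) (nhds 0)"
    using assms by (auto simp: has_fps_expansion_def)
  thus ?thesis by eventually_elim simp
qed

lemma has_fps_expansion_filterlim:
  fixes f :: "complex \<Rightarrow> complex"
  assumes "f has_fps_expansion F"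
  shows "filterlim f (nhds (fps_nth F 0)) (nhds 0)"
proof -
  have "f 0 = fps_nth F 0" using assms by (rule has_fps_expansion_imp_0_eq_fps_nth_0)
  moreover have "isCont f 0" using has_fps_expansion_imp_continuous[OF assms] by blast
  ultimately show ?thesis using tendsto_at_iff_tendsto_nhds unfolding continuous_at by metis
qed

text \<open>Transfer from s to t. The lower bound concerns all small t and is pulled back along s =
  \<Phi>(t); the upper bound is wanted on one curve only, the image of the positive reals under
  \<Psi>.\<close>

lemma isolated_type_defect_bounds:
  assumes M: "M \<ge> 1" and \<phi>: "fps_conv_radius \<phi> > 0" "fps_nth \<phi> 0 = 0" and iso: "isolated_type M \<phi> K"
  shows "\<exists>\<kappa>>0. eventually (\<lambda>t. \<kappa> * norm t ^ (M * (2 * (1 + K))) \<le> norm t ^ (2 * M) - Im (eval_fps \<phi> t)) (nhds 0)"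
    and "\<exists>\<tau> C. eventually (\<lambda>x. x / 2 \<le> norm (\<tau> x) \<and> norm (\<tau> x) \<le> 2 * x \<and>
           norm (\<tau> x) ^ (2 * M) - Im (eval_fps \<phi> (\<tau> x)) \<le> C * x ^ (M * (2 * (1 + K)))) (at_right (0::real))"
proof -
  obtain L a L1 \<Phi> where K: "K \<ge> 1" and L1: "fps_conv_radius L1 > 0" "Re (fps_nth L1 0) > 0"
    and L': "L = fps_const \<i> * fps_compose (fps_of_poly (map_poly complex_of_real a)) (fps_X ^ M) + fps_X ^ (2 * M * K) * L1"
    and \<Phi>: "fps_conv_radius \<Phi> > 0" "fps_nth \<Phi> 0 = 0" "fps_nth \<Phi> 1 = 1"
        "\<Phi> ^ (2 * M) = fps_const (\<i> / (- 2 * of_nat M)) * fps_X * fps_deriv \<phi>"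
        "fps_compose (fps_exp 1) L = fps_shift 1 (fps_inv \<Phi>)"
    and Lr: "fps_conv_radius L > 0" and L0: "fps_nth L 0 = 0"
    using iso unfolding isolated_type_def associated_series_def by blast
  \<comment> \<open>The estimates in s are stated with K lowered by one.\<close>
  obtain k where k: "K = Suc k" using K by (cases K) auto
  have XM0: "fps_nth (fps_X ^ M :: complex fps) 0 = 0" using M by (simp add: fps_X_power_nth)
  have L: "L = (\<Sum>n\<le>degree a. fps_const (\<i> * of_real (coeff a n)) * fps_X ^ (M * n)) + fps_X ^ (2 * M * K) * L1"
    unfolding L' fps_of_poly_compose[OF XM0]
    by (simp add: degree_map_poly coeff_map_poly sum_distrib_left power_mult mult.assoc flip: fps_const_mult)
  \<comment> \<open>The normalization L(0) = 0 forces A_0(0) = 0, as the L_1 term has positive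
    order.\<close>
  have a0: "coeff a 0 = 0"
  proof -
    have "fps_nth L 0 = (\<Sum>n\<le>degree a. \<i> * of_real (coeff a n) * (if n = 0 then 1 else 0))"
      unfolding L using M K by (auto simp: fps_sum_nth fps_X_power_nth intro!: sum.cong)
    also have "\<dots> = \<i> * of_real (coeff a 0)"
      by (subst sum.mono_neutral_right[of "{..degree a}" "{0}"]) auto
    finally show ?thesis using L0 by simp
  qed
  define L2 where "L2 = Abs_fps (\<lambda>n. fps_nth L1 n * of_real (real (2 * M * K + n) / real (2 * M * K + 2 * M + n)))"
  define \<psi> where "\<psi> = fps_X * fps_compose (fps_exp 1) L"
  have \<psi>0: "fps_nth \<psi> 0 = 0" by (simp add: \<psi>_def)
  note comp = associated_series_compose[OF L0 M \<Phi>(2-5), folded \<psi>_def]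
  note \<phi>\<psi> = isolated_type_compose[OF M \<psi>0 \<phi>(2) comp(2) L, folded L2_def]
  \<comment> \<open>The weights in \<open>L2\<close> are at most 1, so its radius is at least that
    of \<open>L1\<close>.\<close>
  have L2r: "fps_conv_radius L2 > 0"
  proof -
    have "norm (fps_nth L2 n) \<le> norm (fps_nth L1 n)" for n
    proof -
      have "real (2 * M * K + n) / real (2 * M * K + 2 * M + n) \<le> real (2 * M * K + 2 * M + n) / real (2 * M * K + 2 * M + n)"
        by (intro divide_right_mono) auto
      also have "\<dots> \<le> 1" by (simp only: divide_self_if) simp
      finally have "real (2 * M * K + n) / real (2 * M * K + 2 * M + n) \<le> 1" .
      thus ?thesis unfolding L2_def fps_nth_Abs_fps norm_mult norm_of_real
        by (intro mult_left_le) auto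
    qed
    hence le: "norm (fps_nth L2 n * z ^ n) \<le> norm (fps_nth L1 n * z ^ n)" for n z
      unfolding norm_mult by (intro mult_right_mono) auto
    have "fps_conv_radius L1 \<le> fps_conv_radius L2"
      unfolding fps_conv_radius_def[of L2]
    proof (rule conv_radius_geI_ex)
      fix r assume r: "0 < r" "ereal r < fps_conv_radius L1"
      hence "summable (\<lambda>n. norm (fps_nth L1 n * of_real r ^ n))" by (intro norm_summable_fps) simp
      hence "summable (\<lambda>n. fps_nth L2 n * of_real r ^ n)"
        by (rule summable_comparison_test') (rule le)
      thus "\<exists>z. norm z = r \<and> summable (\<lambda>n. fps_nth L2 n * z ^ n)"
        using r(1) by (intro exI[of _ "of_real r"]) simp
    qed
    thus ?thesis using L1(1) by (rule order.strict_trans2[rotated])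
  qed
  have L20: "fps_nth L2 0 = of_real (real (k + 1) / (real k + 2)) * fps_nth L1 0"
  proof -
    have "real (2 * M * K) / real (2 * M * K + 2 * M) = (2 * real M * (real k + 1)) / (2 * real M * (real k + 2))"
      by (simp add: k algebra_simps)
    also have "\<dots> = (real k + 1) / (real k + 2)" using M by (subst mult_divide_mult_cancel_left) auto
    finally have "real (2 * M * K) / real (2 * M * K + 2 * M) = real (k + 1) / (real k + 2)" by (simp add: add.commute)
    thus ?thesis unfolding L2_def fps_nth_Abs_fps add_0_right by (simp only: mult.commute)
  qed
  \<comment> \<open>\<open>g\<close>, \<open>W\<close> and \<open>\<Psi>\<close> are functions with
    the expansions \<open>L\<close>, \<open>fps_compose \<phi> \<psi>\<close> and
    \<open>\<psi>\<close>, written in the shape to which the defect estimates apply.\<close>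
  define g where "g = (\<lambda>s. \<i> * poly (map_poly of_real a) (s ^ M) + s ^ (M * (2 * k + 2)) * eval_fps L1 s)"
  define W where "W = (\<lambda>s. \<i> * (s ^ (2 * M) + 2 * of_nat M * s ^ (2 * M) *
          ((\<Sum>n\<le>degree a. \<i> * of_real (coeff a n * (real n / real (n + 2))) * s ^ (M * n))
          + s ^ (M * (2 * k + 2)) * eval_fps L2 s)))"
  define \<Psi> where "\<Psi> = (\<lambda>s. s * exp (g s))"
  have exponent: "2 * M * K = M * (2 * k + 2)" "M * (2 * k + 4) = M * (2 * (1 + K))" by (simp_all add: k algebra_simps)
  have g: "g has_fps_expansion L"
  proof -
    have "(\<lambda>s. (\<Sum>n\<le>degree a. (\<i> * of_real (coeff a n)) * s ^ (M * n)) + s ^ (M * (2 * k + 2)) * eval_fps L1 s) has_fps_expansion L"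
      unfolding L exponent(1) by (intro fps_expansion_intros eval_fps_has_fps_expansion L1)
    also have "(\<lambda>s. (\<Sum>n\<le>degree a. (\<i> * of_real (coeff a n)) * s ^ (M * n)) + s ^ (M * (2 * k + 2)) * eval_fps L1 s) = g"
      by (simp add: g_def poly_altdef degree_map_poly coeff_map_poly sum_distrib_left power_mult mult.assoc)
    finally show ?thesis .
  qed
  have W: "W has_fps_expansion fps_compose \<phi> \<psi>"
  proof -
    have "(2 * of_nat M :: complex fps) = fps_const (2 * of_nat M)"
      by (rule fps_ext) (simp add: fps_of_nat[symmetric] numeral_fps_const del: fps_const_mult)
    hence "fps_compose \<phi> \<psi> = fps_const \<i> * (fps_X ^ (2 * M) + fps_const (2 * of_nat M) * (fps_X ^ (2 * M) *
           ((\<Sum>n\<le>degree a. fps_const (\<i> * of_real (coeff a n * (real n / real (n + 2)))) * fps_X ^ (M * n))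
              + fps_X ^ (M * (2 * k + 2)) * L2)))"
      using \<phi>\<psi> unfolding exponent(1) by (simp only:)
    moreover have "W = (\<lambda>s. \<i> * (s ^ (2 * M) + (2 * of_nat M) * (s ^ (2 * M) *
          ((\<Sum>n\<le>degree a. (\<i> * of_real (coeff a n * (real n / real (n + 2)))) * s ^ (M * n))
          + s ^ (M * (2 * k + 2)) * eval_fps L2 s))))"
      by (simp only: W_def mult.assoc)
    ultimately show ?thesis
      by (simp only:) (intro fps_expansion_intros eval_fps_has_fps_expansion L2r)
  qed
  have \<Psi>: "\<Psi> has_fps_expansion \<psi>"
    unfolding \<Psi>_def \<psi>_def
    using has_fps_expansion_mult[OF has_fps_expansion_fps_X has_fps_expansion_compose[OF has_fps_expansion_exp1 g L0]]
    by (simp add: o_def)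
  have ev_\<phi>: "eventually (\<lambda>s. eval_fps \<phi> (\<Psi> s) = W s) (nhds 0)"
    using has_fps_expansion_eventually_eq[OF has_fps_expansion_compose[OF eval_fps_has_fps_expansion[OF \<phi>(1)] \<Psi> \<psi>0] W]
    by (simp add: o_def)
  have \<Phi>e: "eval_fps \<Phi> has_fps_expansion \<Phi>" by (rule eval_fps_has_fps_expansion[OF \<Phi>(1)])
  have ev_inv: "eventually (\<lambda>t. \<Psi> (eval_fps \<Phi> t) = t) (nhds 0)"
    using has_fps_expansion_eventually_eq[OF has_fps_expansion_compose[OF \<Psi> \<Phi>e \<Phi>(2), unfolded comp(1)] has_fps_expansion_fps_X]
    by (simp add: o_def)
  have lim\<Phi>: "filterlim (eval_fps \<Phi>) (nhds 0) (nhds 0)"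
    using has_fps_expansion_filterlim[OF \<Phi>e] \<Phi>(2) by simp
  \<comment> \<open>exp (g s) tends to 1, so |\<Psi> s| and |s| agree up to a factor 2 near
    0.\<close>
  have lim_exp: "((\<lambda>s. norm (exp (g s))) \<longlongrightarrow> norm (exp (0::complex))) (nhds 0)"
    using has_fps_expansion_filterlim[OF g] L0 by (intro tendsto_norm tendsto_exp) simp
  have "eventually (\<lambda>s. norm (exp (g s)) < 2) (nhds 0)"
    by (rule order_tendstoD(2)[OF lim_exp]) simp
  moreover have "eventually (\<lambda>s. norm (exp (g s)) > 1 / 2) (nhds 0)"
    by (rule order_tendstoD(1)[OF lim_exp]) simp
  ultimately have ev_norm: "eventually (\<lambda>s. norm s / 2 \<le> norm (\<Psi> s) \<and> norm (\<Psi> s) \<le> 2 * norm s) (nhds 0)"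
  proof eventually_elim
    case (elim s)
    have "norm s * (1 / 2) \<le> norm s * norm (exp (g s))" "norm s * norm (exp (g s)) \<le> norm s * 2"
      using elim by (intro mult_left_mono; simp)+
    thus ?case unfolding \<Psi>_def norm_mult by linarith
  qed
  obtain C1 where C1: "C1 \<ge> 0" "eventually (\<lambda>s. norm (eval_fps L1 s - fps_nth L1 0) \<le> C1 * norm s) (nhds 0)"
    using eval_fps_minus_nth_0_le[OF L1(1)] by blast
  obtain C2 where C2: "C2 \<ge> 0" "eventually (\<lambda>s. norm (eval_fps L2 s - fps_nth L2 0) \<le> C2 * norm s) (nhds 0)"
    using eval_fps_minus_nth_0_le[OF L2r] by blast
  have C12: "c * norm s \<le> max C1 C2 * norm s" if "c = C1 \<or> c = C2" for c and s :: complex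
    using that by (intro mult_right_mono) auto
  have C1': "eventually (\<lambda>s. norm (eval_fps L1 s - fps_nth L1 0) \<le> max C1 C2 * norm s) (nhds 0)"
    using C1(2) by (rule eventually_mono) (use C12 order_trans in blast)
  have C2': "eventually (\<lambda>s. norm (eval_fps L2 s - of_real (real (k + 1) / (real k + 2)) * fps_nth L1 0) \<le> max C1 C2 * norm s) (nhds 0)"
    unfolding L20[symmetric] using C2(2) by (rule eventually_mono) (use C12 order_trans in blast)
  obtain \<kappa> where \<kappa>: "\<kappa> > 0" "eventually (\<lambda>s. \<kappa> * norm s ^ (M * (2 * (1 + K))) \<le> norm (\<Psi> s) ^ (2 * M) - Im (W s)) (nhds 0)"
    using defect_lower_bound[OF a0 L1(2) M _ C1' C2', OF max.coboundedI1[OF C1(1)]]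
    unfolding \<Psi>_def g_def W_def exponent(2) by blast
  show "\<exists>\<kappa>>0. eventually (\<lambda>t. \<kappa> * norm t ^ (M * (2 * (1 + K))) \<le> norm t ^ (2 * M) - Im (eval_fps \<phi> t)) (nhds 0)"
  proof (intro exI conjI)
    \<comment> \<open>The power of 2 comes from |t| \<le> 2 |s| with s = \<Phi>(t).\<close>
    show "\<kappa> / 2 ^ (M * (2 * (1 + K))) > 0" using \<kappa> by simp
    have "eventually (\<lambda>s. \<kappa> * norm s ^ (M * (2 * (1 + K))) \<le> norm (\<Psi> s) ^ (2 * M) - Im (eval_fps \<phi> (\<Psi> s))
        \<and> norm (\<Psi> s) \<le> 2 * norm s) (nhds 0)"
      using \<kappa>(2) ev_\<phi> ev_norm by eventually_elim auto
    from eventually_compose_filterlim[OF this lim\<Phi>] ev_inv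
    show "eventually (\<lambda>t. \<kappa> / 2 ^ (M * (2 * (1 + K))) * norm t ^ (M * (2 * (1 + K))) \<le> norm t ^ (2 * M) - Im (eval_fps \<phi> t)) (nhds 0)"
    proof eventually_elim
      case (elim t)
      have "norm t ^ (M * (2 * (1 + K))) \<le> (2 * norm (eval_fps \<Phi> t)) ^ (M * (2 * (1 + K)))"
        using elim by (intro power_mono) auto
      hence "\<kappa> / 2 ^ (M * (2 * (1 + K))) * norm t ^ (M * (2 * (1 + K))) \<le>
          \<kappa> / 2 ^ (M * (2 * (1 + K))) * (2 * norm (eval_fps \<Phi> t)) ^ (M * (2 * (1 + K)))"
        using \<kappa>(1) by (intro mult_left_mono) auto
      also have "\<dots> = \<kappa> * norm (eval_fps \<Phi> t) ^ (M * (2 * (1 + K)))" by (simp add: power_mult_distrib)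
      finally show ?case using elim by simp
    qed
  qed
  have bounded: "\<exists>B. eventually (\<lambda>s. norm (eval_fps F s) \<le> B) (nhds 0)" if "fps_conv_radius F > 0" for F :: "complex fps"
  proof -
    have "((\<lambda>s. norm (eval_fps F s)) \<longlongrightarrow> norm (fps_nth F 0)) (nhds 0)"
      using has_fps_expansion_filterlim[OF eval_fps_has_fps_expansion[OF that]] by (rule tendsto_norm)
    hence "eventually (\<lambda>s. norm (eval_fps F s) < norm (fps_nth F 0) + 1) (nhds 0)" by (rule order_tendstoD) simp
    hence "eventually (\<lambda>s. norm (eval_fps F s) \<le> norm (fps_nth F 0) + 1) (nhds 0)"
      by (rule eventually_mono) simp
    thus ?thesis ..
  qed
  obtain B1 B2 where B: "eventually (\<lambda>s. norm (eval_fps L1 s) \<le> B1) (nhds 0)" "eventually (\<lambda>s. norm (eval_fps L2 s) \<le> B2) (nhds 0)"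
    using bounded[OF L1(1)] bounded[OF L2r] by blast
  have B': "eventually (\<lambda>s. norm (eval_fps L1 s) \<le> max B1 B2) (nhds 0)" "eventually (\<lambda>s. norm (eval_fps L2 s) \<le> max B1 B2) (nhds 0)"
    by (rule eventually_mono[OF B(1)], simp, rule eventually_mono[OF B(2)], simp)
  obtain C where C: "eventually (\<lambda>x. norm (\<Psi> (of_real x)) ^ (2 * M) - Im (W (of_real x)) \<le> C * x ^ (M * (2 * (1 + K)))) (at_right 0)"
    using defect_upper_bound[OF M B', of a k] unfolding \<Psi>_def g_def W_def exponent(2) by blast
  have lim: "filterlim (\<lambda>x. of_real x :: complex) (nhds 0) (at_right 0)"
    using tendsto_of_real[OF tendsto_ident_at, of 0 "{0<..}"] by simp
  have "eventually (\<lambda>x. x / 2 \<le> norm (\<Psi> (of_real x)) \<and> norm (\<Psi> (of_real x)) \<le> 2 * x \<and>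
           norm (\<Psi> (of_real x)) ^ (2 * M) - Im (eval_fps \<phi> (\<Psi> (of_real x))) \<le> C * x ^ (M * (2 * (1 + K)))) (at_right 0)"
    using C eventually_compose_filterlim[OF ev_\<phi> lim] eventually_compose_filterlim[OF ev_norm lim] eventually_at_right_less[of 0]
    by eventually_elim auto
  thus "\<exists>\<tau> C. eventually (\<lambda>x. x / 2 \<le> norm (\<tau> x) \<and> norm (\<tau> x) \<le> 2 * x \<and>
           norm (\<tau> x) ^ (2 * M) - Im (eval_fps \<phi> (\<tau> x)) \<le> C * x ^ (M * (2 * (1 + K)))) (at_right (0::real))"
    by (intro exI[of _ "\<lambda>x. \<Psi> (of_real x)"] exI[of _ C])
qed

section \<open>Values of powers, sums and generators\<close>

lemma eval_fps2_power:
  assumes "convergent2 f"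
  shows "eventually (\<lambda>(z, w). eval_fps2 (f ^ n) z w = eval_fps2 f z w ^ n) (nhds (0, 0))"
proof (induction n)
  case 0
  have "convergent2 (fps_const 1)" unfolding convergent2_const_iff by simp
  from eval_fps2_const[OF this] show ?case by simp
next
  case (Suc n)
  show ?case
    using eval_fps2_mult[OF assms convergent2_power[OF assms], of n] Suc by eventually_elim auto
qed

lemma convergent2_sum:
  assumes "\<And>j. j \<in> A \<Longrightarrow> convergent2 (g j)"
  shows "convergent2 (\<Sum>j\<in>A. g j)"
  using assms
proof (induction A rule: infinite_finite_induct)
  case (insert j A)
  thus ?case by (simp add: convergent2_add)
qed (use convergent2_const_iff[of 0] in simp_all)

lemma eval_fps2_sum:
  assumes "\<And>j. j \<in> A \<Longrightarrow> convergent2 (g j)"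
  shows "eventually (\<lambda>(z, w). eval_fps2 (\<Sum>j\<in>A. g j) z w = (\<Sum>j\<in>A. eval_fps2 (g j) z w)) (nhds (0, 0))"
  using assms
proof (induction A rule: infinite_finite_induct)
  case (insert j A)
  have "eventually (\<lambda>(z, w). eval_fps2 (g j + (\<Sum>j\<in>A. g j)) z w = eval_fps2 (g j) z w + eval_fps2 (\<Sum>j\<in>A. g j) z w) (nhds (0, 0))"
    using insert.prems by (intro eval_fps2_add convergent2_sum) auto
  moreover have "eventually (\<lambda>(z, w). eval_fps2 (\<Sum>j\<in>A. g j) z w = (\<Sum>j\<in>A. eval_fps2 (g j) z w)) (nhds (0, 0))"
    using insert by auto
  ultimately show ?case by eventually_elim (use insert.hyps in auto)
qed (simp_all add: eval_fps2_def case_prod_unfold)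

lemma eval_fps2_w_minus:
  "eventually (\<lambda>(z, w). eval_fps2 (w_fps2 - poly_in_z f) z w = w - poly f z) (nhds (0, 0))"
proof -
  have c: "convergent2 (fps_const (- fps_of_poly f))" by (simp add: convergent2_const_iff)
  have eq: "w_fps2 - poly_in_z f = w_fps2 + fps_const (- fps_of_poly f)"
    by (simp add: poly_in_z_def flip: fps_const_neg)
  have neg: "eval_fps (- fps_of_poly f) z = - poly f z" for z
    by (subst eval_fps_minus) simp_all
  show ?thesis
    unfolding eq using eval_fps2_add[OF convergent2_w c] eval_fps2_w eval_fps2_const[OF c]
    by eventually_elim (auto simp: neg)
qed

lemma convergent2_w_minus: "convergent2 (w_fps2 - poly_in_z f)"
  unfolding diff_conv_add_uminus by (intro convergent2_add convergent2_uminus convergent2_w convergent2_poly_in_z)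

lemma eval_fps2_z: "eventually (\<lambda>(z, w). eval_fps2 z_fps2 z w = z) (nhds (0, 0))"
  unfolding z_fps2_def by (rule eventually_mono[OF eval_fps2_const]) (use convergent2_z in \<open>auto simp: z_fps2_def\<close>)

section \<open>Coefficients controlled by growth\<close>

text \<open>Divided differences reduce the degree by one.\<close>

lemma bigo_coeffs_of_bigo_values:
  fixes b :: "nat \<Rightarrow> 'a \<Rightarrow> complex" and S :: "complex set"
  assumes "infinite S" and "\<And>\<mu>. \<mu> \<in> S \<Longrightarrow> (\<lambda>x. \<Sum>j<m. b j x * \<mu> ^ j) \<in> O[F](X)" and "j < m"
  shows "b j \<in> O[F](X)"
  using assms
proof (induction m arbitrary: b S j)
  case (Suc m)
  obtain \<mu>0 where \<mu>0: "\<mu>0 \<in> S" using Suc.prems(1) by fastforce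
  \<comment> \<open>The coefficients of (P(\<mu>) - P(\<mu>0)) / (\<mu> - \<mu>0), where P has the
    coefficients \<open>b j x\<close>. Removing \<mu>0 from S keeps the denominator nonzero.\<close>
  define c where "c = (\<lambda>i x. \<Sum>j=Suc i..m. b j x * \<mu>0 ^ (j - i - 1))"
  have c: "c i \<in> O[F](X)" if "i < m" for i
  proof (rule Suc.IH[OF _ _ that])
    show "infinite (S - {\<mu>0})" using Suc.prems(1) by simp
    fix \<mu> assume \<mu>: "\<mu> \<in> S - {\<mu>0}"
    have eq: "(\<Sum>j<Suc m. b j x * \<mu> ^ j) - (\<Sum>j<Suc m. b j x * \<mu>0 ^ j) = (\<mu> - \<mu>0) * (\<Sum>j<m. c j x * \<mu> ^ j)" for x
      unfolding c_def lessThan_Suc_atMost using that by (intro polyfun_diff) auto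
    have "(\<lambda>x. (\<mu> - \<mu>0) * (\<Sum>j<m. c j x * \<mu> ^ j)) \<in> O[F](X)"
      unfolding eq[symmetric] using \<mu> \<mu>0 by (intro sum_in_bigo Suc.prems(2)) auto
    thus "(\<lambda>x. \<Sum>j<m. c j x * \<mu> ^ j) \<in> O[F](X)" using \<mu> by simp
  qed
  have cm: "c m = (\<lambda>_. 0)" by (simp add: c_def)
  \<comment> \<open>Horner's scheme read backwards recovers b from c; the empty sum
    \<open>c m\<close> is its starting value.\<close>
  have rec: "b (Suc i) = (\<lambda>x. c i x - \<mu>0 * c (Suc i) x)" if "i < m" for i
  proof
    fix x
    have "c i x = b (Suc i) x * \<mu>0 ^ 0 + (\<Sum>j=Suc (Suc i)..m. b j x * \<mu>0 ^ (j - i - 1))"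
      unfolding c_def using that by (subst sum.atLeast_Suc_atMost) auto
    also have "(\<Sum>j=Suc (Suc i)..m. b j x * \<mu>0 ^ (j - i - 1)) = \<mu>0 * c (Suc i) x"
      unfolding c_def sum_distrib_left
    proof (intro sum.cong refl)
      fix j assume "j \<in> {Suc (Suc i)..m}"
      hence "j - i - 1 = Suc (j - Suc i - 1)" by auto
      thus "b j x * \<mu>0 ^ (j - i - 1) = \<mu>0 * (b j x * \<mu>0 ^ (j - Suc i - 1))" by simp
    qed
    finally show "b (Suc i) x = c i x - \<mu>0 * c (Suc i) x" by simp
  qed
  show ?case
  proof (cases j)
    case (Suc i)
    have "c (Suc i) \<in> O[F](X)" using c[of "Suc i"] cm Suc.prems(3) Suc by (cases "Suc i = m") auto
    thus ?thesis using c[of i] Suc.prems(3) Suc by (auto simp: rec intro!: sum_in_bigo)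
  next
    case 0
    have eq: "(\<Sum>j<Suc m. b j x * \<mu>0 ^ j) = b 0 x + \<mu>0 * c 0 x" for x
    proof -
      have "(\<Sum>j<Suc m. b j x * \<mu>0 ^ j) = b 0 x + (\<Sum>j<m. b (Suc j) x * \<mu>0 ^ Suc j)"
        by (subst sum.lessThan_Suc_shift) simp
      also have "(\<Sum>j<m. b (Suc j) x * \<mu>0 ^ Suc j) = \<mu>0 * c 0 x"
        unfolding c_def sum_distrib_left
        by (rule sum.reindex_bij_witness[of _ "\<lambda>j. j - 1" Suc]) auto
      finally show ?thesis .
    qed
    have "c 0 \<in> O[F](X)" using c[of 0] cm by (cases "m = 0") auto
    moreover have "b 0 = (\<lambda>x. (\<Sum>j<Suc m. b j x * \<mu>0 ^ j) - \<mu>0 * c 0 x)" unfolding eq by simp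
    moreover have "(\<lambda>x. \<Sum>j<Suc m. b j x * \<mu>0 ^ j) \<in> O[F](X)" by (rule Suc.prems(2)[OF \<mu>0])
    ultimately show ?thesis unfolding 0 by (simp only:) (intro sum_in_bigo; cases "\<mu>0 = 0"; simp)
  qed
qed simp

text \<open>A nonzero series is asymptotic to its lowest term. If that term had degree n < k,
  division by z^n would force its coefficient to be 0; a bound along a single family of nonzero
  points tending to 0 is enough for this.\<close>

lemma fps_nth_eq_0_of_bigo:
  fixes a :: "complex fps" and \<zeta> :: "'a \<Rightarrow> complex"
  assumes a: "fps_conv_radius a > 0" and F: "F \<noteq> bot" and \<zeta>: "filterlim \<zeta> (nhds 0) F" "eventually (\<lambda>x. \<zeta> x \<noteq> 0) F"
    and bound: "eventually (\<lambda>x. norm (eval_fps a (\<zeta> x)) \<le> B * norm (\<zeta> x) ^ k) F" and i: "i < k"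
  shows "fps_nth a i = 0"
proof (rule ccontr)
  assume ai: "fps_nth a i \<noteq> 0"
  define n where "n = subdegree a"
  define b where "b = fps_shift n a"
  have a0: "a \<noteq> 0" using ai by auto
  have n: "n < k" using ai i subdegree_leI unfolding n_def by fastforce
  have b0: "fps_nth b 0 \<noteq> 0" using a0 by (simp add: b_def n_def)
  have b: "fps_conv_radius b > 0" using a by (simp add: b_def)
  have lim: "((\<lambda>x. eval_fps b (\<zeta> x)) \<longlongrightarrow> fps_nth b 0) F"
  proof (rule filterlim_compose[OF _ \<zeta>(1)])
    have "isCont (eval_fps b) 0" using b by (intro continuous_eval_fps) (simp add: zero_ereal_def)
    thus "filterlim (eval_fps b) (nhds (fps_nth b 0)) (nhds 0)"
      unfolding continuous_at eval_fps_at_0 by (metis eval_fps_at_0 tendsto_at_iff_tendsto_nhds)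
  qed
  have "((\<lambda>x. eval_fps b (\<zeta> x)) \<longlongrightarrow> 0) F"
  proof (rule Lim_null_comparison)
    have a_eq: "a = fps_X ^ n * b" by (simp add: b_def n_def subdegree_decompose mult.commute flip: subdegree_decompose)
    have "(\<lambda>z. z ^ n * eval_fps b z) has_fps_expansion a"
      by (subst a_eq) (intro fps_expansion_intros eval_fps_has_fps_expansion b)
    hence "eventually (\<lambda>z. eval_fps a z = z ^ n * eval_fps b z) (nhds 0)"
      by (simp add: has_fps_expansion_def)
    from eventually_compose_filterlim[OF this \<zeta>(1)] bound \<zeta>(2)
    show "eventually (\<lambda>x. norm (eval_fps b (\<zeta> x)) \<le> B * norm (\<zeta> x) ^ (k - n)) F"
    proof eventually_elim
      case (elim x)
      have "norm (\<zeta> x) ^ n * norm (eval_fps b (\<zeta> x)) \<le> norm (\<zeta> x) ^ n * (B * norm (\<zeta> x) ^ (k - n))"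
        using elim n by (simp add: norm_mult norm_power mult.left_commute flip: power_add)
      thus ?case using elim(3) by (simp add: mult_le_cancel_left_pos)
    qed
    have "((\<lambda>x. B * norm (\<zeta> x) ^ (k - n)) \<longlongrightarrow> B * norm (0::complex) ^ (k - n)) F"
      by (intro tendsto_intros \<zeta>)
    thus "((\<lambda>x. B * norm (\<zeta> x) ^ (k - n)) \<longlongrightarrow> 0) F" using n by (simp add: power_0_left)
  qed
  with lim b0 show False using tendsto_unique[OF F] by blast
qed

section \<open>Comparison of p and its numerators with h\<close>

text \<open>Convergent series are bounded near the origin, so multiplication by one of them only
  changes the constant B.\<close>

lemma ideal_eval_bounded:
  "ideal {q. convergent2 q \<and> (\<exists>B. eventually (\<lambda>(z, w). (z, w) \<in> S \<longrightarrow> norm (eval_fps2 q z w) \<le> B * H z w) (nhds (0, 0)))} conv_ring"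
  (is "ideal ?I _")
proof -
  interpret cring conv_ring by (rule cring_conv_ring)
  have mult: "q * g \<in> ?I" if q: "q \<in> ?I" and g: "convergent2 g" for q g
  proof -
    from q obtain B where cq: "convergent2 q"
      and B: "eventually (\<lambda>(z, w). (z, w) \<in> S \<longrightarrow> norm (eval_fps2 q z w) \<le> B * H z w) (nhds (0, 0))" by blast
    obtain C where C: "eventually (\<lambda>(z, w). norm (eval_fps2 g z w) \<le> C) (nhds (0, 0))"
      using eval_fps2_bounded[OF g] by blast
    have "eventually (\<lambda>(z, w). (z, w) \<in> S \<longrightarrow> norm (eval_fps2 (q * g) z w) \<le> (B * C) * H z w) (nhds (0, 0))"
      using eval_fps2_mult[OF cq g] B C
    proof eventually_elim
      case (elim x)
      obtain z w where x: "x = (z, w)" by fastforce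
      have "norm (eval_fps2 (q * g) z w) \<le> (B * C) * H z w" if "(z, w) \<in> S"
      proof -
        have "norm (eval_fps2 q z w) \<le> B * H z w" "norm (eval_fps2 g z w) \<le> C"
          using elim that by (auto simp: x)
        hence "norm (eval_fps2 q z w) * norm (eval_fps2 g z w) \<le> (B * H z w) * C"
          by (intro mult_mono) (auto intro: order_trans[OF norm_ge_zero])
        moreover have "eval_fps2 (q * g) z w = eval_fps2 q z w * eval_fps2 g z w"
          using elim by (simp add: x)
        ultimately show ?thesis unfolding norm_mult by (simp only: norm_mult mult_ac)
      qed
      thus ?case by (simp add: x)
    qed
    thus ?thesis using convergent2_mult[OF cq g] by blast
  qed
  show ?thesis
  proof (rule idealI)
    show "ring conv_ring" by (rule ring_axioms)
    show "subgroup ?I (add_monoid conv_ring)"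
    proof (rule add.subgroupI)
      show "?I \<subseteq> carrier conv_ring" by auto
      have "convergent2 0" using convergent2_const_iff[of 0] by simp
      hence "0 \<in> ?I" by (auto simp: eval_fps2_def case_prod_unfold intro!: exI[of _ 0] always_eventually)
      thus "?I \<noteq> {}" by blast
    next
      fix a assume a: "a \<in> ?I"
      have m1: "convergent2 (- 1)" using convergent2_uminus convergent2_const_iff[of 1] by simp
      have "\<ominus>\<^bsub>conv_ring\<^esub> a = - a"
        using a by (intro minus_equality) (auto simp: convergent2_uminus)
      thus "\<ominus>\<^bsub>conv_ring\<^esub> a \<in> ?I" using mult[OF a m1] by simp
    next
      fix a b assume "a \<in> ?I" "b \<in> ?I"
      then obtain A B where c: "convergent2 a" "convergent2 b"
        and ev: "eventually (\<lambda>(z, w). (z, w) \<in> S \<longrightarrow> norm (eval_fps2 a z w) \<le> A * H z w) (nhds (0, 0))"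
          "eventually (\<lambda>(z, w). (z, w) \<in> S \<longrightarrow> norm (eval_fps2 b z w) \<le> B * H z w) (nhds (0, 0))" by blast
      have "eventually (\<lambda>(z, w). (z, w) \<in> S \<longrightarrow> norm (eval_fps2 (a + b) z w) \<le> (A + B) * H z w) (nhds (0, 0))"
        using eval_fps2_add[OF c] ev
        by eventually_elim (auto simp: distrib_right intro!: order_trans[OF norm_triangle_ineq] add_mono)
      thus "a \<oplus>\<^bsub>conv_ring\<^esub> b \<in> ?I" using convergent2_add[OF c] by auto
    qed
  next
    fix a x assume "a \<in> ?I" "x \<in> carrier conv_ring"
    thus "x \<otimes>\<^bsub>conv_ring\<^esub> a \<in> ?I" "a \<otimes>\<^bsub>conv_ring\<^esub> x \<in> ?I"
      using mult[of a x] by (simp_all add: mult.commute)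
  qed
qed

text \<open>For t^M = conj(c) z, membership in U_2 says Im w > |t|^(2M), so Im (w - phi(t)) is
  larger than the defect. The constants are the same for every root t, hence for all
  branches.\<close>

lemma weierstrass_factor_bounds:
  fixes \<phi> f0 :: "complex \<Rightarrow> complex"
  assumes M: "M \<ge> 1" and c: "norm c = 1" and \<kappa>: "\<kappa> > 0" and C: "C \<ge> 0"
    and lower: "eventually (\<lambda>t. \<kappa> * norm t ^ (M * N) \<le> norm t ^ (2 * M) - Im (\<phi> t)) (nhds 0)"
    and approx: "eventually (\<lambda>t. norm (\<phi> t - f0 (t ^ M)) \<le> C * norm t ^ (M * N)) (nhds 0)"
  shows "\<exists>c1 c2. 0 < c1 \<and> 0 < c2 \<and> eventually (\<lambda>(z, w). (z, w) \<in> U2 \<longrightarrow> (\<forall>t. t ^ M = cnj c * z \<longrightarrow>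
            c1 * (norm (w - f0 (cnj c * z)) + norm z ^ N) \<le> norm (w - \<phi> t) \<and>
            norm (w - \<phi> t) \<le> c2 * (norm (w - f0 (cnj c * z)) + norm z ^ N))) (nhds (0, 0))"
proof -
  have "eventually (\<lambda>t. \<kappa> * norm t ^ (M * N) \<le> norm t ^ (2 * M) - Im (\<phi> t) \<and>
      norm (\<phi> t - f0 (t ^ M)) \<le> C * norm t ^ (M * N)) (nhds 0)"
    using lower approx by eventually_elim auto
  then obtain \<delta> where \<delta>: "\<delta> > 0" "\<And>t. norm t < \<delta> \<Longrightarrow> \<kappa> * norm t ^ (M * N) \<le> norm t ^ (2 * M) - Im (\<phi> t)"
      "\<And>t. norm t < \<delta> \<Longrightarrow> norm (\<phi> t - f0 (t ^ M)) \<le> C * norm t ^ (M * N)"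
    unfolding eventually_nhds_metric by (auto simp: dist_norm)
  \<comment> \<open>Passing from phi(t) to f0 and adding |z|^N costs (C + 1) |z|^N, which is at most
    (C + 1) / \<kappa> times |w - phi(t)|.\<close>
  define D where "D = 1 + (C + 1) / \<kappa>"
  have D: "D > 0" using \<kappa> C by (simp add: D_def add_pos_nonneg)
  show ?thesis
  proof (intro exI conjI)
    show "0 < 1 / D" "0 < 1 + C" using D C by auto
    show "eventually (\<lambda>(z, w). (z, w) \<in> U2 \<longrightarrow> (\<forall>t. t ^ M = cnj c * z \<longrightarrow>
            1 / D * (norm (w - f0 (cnj c * z)) + norm z ^ N) \<le> norm (w - \<phi> t) \<and>
            norm (w - \<phi> t) \<le> (1 + C) * (norm (w - f0 (cnj c * z)) + norm z ^ N))) (nhds (0, 0))"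
    \<comment> \<open>As |t|^M = |z|, the radius \<delta>^M for z confines every root t to the disc
      of radius \<delta>.\<close>
    proof (rule eventually_nhds_pair_zeroI[of "\<delta> ^ M", rotated], intro impI allI conjI)
      fix z w t assume z: "norm z < \<delta> ^ M" and w: "(z, w) \<in> U2" and t: "t ^ M = cnj c * z"
      have tM: "norm t ^ M = norm z"
        using arg_cong[OF t, of norm] c by (simp add: norm_mult norm_power)
      have t\<delta>: "norm t < \<delta>" using z \<delta>(1) power_less_imp_less_base[of "norm t" M \<delta>] by (simp add: tM)
      have pow: "norm t ^ (M * N) = norm z ^ N" "norm t ^ (2 * M) = (norm z)\<^sup>2"
        by (simp_all add: power_mult tM mult.commute[of 2])
      have "\<kappa> * norm z ^ N \<le> (norm z)\<^sup>2 - Im (\<phi> t)" using \<delta>(2)[OF t\<delta>] unfolding pow .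
      also have "\<dots> \<le> Im (w - \<phi> t)" using w by (simp add: U2_def)
      also have "\<dots> \<le> norm (w - \<phi> t)" using abs_Im_le_cmod[of "w - \<phi> t"] by simp
      finally have zN: "norm z ^ N \<le> norm (w - \<phi> t) / \<kappa>" using \<kappa> by (simp add: field_simps)
      have ap: "norm (\<phi> t - f0 (cnj c * z)) \<le> C * norm z ^ N" using \<delta>(3)[OF t\<delta>] unfolding pow t .
      have "norm (w - f0 (cnj c * z)) \<le> norm (w - \<phi> t) + norm (\<phi> t - f0 (cnj c * z))"
        using norm_triangle_ineq[of "w - \<phi> t" "\<phi> t - f0 (cnj c * z)"] by simp
      hence "norm (w - f0 (cnj c * z)) + norm z ^ N \<le> norm (w - \<phi> t) + (C + 1) * norm z ^ N"
        using ap by (simp add: algebra_simps)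
      also have "\<dots> \<le> norm (w - \<phi> t) + (C + 1) * (norm (w - \<phi> t) / \<kappa>)"
        using zN C by (intro add_left_mono mult_left_mono) auto
      also have "\<dots> = D * norm (w - \<phi> t)" by (simp add: D_def algebra_simps)
      finally show "1 / D * (norm (w - f0 (cnj c * z)) + norm z ^ N) \<le> norm (w - \<phi> t)"
        using D by (simp add: field_simps)
      have "norm (w - \<phi> t) \<le> norm (w - f0 (cnj c * z)) + norm (\<phi> t - f0 (cnj c * z))"
        using norm_triangle_ineq[of "w - f0 (cnj c * z)" "f0 (cnj c * z) - \<phi> t"] by (simp add: norm_minus_commute)
      also have "\<dots> \<le> norm (w - f0 (cnj c * z)) + C * norm z ^ N" using ap by simp
      also have "\<dots> \<le> (1 + C) * (norm (w - f0 (cnj c * z)) + norm z ^ N)"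
        using C by (simp add: algebra_simps)
      finally show "norm (w - \<phi> t) \<le> (1 + C) * (norm (w - f0 (cnj c * z)) + norm z ^ N)" .
    qed (use \<delta> in simp)
  qed
qed

text \<open>p is a product of M factors comparable to h and a unit u, whose modulus stays between
  half and twice |u(0,0)| by continuity.\<close>

lemma single_weierstrass_factor_bounds:
  assumes M: "M \<ge> 1" and swf: "single_weierstrass_factor p M c \<phi>"
    and c12: "0 < c1" "0 < c2"
    and h: "\<And>z w. h z w \<ge> 0"
    and factor: "eventually (\<lambda>(z, w). (z, w) \<in> U2 \<longrightarrow> (\<forall>t. t ^ M = cnj c * z \<longrightarrow>
            c1 * h z w \<le> norm (w - eval_fps \<phi> t) \<and> norm (w - eval_fps \<phi> t) \<le> c2 * h z w)) (nhds (0, 0))"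
  shows "\<exists>C1 C2. 0 < C1 \<and> eventually (\<lambda>(z, w). (z, w) \<in> U2 \<longrightarrow>
            C1 * h z w ^ M \<le> norm (eval_poly2 p z w) \<and> norm (eval_poly2 p z w) \<le> C2 * h z w ^ M) (nhds (0, 0))"
proof -
  obtain u \<epsilon> where u': "u \<in> carrier conv_ring" "eval_fps2 u 0 0 \<noteq> 0" and \<epsilon>: "\<epsilon> > 0"
    and p': "\<forall>z w t. (z, w) \<in> ball (0, 0) \<epsilon> \<longrightarrow> t ^ M = cnj c * z \<longrightarrow>
             eval_poly2 p z w = eval_fps2 u z w *
               (\<Prod>j=1..M. w - eval_fps \<phi> (exp (2 * of_real pi * \<i> / of_nat M) ^ j * t))"
    using swf unfolding single_weierstrass_factor_def by (elim bexE conjE exE) (rule that)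
  have u: "convergent2 u" "eval_fps2 u 0 0 \<noteq> 0" using u' by simp_all
  note p = p'[rule_format]
  define m where "m = norm (eval_fps2 u 0 0)"
  have m: "m > 0" using u(2) by (simp add: m_def)
  have lim: "((\<lambda>x. norm (case x of (z, w) \<Rightarrow> eval_fps2 u z w)) \<longlongrightarrow> m) (nhds (0, 0))"
    unfolding m_def by (rule tendsto_norm[OF eval_fps2_tendsto[OF u(1)]])
  have ev_u: "eventually (\<lambda>x. norm (case x of (z, w) \<Rightarrow> eval_fps2 u z w) > m / 2) (nhds (0, 0))"
    by (rule order_tendstoD(1)[OF lim]) (use m in simp)
  have ev_u': "eventually (\<lambda>x. norm (case x of (z, w) \<Rightarrow> eval_fps2 u z w) < 2 * m) (nhds (0, 0))"
    by (rule order_tendstoD(2)[OF lim]) (use m in simp)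
  have ball: "eventually (\<lambda>x. x \<in> ball (0 :: complex, 0 :: complex) \<epsilon>) (nhds (0, 0))"
    using \<epsilon> by (intro eventually_nhds_in_open) auto
  let ?\<nu> = "exp (2 * of_real pi * \<i> / of_nat M) :: complex"
  have \<nu>: "?\<nu> ^ M = 1" using M by (subst exp_of_nat_mult[symmetric]) simp
  have "eventually (\<lambda>(z, w). (z, w) \<in> U2 \<longrightarrow>
      (m / 2 * c1 ^ M) * h z w ^ M \<le> norm (eval_poly2 p z w) \<and> norm (eval_poly2 p z w) \<le> (2 * m * c2 ^ M) * h z w ^ M) (nhds (0, 0))"
    using ev_u ev_u' ball factor
  proof eventually_elim
    case (elim x)
    obtain z w where x: "x = (z, w)" by fastforce
    have "(m / 2 * c1 ^ M) * h z w ^ M \<le> norm (eval_poly2 p z w) \<and> norm (eval_poly2 p z w) \<le> (2 * m * c2 ^ M) * h z w ^ M"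
      if U2: "(z, w) \<in> U2"
    proof -
      have "M \<noteq> 0" using M by simp
      then obtain t where t': "cnj c * z = t ^ M" by (rule exists_complex_root)
      note t = t'[symmetric]
      \<comment> \<open>The factors are indexed by multiples of one root t by powers of \<nu>; these
        are roots of conj(c) z again, so the factor bounds apply to each of them.\<close>
      have root: "(?\<nu> ^ j * t) ^ M = cnj c * z" for j
      proof -
        have "(?\<nu> ^ j * t) ^ M = (?\<nu> ^ M) ^ j * t ^ M"
          by (simp add: power_mult_distrib mult.commute flip: power_mult)
        thus ?thesis by (simp only: \<nu> t power_one mult_1_left)
      qed
      have b: "c1 * h z w \<le> norm (w - eval_fps \<phi> (?\<nu> ^ j * t))" "norm (w - eval_fps \<phi> (?\<nu> ^ j * t)) \<le> c2 * h z w" for j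
        using elim(4) U2 root[of j] unfolding x by blast+
      have p_eq: "norm (eval_poly2 p z w) = norm (eval_fps2 u z w) * (\<Prod>j=1..M. norm (w - eval_fps \<phi> (?\<nu> ^ j * t)))"
        using elim(3) unfolding x by (subst p[OF _ t]) (simp_all add: norm_mult prod_norm)
      have "(\<Prod>j=1..M. c1 * h z w) \<le> (\<Prod>j=1..M. norm (w - eval_fps \<phi> (?\<nu> ^ j * t)))"
        using b(1) c12 h by (intro prod_mono) auto
      hence 1: "(c1 * h z w) ^ M \<le> (\<Prod>j=1..M. norm (w - eval_fps \<phi> (?\<nu> ^ j * t)))" by simp
      have "(\<Prod>j=1..M. norm (w - eval_fps \<phi> (?\<nu> ^ j * t))) \<le> (\<Prod>j=1..M. c2 * h z w)"
        using b(2) by (intro prod_mono) auto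
      hence 2: "(\<Prod>j=1..M. norm (w - eval_fps \<phi> (?\<nu> ^ j * t))) \<le> (c2 * h z w) ^ M" by simp
      have "m / 2 * (c1 * h z w) ^ M \<le> norm (eval_poly2 p z w)"
        unfolding p_eq using elim(1) m c12 h 1 by (intro mult_mono) (auto simp: x)
      moreover have "norm (eval_poly2 p z w) \<le> 2 * m * (c2 * h z w) ^ M"
        unfolding p_eq using elim(2) m 2 by (intro mult_mono) (auto simp: x intro!: prod_nonneg)
      ultimately show ?thesis by (simp add: power_mult_distrib mult.assoc)
    qed
    thus ?case by (simp add: x)
  qed
  moreover have "m / 2 * c1 ^ M > 0" using m c12 by simp
  ultimately show ?thesis by blast
qed

text \<open>At a zero of p the quotient would take the default value 0, and its boundedness would
  say nothing about q; the lower bound for |p| together with h > 0 excludes zeros on U_2 near the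
  origin.\<close>

lemma admissible_numerators_eq:
  assumes C1: "0 < C1" and h: "\<And>z w. (z, w) \<in> U2 \<Longrightarrow> h z w > 0"
    and p: "eventually (\<lambda>(z, w). (z, w) \<in> U2 \<longrightarrow>
            C1 * h z w ^ M \<le> norm (eval_poly2 p z w) \<and> norm (eval_poly2 p z w) \<le> C2 * h z w ^ M) (nhds (0, 0))"
  shows "admissible_numerators p = {q. convergent2 q \<and> (\<exists>B. eventually (\<lambda>(z, w). (z, w) \<in> U2 \<longrightarrow>
            norm (eval_fps2 q z w) \<le> B * h z w ^ M) (nhds (0, 0)))}"
proof (intro Set.set_eqI iffI)
  fix q assume "q \<in> admissible_numerators p"
  then obtain \<epsilon> where q: "convergent2 q" and \<epsilon>: "\<epsilon> > 0"
    and "bounded ((\<lambda>(z, w). eval_fps2 q z w / eval_poly2 p z w) ` (U2 \<inter> ball (0, 0) \<epsilon>))"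
    by (auto simp: admissible_numerators_def)
  then obtain B where B: "\<And>z w. (z, w) \<in> U2 \<Longrightarrow> (z, w) \<in> ball (0, 0) \<epsilon> \<Longrightarrow> norm (eval_fps2 q z w / eval_poly2 p z w) \<le> B"
    unfolding bounded_iff by fastforce
  have ball: "eventually (\<lambda>x. x \<in> ball (0 :: complex, 0 :: complex) \<epsilon>) (nhds (0, 0))"
    using \<epsilon> by (intro eventually_nhds_in_open) auto
  have "eventually (\<lambda>(z, w). (z, w) \<in> U2 \<longrightarrow> norm (eval_fps2 q z w) \<le> (\<bar>B\<bar> * C2) * h z w ^ M) (nhds (0, 0))"
    using p ball
  proof eventually_elim
    case (elim x)
    obtain z w where x: "x = (z, w)" by fastforce
    have "norm (eval_fps2 q z w) \<le> (\<bar>B\<bar> * C2) * h z w ^ M" if U2: "(z, w) \<in> U2"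
    proof -
      have pz: "C1 * h z w ^ M \<le> norm (eval_poly2 p z w)" "norm (eval_poly2 p z w) \<le> C2 * h z w ^ M"
        using elim U2 by (auto simp: x)
      have "C1 * h z w ^ M > 0" using C1 h[OF U2] by simp
      hence p0: "norm (eval_poly2 p z w) > 0" using pz by linarith
      have "norm (eval_fps2 q z w) / norm (eval_poly2 p z w) \<le> \<bar>B\<bar>"
        using B[OF U2] elim(2) by (simp add: x norm_divide)
      hence "norm (eval_fps2 q z w) \<le> \<bar>B\<bar> * norm (eval_poly2 p z w)" using p0 by (simp add: field_simps)
      also have "\<dots> \<le> \<bar>B\<bar> * (C2 * h z w ^ M)" using pz by (intro mult_left_mono) auto
      finally show ?thesis by (simp add: mult.assoc)
    qed
    thus ?case by (simp add: x)
  qed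
  thus "q \<in> {q. convergent2 q \<and> (\<exists>B. eventually (\<lambda>(z, w). (z, w) \<in> U2 \<longrightarrow>
            norm (eval_fps2 q z w) \<le> B * h z w ^ M) (nhds (0, 0)))}" using q by blast
next
  fix q assume "q \<in> {q. convergent2 q \<and> (\<exists>B. eventually (\<lambda>(z, w). (z, w) \<in> U2 \<longrightarrow>
            norm (eval_fps2 q z w) \<le> B * h z w ^ M) (nhds (0, 0)))}"
  then obtain B where q: "convergent2 q"
    and B: "eventually (\<lambda>(z, w). (z, w) \<in> U2 \<longrightarrow> norm (eval_fps2 q z w) \<le> B * h z w ^ M) (nhds (0, 0))" by blast
  have "eventually (\<lambda>x. x \<in> U2 \<longrightarrow> norm (case x of (z, w) \<Rightarrow> eval_fps2 q z w / eval_poly2 p z w) \<le> \<bar>B\<bar> / C1) (nhds (0, 0))"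
    using p B
  proof eventually_elim
    case (elim x)
    obtain z w where x: "x = (z, w)" by fastforce
    have "norm (eval_fps2 q z w / eval_poly2 p z w) \<le> \<bar>B\<bar> / C1" if U2: "(z, w) \<in> U2"
    proof -
      have pz: "C1 * h z w ^ M \<le> norm (eval_poly2 p z w)" and qz: "norm (eval_fps2 q z w) \<le> B * h z w ^ M"
        using elim U2 by (auto simp: x)
      have hM: "h z w ^ M > 0" using h[OF U2] by simp
      have "norm (eval_fps2 q z w) \<le> \<bar>B\<bar> * h z w ^ M"
        using qz mult_right_mono[of B "\<bar>B\<bar>" "h z w ^ M"] hM by linarith
      hence "norm (eval_fps2 q z w) / norm (eval_poly2 p z w) \<le> (\<bar>B\<bar> * h z w ^ M) / (C1 * h z w ^ M)"
        using pz hM C1 by (intro frac_le) auto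
      also have "\<dots> = \<bar>B\<bar> / C1" using hM by (intro mult_divide_mult_cancel_right) linarith
      finally show ?thesis by (simp add: norm_divide)
    qed
    thus ?case by (simp add: x)
  qed
  then obtain \<epsilon> where \<epsilon>: "\<epsilon> > 0" "\<And>x. dist x (0, 0) < \<epsilon> \<Longrightarrow> x \<in> U2 \<Longrightarrow> norm (case x of (z, w) \<Rightarrow> eval_fps2 q z w / eval_poly2 p z w) \<le> \<bar>B\<bar> / C1"
    unfolding eventually_nhds_metric by blast
  have "bounded ((\<lambda>(z, w). eval_fps2 q z w / eval_poly2 p z w) ` (U2 \<inter> ball (0, 0) \<epsilon>))"
    unfolding bounded_iff using \<epsilon>(2) by (intro exI[of _ "\<bar>B\<bar> / C1"]) (auto simp: dist_commute)
  thus "q \<in> admissible_numerators p" using q \<epsilon>(1) by (auto simp: admissible_numerators_def)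
qed

section \<open>Normalization at the origin; Taylor coefficients along curves in U_2\<close>

lemma fps_nth_0_eq_0_of_smallo:
  assumes "fps_conv_radius \<phi> > 0" "M \<ge> 1"
    and o: "(\<lambda>t. eval_fps \<phi> t - \<i> * t ^ (2 * M)) \<in> o[at 0](\<lambda>t. t ^ (2 * M))"
  shows "fps_nth \<phi> 0 = 0"
proof -
  have zero: "((\<lambda>t::complex. t ^ (2 * M)) \<longlongrightarrow> 0) (at 0)"
    using tendsto_power[OF tendsto_ident_at, where n = "2 * M" and a = "0::complex"] assms(2) by (simp add: power_0_left)
  have "eventually (\<lambda>t. norm (eval_fps \<phi> t - \<i> * t ^ (2 * M)) \<le> 1 * norm (t ^ (2 * M))) (at 0)"
    by (rule landau_o.smallD[OF o]) simp
  hence "((\<lambda>t. eval_fps \<phi> t - \<i> * t ^ (2 * M)) \<longlongrightarrow> 0) (at 0)"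
    by (rule Lim_null_comparison) (use tendsto_norm[OF zero] in simp)
  from tendsto_add[OF this tendsto_mult[OF tendsto_const zero, of \<i>]]
  have "(eval_fps \<phi> \<longlongrightarrow> 0) (at 0)" by simp
  moreover have "(eval_fps \<phi> \<longlongrightarrow> fps_nth \<phi> 0) (at 0)"
    by (rule tendsto_mono[OF _ has_fps_expansion_filterlim[OF eval_fps_has_fps_expansion[OF assms(1)]]])
       (simp add: at_within_def)
  ultimately show ?thesis by (intro LIM_unique)
qed

text \<open>The O-estimate concerns t \<noteq> 0 only. Letting t tend to 0 forces the constant term
  of \<phi>0 to vanish, and then the estimate also holds at t = 0.\<close>

lemma is_phi0_nhds:
  assumes "fps_conv_radius \<phi> > 0" "M \<ge> 1" "fps_nth \<phi> 0 = 0" "is_phi0 M \<phi> K \<phi>0"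
  shows "poly \<phi>0 0 = 0"
    and "\<exists>C\<ge>0. eventually (\<lambda>t. norm (eval_fps \<phi> t - poly \<phi>0 (t ^ M)) \<le> C * norm t ^ (M * (2 * (1 + K)))) (nhds 0)"
proof -
  have "2 * M * (1 + K) = M * (2 * (1 + K))" by simp
  hence big: "(\<lambda>t. eval_fps \<phi> t - poly \<phi>0 (t ^ M)) \<in> O[at 0](\<lambda>t. t ^ (M * (2 * (1 + K))))"
    using assms(4) unfolding is_phi0_def by metis
  have at_le: "at (0::complex) \<le> nhds 0" by (simp add: at_within_def)
  obtain C where C: "C > 0" "eventually (\<lambda>t. norm (eval_fps \<phi> t - poly \<phi>0 (t ^ M)) \<le> C * norm (t ^ (M * (2 * (1 + K))))) (at 0)"
    by (rule landau_o.bigE[OF big])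
  have \<phi>: "(eval_fps \<phi> \<longlongrightarrow> 0) (nhds 0)"
    using has_fps_expansion_filterlim[OF eval_fps_has_fps_expansion[OF assms(1)]] assms(3) by simp
  have pow: "((\<lambda>t::complex. t ^ n) \<longlongrightarrow> 0) (nhds 0)" if "n \<ge> 1" for n
    using tendsto_power[OF filterlim_ident, where n = n and a = "0::complex"] that by (simp add: power_0_left)
  have "((\<lambda>t. poly \<phi>0 (t ^ M)) \<longlongrightarrow> poly \<phi>0 0) (nhds 0)"
    by (rule tendsto_poly[OF pow[OF assms(2)]])
  note l1 = tendsto_mono[OF at_le tendsto_diff[OF \<phi> this]]
  have "M * (2 * (1 + K)) \<ge> 1" using assms(2) by simp
  from tendsto_mono[OF at_le tendsto_mult[OF tendsto_const tendsto_norm[OF pow[OF this]], of C]]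
  have "((\<lambda>t::complex. C * norm (t ^ (M * (2 * (1 + K))))) \<longlongrightarrow> 0) (at 0)"
    by simp
  with C(2) have "((\<lambda>t. eval_fps \<phi> t - poly \<phi>0 (t ^ M)) \<longlongrightarrow> 0) (at 0)"
    by (rule Lim_null_comparison)
  with l1 have "0 - poly \<phi>0 0 = 0" by (intro LIM_unique)
  thus 0: "poly \<phi>0 0 = 0" by simp
  have "norm (eval_fps \<phi> 0 - poly \<phi>0 (0 ^ M)) \<le> C * norm (0::complex) ^ (M * (2 * (1 + K)))"
    using assms(2,3) 0 by (simp add: eval_fps_at_0 power_0_left)
  with C show "\<exists>C\<ge>0. eventually (\<lambda>t. norm (eval_fps \<phi> t - poly \<phi>0 (t ^ M)) \<le> C * norm t ^ (M * (2 * (1 + K)))) (nhds 0)"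
    unfolding eventually_nhds_conv_at by (intro exI[of _ C]) (simp add: norm_power)
qed

text \<open>Along the curves \<open>z = c \<tau>\<^sup>M\<close>, \<open>w = f(z) + i \<lambda> x\<^bsup>M N\<^esup>\<close>, which lie in \<open>U\<^sub>2\<close> for all large \<open>\<lambda>\<close>, the
  bound on \<open>q\<close> becomes a bound on a polynomial in \<open>\<lambda>\<close>, hence on each of its coefficients.\<close>

lemma taylor_coeffs_vanish:
  fixes a :: "nat \<Rightarrow> complex fps" and f :: "complex poly" and \<tau> :: "real \<Rightarrow> complex"
  assumes M: "M \<ge> 1" and N: "N \<ge> 1" and c: "norm c = 1" and f0: "poly f 0 = 0"
    and q: "eventually (\<lambda>(z, w). (z, w) \<in> U2 \<longrightarrow> norm (eval_fps2 q z w) \<le> B * (norm (w - poly f z) + norm z ^ N) ^ M) (nhds (0, 0))"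
    and a: "\<And>j. convergent2 (fps_const (a j))" and Q: "convergent2 Q"
    and q_eq: "q = (\<Sum>j<M. fps_const (a j) * (w_fps2 - poly_in_z f) ^ j) + (w_fps2 - poly_in_z f) ^ M * Q"
    and \<tau>: "eventually (\<lambda>x. x / 2 \<le> norm (\<tau> x) \<and> norm (\<tau> x) \<le> 2 * x \<and>
           norm (\<tau> x) ^ (2 * M) - Im (poly f (c * \<tau> x ^ M)) \<le> D * x ^ (M * N)) (at_right 0)"
    and j: "j < M" and i: "i < N * (M - j)"
  shows "fps_nth (a j) i = 0"
proof -
  define d where "d = w_fps2 - poly_in_z f"
  have cd: "convergent2 d" unfolding d_def by (rule convergent2_w_minus)
  define \<zeta> where "\<zeta> = (\<lambda>x. c * \<tau> x ^ M)"
  have norm_\<zeta>: "norm (\<zeta> x) = norm (\<tau> x) ^ M" for x by (simp add: \<zeta>_def norm_mult norm_power c)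
  have pos: "eventually (\<lambda>x. x > 0) (at_right (0::real))" by (rule eventually_at_right_less)
  have x0: "((\<lambda>x::real. x) \<longlongrightarrow> 0) (at_right 0)" by (rule tendsto_ident_at)
  have lim\<tau>: "(\<tau> \<longlongrightarrow> 0) (at_right 0)"
  proof (rule Lim_null_comparison)
    show "eventually (\<lambda>x. norm (\<tau> x) \<le> 2 * x) (at_right 0)" using \<tau> by eventually_elim auto
    show "((\<lambda>x::real. 2 * x) \<longlongrightarrow> 0) (at_right 0)" using tendsto_mult[OF tendsto_const x0, of 2] by simp
  qed
  have lim\<zeta>: "(\<zeta> \<longlongrightarrow> 0) (at_right 0)"
    using tendsto_mult[OF tendsto_const tendsto_power[OF lim\<tau>, of M], of c] M by (simp add: \<zeta>_def power_0_left)
  have limf: "((\<lambda>x. poly f (\<zeta> x)) \<longlongrightarrow> 0) (at_right 0)"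
    using tendsto_poly[OF lim\<zeta>, of f] f0 by simp
  have MN: "M * N \<ge> 1" using M N by simp
  have xMN: "((\<lambda>x::real. complex_of_real (x ^ (M * N))) \<longlongrightarrow> 0) (at_right 0)"
    using tendsto_of_real[OF tendsto_power[OF x0, of "M * N"], where 'a = complex] MN by (simp add: power_0_left)
  obtain BQ where BQ: "eventually (\<lambda>(z, w). norm (eval_fps2 Q z w) \<le> BQ) (nhds (0, 0))"
    using eval_fps2_bounded[OF Q] by blast
  have summand: "eventually (\<lambda>(z, w). eval_fps2 (fps_const (a j) * d ^ j) z w = eval_fps (a j) z * (w - poly f z) ^ j) (nhds (0, 0))" for j
    using eval_fps2_mult[OF a convergent2_power[OF cd], of j j] eval_fps2_const[OF a, of j] eval_fps2_power[OF cd, of j]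
      eval_fps2_w_minus[of f, folded d_def]
    by eventually_elim (simp add: case_prod_unfold)
  have "eventually (\<lambda>x. \<forall>j\<in>{..<M}. case x of (z, w) \<Rightarrow> eval_fps2 (fps_const (a j) * d ^ j) z w = eval_fps (a j) z * (w - poly f z) ^ j) (nhds (0, 0))"
    by (intro eventually_ball_finite ballI summand) auto
  moreover have "eventually (\<lambda>(z, w). eval_fps2 (\<Sum>j<M. fps_const (a j) * d ^ j) z w = (\<Sum>j<M. eval_fps2 (fps_const (a j) * d ^ j) z w)) (nhds (0, 0))"
    by (intro eval_fps2_sum convergent2_mult a convergent2_power cd)
  moreover have "eventually (\<lambda>(z, w). eval_fps2 q z w = eval_fps2 (\<Sum>j<M. fps_const (a j) * d ^ j) z w + eval_fps2 (d ^ M * Q) z w) (nhds (0, 0))"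
    unfolding q_eq d_def[symmetric]
    by (intro eval_fps2_add convergent2_sum convergent2_mult a convergent2_power cd Q)
  moreover note eval_fps2_mult[OF convergent2_power[OF cd] Q, of M] eval_fps2_power[OF cd, of M] eval_fps2_w_minus[of f, folded d_def]
  ultimately have eval_q: "eventually (\<lambda>(z, w). eval_fps2 q z w = (\<Sum>j<M. eval_fps (a j) z * (w - poly f z) ^ j) + (w - poly f z) ^ M * eval_fps2 Q z w) (nhds (0, 0))"
  proof eventually_elim
    case (elim x)
    obtain z w where x: "x = (z, w)" by fastforce
    have "(\<Sum>j<M. eval_fps2 (fps_const (a j) * d ^ j) z w) = (\<Sum>j<M. eval_fps (a j) z * (w - poly f z) ^ j)"
      using elim(1) by (intro sum.cong) (auto simp: x)
    thus ?case using elim(2-6) by (simp add: x)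
  qed
  define l\<^sub>0 where "l\<^sub>0 = max D 0"
  \<comment> \<open>The values \<mu> = i l with l > \<open>l\<^sub>0\<close>: l > D moves w above
    the boundary of U_2, and l > 0 gives |\<mu>| = l.\<close>
  define S where "S = (\<lambda>l. \<i> * complex_of_real l) ` {l\<^sub>0<..}"
  have inj: "inj_on (\<lambda>l. \<i> * complex_of_real l) {l\<^sub>0<..}" by (rule inj_onI) simp
  have "infinite S"
    unfolding S_def finite_image_iff[OF inj] by (rule infinite_Ioi)
  moreover have "(\<lambda>x. \<Sum>j<M. (eval_fps (a j) (\<zeta> x) * of_real (x ^ (M * N * j))) * \<mu> ^ j) \<in> O[at_right 0](\<lambda>x. of_real (x ^ (M * N * M)))"
    if "\<mu> \<in> S" for \<mu>
  proof -
    from that[unfolded S_def] obtain l where \<mu>: "\<mu> = \<i> * of_real l" and l': "l \<in> {l\<^sub>0<..}"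
      by (rule imageE)
    hence l: "l > l\<^sub>0" by simp
    have l0: "l > 0" "l > D" using l by (auto simp: l\<^sub>0_def)
    define \<omega> where "\<omega> = (\<lambda>x. poly f (\<zeta> x) + \<mu> * of_real (x ^ (M * N)))"
    have lim\<omega>: "(\<omega> \<longlongrightarrow> 0) (at_right 0)"
      unfolding \<omega>_def using tendsto_add[OF limf tendsto_mult[OF tendsto_const xMN, of \<mu>]] by simp
    have lim: "filterlim (\<lambda>x. (\<zeta> x, \<omega> x)) (nhds (0, 0)) (at_right 0)"
      by (rule tendsto_Pair[OF lim\<zeta> lim\<omega>])
    have "eventually (\<lambda>x. norm (\<Sum>j<M. (eval_fps (a j) (\<zeta> x) * of_real (x ^ (M * N * j))) * \<mu> ^ j)
        \<le> (\<bar>B\<bar> * (l + 2 ^ (M * N)) ^ M + l ^ M * \<bar>BQ\<bar>) * norm (complex_of_real (x ^ (M * N * M)))) (at_right 0)"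
      using eventually_compose_filterlim[OF q lim] eventually_compose_filterlim[OF eval_q lim]
        eventually_compose_filterlim[OF BQ lim] \<tau> pos
    proof eventually_elim
      case (elim x)
      have x: "x > 0" using elim by simp
      define y where "y = x ^ (M * N)"
      have y: "y > 0" using x by (simp add: y_def)
      have yj: "x ^ (M * N * j) = y ^ j" for j by (simp add: y_def power_mult)
      have \<omega>x: "\<omega> x - poly f (\<zeta> x) = \<mu> * of_real y" by (simp add: \<omega>_def y_def)
      have "(norm (\<zeta> x))\<^sup>2 = norm (\<tau> x) ^ (2 * M)" unfolding norm_\<zeta> power_mult[symmetric] by (simp only: mult.commute)
      also have "\<dots> \<le> Im (poly f (\<zeta> x)) + D * y" using elim(4) by (simp add: \<zeta>_def y_def)
      also have "\<dots> < Im (poly f (\<zeta> x)) + l * y" using l0 y by simp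
      also have "\<dots> = Im (poly f (\<zeta> x) + \<i> * of_real (l * y))" by simp
      also have "poly f (\<zeta> x) + \<i> * of_real (l * y) = \<omega> x" by (simp add: \<omega>_def \<mu> y_def)
      finally have U2: "(\<zeta> x, \<omega> x) \<in> U2" by (simp add: U2_def)
      have n1: "norm (\<omega> x - poly f (\<zeta> x)) = l * y" unfolding \<omega>x using l0 y by (simp add: \<mu> norm_mult)
      have "norm (\<tau> x) ^ (M * N) \<le> (2 * x) ^ (M * N)" using elim(4) by (intro power_mono) auto
      hence n2: "norm (\<zeta> x) ^ N \<le> 2 ^ (M * N) * y"
        unfolding norm_\<zeta> power_mult[symmetric] power_mult_distrib y_def .
      have "norm (eval_fps2 q (\<zeta> x) (\<omega> x)) \<le> B * (norm (\<omega> x - poly f (\<zeta> x)) + norm (\<zeta> x) ^ N) ^ M"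
        using elim(1) U2 by simp
      also have "\<dots> \<le> \<bar>B\<bar> * (l * y + 2 ^ (M * N) * y) ^ M"
        unfolding n1 using n2 l0 y by (intro mult_mono power_mono add_left_mono) auto
      also have "\<dots> = \<bar>B\<bar> * (l + 2 ^ (M * N)) ^ M * y ^ M"
        by (simp add: mult.assoc flip: power_mult_distrib distrib_right)
      finally have b1: "norm (eval_fps2 q (\<zeta> x) (\<omega> x)) \<le> \<bar>B\<bar> * (l + 2 ^ (M * N)) ^ M * y ^ M" .
      have "norm ((\<omega> x - poly f (\<zeta> x)) ^ M * eval_fps2 Q (\<zeta> x) (\<omega> x)) \<le> (l * y) ^ M * \<bar>BQ\<bar>"
        unfolding norm_mult norm_power n1 using elim(3) l0 y by (intro mult_left_mono) auto
      hence b2: "norm ((\<omega> x - poly f (\<zeta> x)) ^ M * eval_fps2 Q (\<zeta> x) (\<omega> x)) \<le> l ^ M * \<bar>BQ\<bar> * y ^ M"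
        by (simp add: power_mult_distrib mult_ac)
      \<comment> \<open>Both q and the term with Q are O(y^M) here, so the polynomial in \<mu> with
        coefficients a_j(\<zeta>) y^j is O(y^M) as well.\<close>
      have "(\<Sum>j<M. (eval_fps (a j) (\<zeta> x) * of_real (x ^ (M * N * j))) * \<mu> ^ j)
          = (\<Sum>j<M. eval_fps (a j) (\<zeta> x) * (\<omega> x - poly f (\<zeta> x)) ^ j)"
        unfolding \<omega>x yj by (intro sum.cong refl) (simp add: power_mult_distrib mult_ac)
      also have "\<dots> = eval_fps2 q (\<zeta> x) (\<omega> x) - (\<omega> x - poly f (\<zeta> x)) ^ M * eval_fps2 Q (\<zeta> x) (\<omega> x)"
        using elim(2) by simp
      also have "norm \<dots> \<le> \<bar>B\<bar> * (l + 2 ^ (M * N)) ^ M * y ^ M + l ^ M * \<bar>BQ\<bar> * y ^ M"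
        by (intro order_trans[OF norm_triangle_ineq4] add_mono b1 b2)
      also have "\<dots> = (\<bar>B\<bar> * (l + 2 ^ (M * N)) ^ M + l ^ M * \<bar>BQ\<bar>) * norm (complex_of_real (x ^ (M * N * M)))"
        using y unfolding yj norm_of_real by (simp add: distrib_right)
      finally show ?case .
    qed
    thus ?thesis by (rule bigoI)
  qed
  ultimately have "(\<lambda>x. eval_fps (a j) (\<zeta> x) * of_real (x ^ (M * N * j))) \<in> O[at_right 0](\<lambda>x. of_real (x ^ (M * N * M)))"
    using j by (rule bigo_coeffs_of_bigo_values[where b = "\<lambda>j x. eval_fps (a j) (\<zeta> x) * of_real (x ^ (M * N * j))"])
  from landau_o.bigE[OF this] obtain E where E: "E > 0" "eventually (\<lambda>x. norm (eval_fps (a j) (\<zeta> x) * of_real (x ^ (M * N * j))) \<le> E * norm (complex_of_real (x ^ (M * N * M)))) (at_right 0)"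
    by blast
  \<comment> \<open>Division by y^j leaves x^(MN(M-j)), and x \<le> 2 |\<tau> x| turns this into a
    power of |\<zeta> x|; hence the power of 2.\<close>
  have bound: "eventually (\<lambda>x. norm (eval_fps (a j) (\<zeta> x)) \<le> (E * 2 ^ (M * N * (M - j))) * norm (\<zeta> x) ^ (N * (M - j))) (at_right 0)"
    using E(2) \<tau> pos
  proof eventually_elim
    case (elim x)
    have x: "x > 0" using elim by simp
    have "x ^ (M * N * M) = x ^ (M * N * (M - j)) * x ^ (M * N * j)"
      using j by (simp flip: power_add distrib_left)
    hence "norm (eval_fps (a j) (\<zeta> x)) * x ^ (M * N * j) \<le> (E * x ^ (M * N * (M - j))) * x ^ (M * N * j)"
      using elim(1) x by (simp add: norm_mult norm_power mult.assoc)
    hence "norm (eval_fps (a j) (\<zeta> x)) \<le> E * x ^ (M * N * (M - j))"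
      by (rule mult_right_le_imp_le) (use x in simp)
    also have "\<dots> \<le> E * (2 * norm (\<tau> x)) ^ (M * N * (M - j))"
      using elim(2) x E(1) by (intro mult_left_mono power_mono) auto
    also have "\<dots> = (E * 2 ^ (M * N * (M - j))) * norm (\<zeta> x) ^ (N * (M - j))"
      unfolding norm_\<zeta> power_mult[symmetric] power_mult_distrib by (simp only: mult.assoc)
    finally show ?case .
  qed
  have nz: "eventually (\<lambda>x. \<zeta> x \<noteq> 0) (at_right 0)"
    using \<tau> pos
  proof eventually_elim
    case (elim x)
    hence "norm (\<tau> x) > 0" by linarith
    hence "norm (\<zeta> x) > 0" unfolding norm_\<zeta> by simp
    thus ?case by simp
  qed
  have "fps_conv_radius (a j) > 0" using a[of j] by (simp add: convergent2_const_iff)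
  thus ?thesis
    by (rule fps_nth_eq_0_of_bigo[OF _ _ lim\<zeta> nz bound i]) (simp add: trivial_limit_at_right_real)
qed

section \<open>Equality of the numerator ideal with the product ideal\<close>

theorem theorem1p6:
  fixes p :: "complex poly poly" and M K :: nat and c :: complex
    and \<phi> :: "complex fps" and \<phi>0 :: "complex poly"
  assumes "\<exists>\<epsilon>>0. \<forall>(z, w) \<in> U2 \<inter> ball (0, 0) \<epsilon>. eval_poly2 p z w \<noteq> 0"
    and "M \<ge> 1" and "norm c = 1"
    and "fps_conv_radius \<phi> > 0"
    and "(\<lambda>t. eval_fps \<phi> t - \<i> * t ^ (2 * M)) \<in> o[at 0](\<lambda>t. t ^ (2 * M))"
    and "single_weierstrass_factor p M c \<phi>"
    and "locally_inj_parametrizes (\<lambda>t. (c * t ^ M, eval_fps \<phi> t)) {(z, w). eval_poly2 p z w = 0}"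
    and "isolated_type M \<phi> K"
    and "is_phi0 M \<phi> K \<phi>0"
  shows "admissible_numerators p =
           (genideal conv_ring {w_fps2 - poly_in_z (pcompose \<phi>0 [:0, cnj c:]), z_fps2 ^ (2 * (1 + K))})
             [^]\<^bsub>ideals_set conv_ring\<^esub> M \<and>
         admissible_numerators p =
           genideal conv_ring
             {(w_fps2 - poly_in_z (pcompose \<phi>0 [:0, cnj c:])) ^ j * z_fps2 ^ (2 * (1 + K) * (M - j)) |j. j \<le> M}"
proof -
  note M = assms(2) and c = assms(3) and \<phi>_conv = assms(4)
  define N where "N = 2 * (1 + K)"
  define f where "f = pcompose \<phi>0 [:0, cnj c:]"
  define d where "d = w_fps2 - poly_in_z f"
  define h where "h = (\<lambda>z w. norm (w - poly f z) + norm z ^ N)"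
  define G where "G = {d ^ j * z_fps2 ^ (N * (M - j)) |j. j \<le> M}"
  have f: "poly f z = poly \<phi>0 (cnj c * z)" for z by (simp add: f_def poly_pcompose mult.commute)
  have N: "N \<ge> 1" by (simp add: N_def)
  have \<phi>0: "fps_nth \<phi> 0 = 0" by (rule fps_nth_0_eq_0_of_smallo[OF \<phi>_conv M assms(5)])
  have f0: "poly f 0 = 0" using is_phi0_nhds(1)[OF \<phi>_conv M \<phi>0 assms(9)] by (simp add: f)
  obtain C where C: "C \<ge> 0" "eventually (\<lambda>t. norm (eval_fps \<phi> t - poly \<phi>0 (t ^ M)) \<le> C * norm t ^ (M * N)) (nhds 0)"
    using is_phi0_nhds(2)[OF \<phi>_conv M \<phi>0 assms(9)] unfolding N_def by blast
  obtain \<kappa> where \<kappa>: "\<kappa> > 0" "eventually (\<lambda>t. \<kappa> * norm t ^ (M * N) \<le> norm t ^ (2 * M) - Im (eval_fps \<phi> t)) (nhds 0)"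
    using isolated_type_defect_bounds(1)[OF M \<phi>_conv \<phi>0 assms(8)] unfolding N_def by blast
  obtain \<tau> D where \<tau>: "eventually (\<lambda>x. x / 2 \<le> norm (\<tau> x) \<and> norm (\<tau> x) \<le> 2 * x \<and>
           norm (\<tau> x) ^ (2 * M) - Im (eval_fps \<phi> (\<tau> x)) \<le> D * x ^ (M * N)) (at_right (0::real))"
    using isolated_type_defect_bounds(2)[OF M \<phi>_conv \<phi>0 assms(8)] unfolding N_def by blast
  have h_nonneg: "h z w \<ge> 0" for z w by (simp add: h_def)
  have h_pos: "h z w > 0" if "(z, w) \<in> U2" for z w
  \<comment> \<open>At z = 0 positivity comes from the other summand: f(0) = 0, and w \<noteq> 0 on
    U_2.\<close>
  proof (cases "z = 0")
    case True
    hence "w \<noteq> 0" using that by (auto simp: U2_def)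
    thus ?thesis using True f0 by (simp add: h_def add_pos_nonneg)
  qed (simp add: h_def add_nonneg_pos)
  obtain c1 c2 where c12: "0 < c1" "0 < c2" "eventually (\<lambda>(z, w). (z, w) \<in> U2 \<longrightarrow> (\<forall>t. t ^ M = cnj c * z \<longrightarrow>
            c1 * h z w \<le> norm (w - eval_fps \<phi> t) \<and> norm (w - eval_fps \<phi> t) \<le> c2 * h z w)) (nhds (0, 0))"
    using weierstrass_factor_bounds[OF M c \<kappa>(1) C(1) \<kappa>(2) C(2)] unfolding h_def f by blast
  obtain C1 C2 where C1: "0 < C1" and C12: "eventually (\<lambda>(z, w). (z, w) \<in> U2 \<longrightarrow>
            C1 * h z w ^ M \<le> norm (eval_poly2 p z w) \<and> norm (eval_poly2 p z w) \<le> C2 * h z w ^ M) (nhds (0, 0))"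
    using single_weierstrass_factor_bounds[OF M assms(6) c12(1,2) h_nonneg c12(3)] by blast
  have adm: "admissible_numerators p = {q. convergent2 q \<and> (\<exists>B. eventually (\<lambda>(z, w). (z, w) \<in> U2 \<longrightarrow>
            norm (eval_fps2 q z w) \<le> B * h z w ^ M) (nhds (0, 0)))}"
    by (rule admissible_numerators_eq[OF C1 _ C12]) (rule h_pos)
  have cd: "convergent2 d" unfolding d_def by (rule convergent2_w_minus)
  interpret cring conv_ring by (rule cring_conv_ring)
  have G_conv: "convergent2 g" if "g \<in> G" for g
    using that by (auto simp: G_def intro!: convergent2_mult convergent2_power cd convergent2_z)
  have "admissible_numerators p = genideal conv_ring G"
  proof (rule equalityI)
    show "genideal conv_ring G \<subseteq> admissible_numerators p"
    proof (rule genideal_minimal)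
      show "ideal (admissible_numerators p) conv_ring" unfolding adm by (rule ideal_eval_bounded)
      show "G \<subseteq> admissible_numerators p"
      proof
        fix g assume g: "g \<in> G"
        then obtain j where j: "j \<le> M" and g_eq: "g = d ^ j * z_fps2 ^ (N * (M - j))" by (auto simp: G_def)
        have "eventually (\<lambda>(z, w). (z, w) \<in> U2 \<longrightarrow> norm (eval_fps2 g z w) \<le> 1 * h z w ^ M) (nhds (0, 0))"
          unfolding g_eq
          using eval_fps2_mult[OF convergent2_power[OF cd] convergent2_power[OF convergent2_z], of j "N * (M - j)"]
            eval_fps2_power[OF cd, of j] eval_fps2_power[OF convergent2_z, of "N * (M - j)"]
            eval_fps2_w_minus[of f, folded d_def] eval_fps2_z
        proof eventually_elim
          case (elim x)
          obtain z w where x: "x = (z, w)" by fastforce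
          have "norm (eval_fps2 (d ^ j * z_fps2 ^ (N * (M - j))) z w) = norm (w - poly f z) ^ j * (norm z ^ N) ^ (M - j)"
            using elim by (simp add: x norm_mult norm_power power_mult)
          also have "\<dots> \<le> h z w ^ j * h z w ^ (M - j)"
            unfolding h_def by (intro mult_mono power_mono) auto
          also have "\<dots> = h z w ^ M" using j by (simp flip: power_add)
          finally show ?case by (simp add: x)
        qed
        thus "g \<in> admissible_numerators p" unfolding adm using G_conv[OF g] by blast
      qed
    qed
    show "admissible_numerators p \<subseteq> genideal conv_ring G"
    proof
      fix q assume "q \<in> admissible_numerators p"
      then obtain B where q: "convergent2 q"
        and B: "eventually (\<lambda>(z, w). (z, w) \<in> U2 \<longrightarrow> norm (eval_fps2 q z w) \<le> B * (norm (w - poly f z) + norm z ^ N) ^ M) (nhds (0, 0))"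
        unfolding adm h_def by blast
      have cf: "convergent2 (fps_const (fps_of_poly f))" by (simp add: convergent2_const_iff)
      have "fps_nth (fps_of_poly f) 0 = 0" using f0 by (simp add: poly_0_coeff_0)
      from convergent2_taylor_linear[OF q cf this, of M] obtain a Q where a: "\<And>j. convergent2 (fps_const (a j))" and Q: "convergent2 Q"
        and q_eq: "q = (\<Sum>j<M. fps_const (a j) * d ^ j) + d ^ M * Q"
        unfolding d_def poly_in_z_def by blast
      have lim\<tau>: "(\<tau> \<longlongrightarrow> 0) (at_right 0)"
      proof (rule Lim_null_comparison)
        show "eventually (\<lambda>x. norm (\<tau> x) \<le> 2 * x) (at_right 0)" using \<tau> by eventually_elim auto
        show "((\<lambda>x::real. 2 * x) \<longlongrightarrow> 0) (at_right 0)"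
          using tendsto_mult[OF tendsto_const tendsto_ident_at, of 2 "0::real" "{0<..}"] by simp
      qed
      \<comment> \<open>As |c| = 1, the point z = c \<tau>^M satisfies conj(c) z = \<tau>^M, so f(z)
        is \<phi>0 at \<tau>^M.\<close>
      have cc: "cnj c * (c * z) = z" for z
        using c complex_norm_square[of c] by (simp add: mult.assoc[symmetric] mult.commute)
      \<comment> \<open>Replacing phi by \<phi>0 along the curve costs C |\<tau> x|^(MN), at most C
        2^(MN) x^(MN).\<close>
      have \<tau>': "eventually (\<lambda>x. x / 2 \<le> norm (\<tau> x) \<and> norm (\<tau> x) \<le> 2 * x \<and>
           norm (\<tau> x) ^ (2 * M) - Im (poly f (c * \<tau> x ^ M)) \<le> (D + C * 2 ^ (M * N)) * x ^ (M * N)) (at_right 0)"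
        using \<tau> eventually_compose_filterlim[OF C(2) lim\<tau>]
      proof eventually_elim
        case (elim x)
        have "norm (\<tau> x) ^ (M * N) \<le> (2 * x) ^ (M * N)" using elim by (intro power_mono) auto
        hence "C * norm (\<tau> x) ^ (M * N) \<le> C * (2 ^ (M * N) * x ^ (M * N))"
          unfolding power_mult_distrib using C(1) by (rule mult_left_mono)
        moreover have "\<bar>Im (eval_fps \<phi> (\<tau> x) - poly \<phi>0 (\<tau> x ^ M))\<bar> \<le> C * norm (\<tau> x) ^ (M * N)"
          using elim(2) abs_Im_le_cmod order_trans by blast
        ultimately have "Im (eval_fps \<phi> (\<tau> x)) - Im (poly \<phi>0 (\<tau> x ^ M)) \<le> C * 2 ^ (M * N) * x ^ (M * N)"
          by simp
        thus ?case using elim(1) by (simp add: f cc distrib_right)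
      qed
      have "\<exists>b. convergent2 b \<and> fps_const (a j) = b * z_fps2 ^ (N * (M - j))" if j: "j < M" for j
        using convergent2_const_shift[OF a, of "N * (M - j)" j]
          taylor_coeffs_vanish[OF M N c f0 B a Q q_eq[unfolded d_def] \<tau>' j] by metis
      then obtain b where b: "\<And>j. j < M \<Longrightarrow> convergent2 (b j)"
        "\<And>j. j < M \<Longrightarrow> fps_const (a j) = b j * z_fps2 ^ (N * (M - j))" by metis
      have "(\<Sum>j<M. fps_const (a j) * d ^ j) = (\<Sum>j<M. (if j < M then b j else Q) * (d ^ j * z_fps2 ^ (N * (M - j))))"
        by (intro sum.cong refl) (auto simp: b(2) mult_ac)
      \<comment> \<open>The index j = M takes in the remainder: there the generator is d^M, with
        z-exponent 0, and its cofactor is Q.\<close>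
      hence "q = (\<Sum>j\<le>M. (if j < M then b j else Q) * (d ^ j * z_fps2 ^ (N * (M - j))))"
        unfolding q_eq by (simp add: mult.commute flip: lessThan_Suc_atMost)
      also have "\<dots> \<in> genideal conv_ring G"
      proof (rule sum_in_genideal_conv_ring)
        fix j assume "j \<in> {..M}"
        hence "d ^ j * z_fps2 ^ (N * (M - j)) \<in> G" by (auto simp: G_def)
        thus "convergent2 (if j < M then b j else Q) \<and> d ^ j * z_fps2 ^ (N * (M - j)) \<in> G"
          using b(1) Q by simp
      qed (use G_conv in auto)
      finally show "q \<in> genideal conv_ring G" .
    qed
  qed
  moreover have "(genideal conv_ring {d, z_fps2 ^ N}) [^]\<^bsub>ideals_set conv_ring\<^esub> M = genideal conv_ring G"
  proof -
    have "z_fps2 ^ N \<in> carrier conv_ring" "d \<in> carrier conv_ring"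
      using cd convergent2_power[OF convergent2_z] by simp_all
    from genideal_pair_power[OF this(2,1), of M] show ?thesis
      by (simp add: G_def flip: power_mult)
  qed
  ultimately show ?thesis unfolding G_def d_def f_def N_def by simp
qed

end
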